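(* Let $M_i,L_i\ge0$ and suppose each $Q_i$ ($1\le i\le n$) is monotone and $M_i$-Lipschitz on $\mathcal Z$ with respect to $\|\cdot\|_{\mathbf P}$, and that the functions $p_i$ satisfy the stochastic first-order oracle assumption of the context with constants $L_i$ and $\sigma_i$. Let $T_1,\dots,T_n$ be positive integers, $A_i:=\prod_{j=1}^iT_j$, and let $\tau_1,\dots,\tau_n\ge0$ with $\tau_i>0$ whenever $\sigma_i>0$ and $L_i+\tau_i+M_i>0$ for all $i$. Run the stochastic Sliding Algorithm (described in the context) with $\alpha_0=1$, $\alpha_{t+1}=2/(1+\sqrt{1+4/\alpha_t^2})$, and $$\eta^k_{\mathbf t}=(L_k+\tau_k)\prod_{\ell=1}^k\alpha_{t_\ell}+M_k\prod_{\ell=1}^k\frac{\alpha_{t_\ell}}{\alpha_{T_\ell-1}},\qquad\mathbf t=(t_1,\dots,t_k),$$ from an $\mathcal F_0$-measurable input $z_{\mathrm{in}}$. Let $\mathcal Z$ be bounded, and assume that a deterministic constant $0<\Omega<\infty$ satisfies $\sup_{z\in\mathcal Z}\|z_{\mathrm{in}}-z\|_{\mathbf P}^2\le\Omega$ almost surely. Then $$\mathbb E\Big[\sup_{z\in\mathcal Z}\big\{p(z_{\mathrm{out}})-p(z)+\langle Q(z),z_{\mathrm{out}}-z\rangle\big\}\Big]\le\sum_{i=1}^n\frac{2^{2i-1}(L_i+\tau_i)\Omega}{A_i^2}+\sum_{i=1}^n\frac{2^{i-1}M_i\Omega}{A_i}+\sum_{i=1}^n\frac{\sigma_i^2A_i}{2\tau_i}+\sqrt\Omega\sum_{i=1}^n\frac{2^{i/2}\sigma_i}{\sqrt{A_i}},$$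 with the convention $\sigma_i^2/(2\tau_i):=0$ when $\sigma_i=\tau_i=0$.
   Context: Setting. $\mathcal Z\subseteq\mathbb R^{d_z}$ is nonempty, closed and convex; $p=\sum_{i=1}^np_i$, $Q=\sum_{i=1}^nQ_i$, with $p_i:\mathcal Z\to\mathbb R$ convex and $Q_i:\mathcal Z\to\mathbb R^{d_z}$ continuous and monotone. $\mathbf P$ is symmetric positive definite, $\|z\|_{\mathbf P}=\langle\mathbf Pz,z\rangle^{1/2}$, $\|s\|_{\mathbf P,*}=\|s\|_{\mathbf P^{-1}}=\langle s,\mathbf P^{-1}s\rangle^{1/2}$. $G$ is monotone if $\langle G(u)-G(v),u-v\rangle\ge0$, and $M$-Lipschitz with respect to $\|\cdot\|_{\mathbf P}$ if $\|G(u)-G(v)\|_{\mathbf P^{-1}}\le M\|u-v\|_{\mathbf P}$. Stochastic Sliding Algorithm. Oracle-call nodes are $\nu=(k,\mathbf t)$ with $1\le k\le n$, $\mathbf t=(t_1,\dots,t_k)$, $0\le t_\ell<T_\ell$; at node $\nu$ a fresh sample $\xi_\nu$ is drawn. Set $z^k_{(0,\dots,0)}=z_{\mathrm{in}}\in\mathcal Z$ ($k$ zeros), $k=1,\dots,n$; output $z_{\mathrm{out}}=\mathrm{Rec}(0,\varnothing)$, where $\mathrm{Rec}(k,\mathbf t)$, $\mathbf t=(t_1,\dots,t_k)$, is: (a) If $k=n$, return $\operatorname{argmin}_{z\in\mathcal Z}\sum_{i=1}^n\{\langle G_i(w^i_{(t_1,\dots,t_i)},\xi_{(i,(t_1,\dots,t_i))})+Q_i(z^i_{(t_1,\dots,t_i)}),z\rangle+\tfrac12\eta^i_{(t_1,\dots,t_i)}\|z-z^i_{(t_1,\dots,t_i)}\|_{\mathbf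 P}^2\}$. (b) If $k<n$, set $\bar z^{k+1}_{(\mathbf t,0)}=z^{k+1}_{(\mathbf t,0)}$. For $j=0,\dots,T_{k+1}-1$, with $\mathbf t'=(\mathbf t,j)$, $\mathbf t''=(\mathbf t,j+1)$: evaluate $G_{k+1}(w^{k+1}_{\mathbf t'},\xi_{(k+1,\mathbf t')})$ once; $\tilde z^{k+1}_{\mathbf t'}=\mathrm{Rec}(k+1,\mathbf t')$; $\bar z^{k+1}_{\mathbf t''}=\alpha_j\tilde z^{k+1}_{\mathbf t'}+(1-\alpha_j)\bar z^{k+1}_{\mathbf t'}$; $z^{k+1}_{\mathbf t''}=\operatorname{argmin}_{z\in\mathcal Z}\{\langle Q_{k+1}(\tilde z^{k+1}_{\mathbf t'})-Q_{k+1}(z^{k+1}_{\mathbf t'}),z\rangle+\tfrac12\eta^{k+1}_{\mathbf t'}\|z-\tilde z^{k+1}_{\mathbf t'}\|_{\mathbf P}^2\}$; for $\ell=k+2,\dots,n$, $z^\ell_{(\mathbf t'',0,\dots,0)}=z^\ell_{(\mathbf t',T_{k+2},0,\dots,0)}$ (zero-padded to length $\ell$). Return $\bar z^{k+1}_{(\mathbf t,T_{k+1})}$. Here $w^i_{(t_1,\dots,t_i)}=(a_1\circ\cdots\circ a_i)(z^i_{(t_1,\dots,t_i)})$, $a_\ell(z)=\alpha_{t_\ell}z+(1-\alpha_{t_\ell})\bar z^\ell_{(t_1,\dots,t_\ell)}$. Filtration. Enumerate the nodes $\nu_1,\dots,\nu_N$ in execution order; $\mathcal F_0=\sigma(z_{\mathrm{in}})$,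 $\mathcal F_m=\mathcal F_0\vee\sigma(\xi_{\nu_1},\dots,\xi_{\nu_m})$, and $\mathcal F_{\nu_m}:=\mathcal F_{m-1}$ is the history before the call at $\nu_m$. Stochastic first-order oracle assumption. For every $i$, $p_i$ is convex and differentiable on $\mathcal Z$ with $L_i$-Lipschitz gradient with respect to $\|\cdot\|_{\mathbf P}$, hence $0\le p_i(u)-p_i(v)-\langle\nabla p_i(v),u-v\rangle\le\frac{L_i}2\|u-v\|_{\mathbf P}^2$ for $u,v\in\mathcal Z$; and there is a measurable map $G_i$ such that, with $\varepsilon_i(v,\xi)=G_i(v,\xi)-\nabla p_i(v)$, for every node $\nu$ and every $\mathcal F_\nu$-measurable $v\in\mathcal Z$, almost surely $\mathbb E[\varepsilon_i(v,\xi_\nu)\mid\mathcal F_\nu]=0$ and $\mathbb E[\|\varepsilon_i(v,\xi_\nu)\|_{\mathbf P,*}^2\mid\mathcal F_\nu]\le\sigma_i^2$. *)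

theory Defs
  imports "HOL-Probability.Probability"
begin

section \<open>Geometry\<close>

definition sym_pos_def :: "real^'d^'d \<Rightarrow> bool" where
  "sym_pos_def P \<longleftrightarrow> transpose P = P \<and> (\<forall>x. x \<noteq> 0 \<longrightarrow> (P *v x) \<bullet> x > 0)"

definition mnorm :: "real^'d^'d \<Rightarrow> real^'d \<Rightarrow> real" where
  "mnorm P z = sqrt ((P *v z) \<bullet> z)"

definition dual_mnorm :: "real^'d^'d \<Rightarrow> real^'d \<Rightarrow> real" where
  "dual_mnorm P s = mnorm (matrix_inv P) s"

definition monotone_map_on :: "(real^'d) set \<Rightarrow> (real^'d \<Rightarrow> real^'d) \<Rightarrow> bool" where
  "monotone_map_on Z F \<longleftrightarrow> (\<forall>u\<in>Z. \<forall>v\<in>Z. (F u - F v) \<bullet> (u - v) \<ge> 0)"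

definition mlipschitz_on ::
  "real^'d^'d \<Rightarrow> real \<Rightarrow> (real^'d) set \<Rightarrow> (real^'d \<Rightarrow> real^'d) \<Rightarrow> bool" where
  "mlipschitz_on P C Z F \<longleftrightarrow>
     (\<forall>u\<in>Z. \<forall>v\<in>Z. dual_mnorm P (F u - F v) \<le> C * mnorm P (u - v))"

section \<open>Parameters\<close>

fun alpha :: "nat \<Rightarrow> real" where
  "alpha 0 = 1"
| "alpha (Suc t) = 2 / (1 + sqrt (1 + 4 / (alpha t)\<^sup>2))"

text \<open>Level parameters such as \<^term>\<open>T\<close> are indexed from 1, whereas lists are indexed from 0:
  the component $t_l$ of a multi-index is \<^term>\<open>t ! (l - 1)\<close>.\<close>

definition eta :: "(nat \<Rightarrow> real) \<Rightarrow> (nat \<Rightarrow> real) \<Rightarrow> (nat \<Rightarrow> real) \<Rightarrow> (nat \<Rightarrow> nat)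
    \<Rightarrow> nat \<Rightarrow> nat list \<Rightarrow> real" where
  "eta L \<tau> M T k t =
     (L k + \<tau> k) * (\<Prod>l=1..k. alpha (t ! (l - 1)))
     + M k * (\<Prod>l=1..k. alpha (t ! (l - 1)) / alpha (T l - 1))"

section \<open>The stochastic sliding algorithm\<close>

text \<open>A node $(k, t)$ is represented by the list \<^term>\<open>t\<close> alone, since $k$ is its length. The
  iterates $z^k_t$ and $\bar z^k_t$ are stored in two tables indexed by lists, which form the
  program state. The function \<^term>\<open>\<xi>\<close> gives the realised sample of each node, so that the oracle
  answer at a node is a fixed value, however often the formulas below mention it.\<close>

type_synonym 'd table = "nat list \<Rightarrow> real^'d"

text \<open>The query point $w^i_t = (a_1 \circ \cdots \circ a_i)(z^i_t)$, with $i$ the length of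
  \<^term>\<open>t\<close>.\<close>

definition query_point :: "'d::finite table \<Rightarrow> 'd table \<Rightarrow> nat list \<Rightarrow> real^'d" where
  "query_point z zbar t =
     foldr (\<lambda>l x. alpha (t ! (l - 1)) *\<^sub>R x + (1 - alpha (t ! (l - 1))) *\<^sub>R zbar (take l t))
       [1..<Suc (length t)] (z t)"

definition leaf_step :: "nat \<Rightarrow> (real^'d) set \<Rightarrow> real^'d^'d \<Rightarrow> (nat \<Rightarrow> real^'d \<Rightarrow> real^'d)
    \<Rightarrow> (nat \<Rightarrow> real^'d \<Rightarrow> 's \<Rightarrow> real^'d) \<Rightarrow> (nat \<Rightarrow> nat list \<Rightarrow> real) \<Rightarrow> (nat list \<Rightarrow> 's)
    \<Rightarrow> nat list \<Rightarrow> 'd::finite table \<Rightarrow> 'd table \<Rightarrow> real^'d" where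
  "leaf_step n Z P Q G \<eta> \<xi> t z zbar =
     arg_min_on (\<lambda>u. \<Sum>i=1..n.
         (G i (query_point z zbar (take i t)) (\<xi> (take i t)) + Q i (z (take i t))) \<bullet> u
         + 1/2 * \<eta> i (take i t) * (mnorm P (u - z (take i t)))\<^sup>2) Z"

text \<open>The carry-over $z^l_{(t, j+1, 0, \ldots, 0)} := z^l_{(t, j, T_{k+2}, 0, \ldots, 0)}$ for
  $l = k+2, \ldots, n$, where $k$ is the length of \<^term>\<open>t\<close> and indices are padded to length $l$.\<close>

definition carry_over :: "nat \<Rightarrow> (nat \<Rightarrow> nat) \<Rightarrow> nat list \<Rightarrow> nat \<Rightarrow> 'd::finite table \<Rightarrow> 'd table" where
  "carry_over n T t j z =
     (let k = length t in
      fold (\<lambda>l z. z(t @ [j + 1] @ replicate (l - (k + 1)) 0 :=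
                    z (t @ [j, T (k + 2)] @ replicate (l - (k + 2)) 0)))
        [k + 2..<n + 1] z)"

text \<open>One pass of the loop body at \<^term>\<open>t\<close>; \<^term>\<open>R\<close> is the recursive procedure at the next
  level, returning a point and the updated tables.\<close>

definition loop_body :: "nat \<Rightarrow> (nat \<Rightarrow> nat) \<Rightarrow> (real^'d) set \<Rightarrow> real^'d^'d
    \<Rightarrow> (nat \<Rightarrow> real^'d \<Rightarrow> real^'d) \<Rightarrow> (nat \<Rightarrow> nat list \<Rightarrow> real)
    \<Rightarrow> (nat list \<Rightarrow> 'd table \<times> 'd table \<Rightarrow> (real^'d) \<times> ('d::finite table \<times> 'd table))
    \<Rightarrow> nat list \<Rightarrow> nat \<Rightarrow> 'd table \<times> 'd table \<Rightarrow> 'd table \<times> 'd table" where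
  "loop_body n T Z P Q \<eta> R t j s =
     (let k = length t;
          t' = t @ [j];
          t'' = t @ [j + 1];
          (zt, (z, zbar)) = R t' s;
          zbar = zbar(t'' := alpha j *\<^sub>R zt + (1 - alpha j) *\<^sub>R zbar t');
          z = z(t'' := arg_min_on (\<lambda>u. (Q (k + 1) zt - Q (k + 1) (z t')) \<bullet> u
                          + 1/2 * \<eta> (k + 1) t' * (mnorm P (u - zt))\<^sup>2) Z)
      in (carry_over n T t j z, zbar))"

text \<open>The recursive procedure; its first explicit argument after the problem data is the number
  $n - k$ of levels below \<^term>\<open>t\<close>.\<close>

primrec sliding_rec :: "nat \<Rightarrow> (nat \<Rightarrow> nat) \<Rightarrow> (real^'d) set \<Rightarrow> real^'d^'d
    \<Rightarrow> (nat \<Rightarrow> real^'d \<Rightarrow> real^'d) \<Rightarrow> (nat \<Rightarrow> real^'d \<Rightarrow> 's \<Rightarrow> real^'d)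
    \<Rightarrow> (nat \<Rightarrow> nat list \<Rightarrow> real) \<Rightarrow> (nat list \<Rightarrow> 's)
    \<Rightarrow> nat \<Rightarrow> nat list \<Rightarrow> 'd table \<times> 'd table \<Rightarrow> (real^'d) \<times> ('d::finite table \<times> 'd table)" where
  "sliding_rec n T Z P Q G \<eta> \<xi> 0 =
     (\<lambda>t s. (leaf_step n Z P Q G \<eta> \<xi> t (fst s) (snd s), s))"
| "sliding_rec n T Z P Q G \<eta> \<xi> (Suc d) =
     (\<lambda>t (z, zbar).
        let s = fold (loop_body n T Z P Q \<eta> (sliding_rec n T Z P Q G \<eta> \<xi> d) t)
                  [0..<T (length t + 1)] (z, zbar(t @ [0] := z (t @ [0])))
        in (snd s (t @ [T (length t + 1)]), s))"

text \<open>Only the entries of the first table at all-zero indices are initial data. Every other entry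
  is assigned before it is read, so its initial value is immaterial.\<close>

definition sliding_output :: "nat \<Rightarrow> (nat \<Rightarrow> nat) \<Rightarrow> (real^'d) set \<Rightarrow> real^'d^'d
    \<Rightarrow> (nat \<Rightarrow> real^'d \<Rightarrow> real^'d) \<Rightarrow> (nat \<Rightarrow> real^'d \<Rightarrow> 's \<Rightarrow> real^'d)
    \<Rightarrow> (nat \<Rightarrow> nat list \<Rightarrow> real) \<Rightarrow> (nat list \<Rightarrow> 's) \<Rightarrow> real^'d \<Rightarrow> real^'d::finite" where
  "sliding_output n T Z P Q G \<eta> \<xi> zin =
     fst (sliding_rec n T Z P Q G \<eta> \<xi> n [] (\<lambda>_. zin, \<lambda>_. zin))"

section \<open>Execution order, filtration and oracle\<close>

text \<open>The nodes called within the procedure at \<^term>\<open>t\<close>, in execution order: each pass of the loop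
  first calls the oracle at $(t, j)$ and then descends.\<close>

primrec oracle_calls :: "(nat \<Rightarrow> nat) \<Rightarrow> nat \<Rightarrow> nat list \<Rightarrow> nat list list" where
  "oracle_calls T 0 = (\<lambda>t. [])"
| "oracle_calls T (Suc d) =
     (\<lambda>t. concat (map (\<lambda>j. (t @ [j]) # oracle_calls T d (t @ [j])) [0..<T (length t + 1)]))"

text \<open>The $\sigma$-algebra generated by the input and the samples of the first \<^term>\<open>m\<close> calls. As
  lists are indexed from 0, it is the history before the call at node \<^term>\<open>nodes ! m\<close>.\<close>

definition history :: "'w measure \<Rightarrow> 's measure \<Rightarrow> ('w \<Rightarrow> real^'d) \<Rightarrow> (nat list \<Rightarrow> 'w \<Rightarrow> 's)
    \<Rightarrow> nat list list \<Rightarrow> nat \<Rightarrow> 'w measure" where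
  "history Pr S zin \<xi> nodes m =
     sigma (space Pr)
       ({zin -` B \<inter> space Pr | B. B \<in> sets borel}
        \<union> (\<Union>\<nu>\<in>set (take m nodes). {\<xi> \<nu> -` A \<inter> space Pr | A. A \<in> sets S}))"

definition vec_cond_exp ::
  "'w measure \<Rightarrow> 'w measure \<Rightarrow> ('w \<Rightarrow> real^'d) \<Rightarrow> 'w \<Rightarrow> real^'d" where
  "vec_cond_exp Pr F f \<omega> = (\<chi> c. real_cond_exp Pr F (\<lambda>\<omega>'. f \<omega>' $ c) \<omega>)"

text \<open>The oracle assumption for one component \<^term>\<open>f\<close> with gradient \<^term>\<open>gf\<close> and stochastic
  oracle \<^term>\<open>g\<close>. Differentiability is relative to \<^term>\<open>Z\<close>, where \<^term>\<open>f\<close> lives; if \<^term>\<open>Z\<close> has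
  empty interior, the gradient is not determined by \<^term>\<open>f\<close> and \<^term>\<open>gf\<close> is any Lipschitz choice
  of it. The conditional second moment is taken in the extended nonnegative reals, so the bound
  includes square integrability of the error.\<close>

definition stochastic_oracle :: "'w measure \<Rightarrow> 's measure \<Rightarrow> ('w \<Rightarrow> real^'d)
    \<Rightarrow> (nat list \<Rightarrow> 'w \<Rightarrow> 's) \<Rightarrow> nat list list \<Rightarrow> (real^'d) set \<Rightarrow> real^'d^'d
    \<Rightarrow> (real^'d \<Rightarrow> real) \<Rightarrow> (real^'d \<Rightarrow> real^'d) \<Rightarrow> (real^'d \<Rightarrow> 's \<Rightarrow> real^'d)
    \<Rightarrow> real \<Rightarrow> real \<Rightarrow> bool" where
  "stochastic_oracle Pr S zin \<xi> nodes Z P f gf g L \<sigma> \<longleftrightarrow>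
     convex_on Z f
     \<and> (\<forall>v\<in>Z. (f has_derivative (\<lambda>h. gf v \<bullet> h)) (at v within Z))
     \<and> mlipschitz_on P L Z gf
     \<and> (\<lambda>(v, x). g v x) \<in> borel_measurable (restrict_space borel Z \<Otimes>\<^sub>M S)
     \<and> (\<forall>m < length nodes. \<forall>v.
          v \<in> borel_measurable (history Pr S zin \<xi> nodes m) \<and> (\<forall>\<omega>\<in>space Pr. v \<omega> \<in> Z) \<longrightarrow>
          (AE \<omega> in Pr. vec_cond_exp Pr (history Pr S zin \<xi> nodes m)
             (\<lambda>\<omega>. g (v \<omega>) (\<xi> (nodes ! m) \<omega>) - gf (v \<omega>)) \<omega> = 0)
          \<and> (AE \<omega> in Pr. nn_cond_exp Pr (history Pr S zin \<xi> nodes m)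
             (\<lambda>\<omega>. ennreal ((dual_mnorm P (g (v \<omega>) (\<xi> (nodes ! m) \<omega>) - gf (v \<omega>)))\<^sup>2)) \<omega>
             \<le> ennreal (\<sigma>\<^sup>2)))"

end

theory Submission
  imports Defs
begin

text \<open>
  Why the theorem is true. Along one realised run, attach to every call node \<open>t\<close> of level \<open>k\<close> the
  product \<open>\<pi> t\<close> of its \<open>alpha\<close>-factors and the weight \<open>W t\<close>, the product over its components of
  \<open>(alpha (T l - 1))\<^sup>2 / alpha j\<close>. The weights are the coefficients with which the points returned by the
  inner loops enter the final average: the recurrence of \<open>alpha\<close> says
  \<open>(1 - alpha (t + 1)) / (alpha (t + 1))\<^sup>2 = 1 / (alpha t)\<^sup>2\<close>, so dividing one averaging step by
  \<open>(alpha j)\<^sup>2\<close> turns a loop into a telescoping sum. The parameters \<open>\<eta>\<close> are chosen such that \<open>W t * \<eta> t\<close> is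
  a constant \<open>K k\<close> of the level.

  On each node the gap of the levels \<open>i \<le> k\<close> is measured by their linearised and regularised
  models, that of the levels \<open>i > k\<close> by the true functions at the point that the averaging maps make of
  the current iterate, rescaled by \<open>1 / \<pi> t\<close> (\<open>mixed_gap\<close>). Lemma \<open>node_step\<close> trades the true gap of one
  level for its model gap. It combines the smoothness and convexity of \<open>p\<close>, the extragradient step for
  \<open>Q\<close>, and Young's inequality for the oracle error; the price is a difference of squared distances and a
  noise term. At a leaf all levels are modelled, and the minimality of the leaf step makes the sum of the
  models nonpositive. Going back up the recursion (\<open>energy\<close>), the squared distances telescope inside
  every loop, and the carry-over joins the end of one inner loop to the beginning of the next. Only
  \<open>K i / 2\<close> times the squared distance to the starting point survives for each level.

  The noise splits into three parts: a quadratic one, a martingale tested against \<open>v - zin\<close>, and a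
  sum of increments tested against points known before the call. Taking the supremum over \<open>v\<close> costs
  the factor \<open>sqrt \<Omega>\<close> times the dual norm of the martingale, whose second moment is the weighted sum of
  the variances (\<open>martingale_second_moment\<close>); the last part has expectation zero. Sums of products of
  node components factor over the levels, and \<open>alpha (T - 1) \<le> 2 / (T + 1)\<close> evaluates each factor.

  Both the deterministic inequality and the measurability of the iterates use only the equations that the
  final tables satisfy (\<open>trace\<close>), because no entry changes after it has been read. The execution of the
  program is therefore analysed once, in \<open>Rec_trace\<close>.
\<close>

section \<open>The geometry of a positive definite quadratic form\<close>

locale spd =
  fixes P :: "real^'d^'d"
  assumes spd: "sym_pos_def P"
begin

definition q :: "real^'d \<Rightarrow> real" where "q x = (P *v x) \<bullet> x"

lemma P_sym: "(P *v x) \<bullet> y = (P *v y) \<bullet> x"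
proof -
  have "(P *v x) \<bullet> y = x \<bullet> (transpose P *v y)"
    by (metis dot_lmul_matrix inner_commute transpose_matrix_vector)
  then show ?thesis using spd by (simp add: sym_pos_def_def inner_commute del: transpose_matrix_vector)
qed

lemma q_pos: "x \<noteq> 0 \<Longrightarrow> q x > 0"
  using spd by (simp add: q_def sym_pos_def_def)

lemma q_nonneg[simp]: "q x \<ge> 0"
  using q_pos[of x] by (cases "x = 0") (auto simp: q_def)

lemma mnorm_sq[simp]: "(mnorm P x)\<^sup>2 = q x"
  using q_nonneg[of x] by (simp add: mnorm_def q_def)

lemma mnorm_nonneg[simp]: "mnorm P x \<ge> 0"
  using q_nonneg[of x] by (simp add: mnorm_def q_def)

lemma q_add: "q (x + y) = q x + 2 * ((P *v x) \<bullet> y) + q y"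
  using P_sym[of x y] by (simp add: q_def matrix_vector_right_distrib inner_add_left inner_add_right)

lemma q_scale: "q (c *\<^sub>R x) = c\<^sup>2 * q x"
  by (simp add: q_def matrix_vector_mult_scaleR power2_eq_square)

lemma q_minus: "q (- x) = q x"
  using q_scale[of "-1" x] by simp

lemma q_diff_commute: "q (x - y) = q (y - x)"
  using q_minus[of "x - y"] by simp

lemma q_diff: "q (x - y) = q x - 2 * ((P *v x) \<bullet> y) + q y"
  using q_add[of x "-y"] q_scale[of "-1" y]
  by (simp add: matrix_vector_mult_scaleR)

lemma mnorm_scale: "mnorm P (c *\<^sub>R x) = \<bar>c\<bar> * mnorm P x"
  by (rule power2_eq_imp_eq) (simp_all add: power_mult_distrib q_scale)

lemma cauchy_schwarz: "(P *v x) \<bullet> y \<le> mnorm P x * mnorm P y"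
proof (cases "y = 0")
  case False
  let ?b = "(P *v x) \<bullet> y"
  have "0 \<le> q (x - (?b / q y) *\<^sub>R y)" by simp
  also have "\<dots> = q x - ?b\<^sup>2 / q y"
    using q_pos[OF False] by (simp add: q_diff q_scale) (simp add: field_simps power2_eq_square)
  finally have "?b\<^sup>2 \<le> q x * q y"
    using q_pos[OF False] by (simp add: field_simps)
  also have "\<dots> = (mnorm P x * mnorm P y)\<^sup>2" by (simp add: power_mult_distrib)
  finally show ?thesis by (rule power2_le_imp_le) simp
qed simp

lemma P_inv: "P *v (matrix_inv P *v s) = s"
proof -
  have "\<And>x. P *v x = 0 \<Longrightarrow> x = 0" using q_pos by (force simp: q_def)
  then have "invertible P"
    using invertible_left_inverse matrix_left_invertible_ker by metis
  then have "P ** matrix_inv P = mat 1"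
    unfolding invertible_def matrix_inv_def by (metis (mono_tags, lifting) someI_ex)
  then show ?thesis by (simp add: matrix_vector_mul_assoc)
qed

lemma dual_mnorm_eq: "dual_mnorm P s = mnorm P (matrix_inv P *v s)"
  by (simp add: dual_mnorm_def mnorm_def P_inv inner_commute)

lemma dual_cauchy_schwarz: "s \<bullet> x \<le> dual_mnorm P s * mnorm P x"
  using cauchy_schwarz[of "matrix_inv P *v s" x] by (simp add: P_inv dual_mnorm_eq)

lemma dual_mnorm_nonneg[simp]: "dual_mnorm P s \<ge> 0"
  by (simp add: dual_mnorm_eq)

lemma dual_mnorm_minus: "dual_mnorm P (- s) = dual_mnorm P s"
  by (simp add: dual_mnorm_def mnorm_def minus_mult_minus flip: matrix_vector_mult_scaleR)
   (metis (no_types, lifting) inner_minus_left inner_minus_right matrix_vector_mult_scaleR minus_minus scaleR_minus1_left)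

lemma young:
  assumes "c > 0"
  shows "s \<bullet> x \<ge> - (dual_mnorm P s)\<^sup>2 / (2 * c) - c / 2 * q x"
proof -
  let ?a = "dual_mnorm P s" and ?b = "mnorm P x"
  have "- (s \<bullet> x) \<le> ?a * ?b"
    using dual_cauchy_schwarz[of "-s" x] by (simp add: dual_mnorm_minus)
  also have "\<dots> \<le> ?a\<^sup>2 / (2 * c) + c / 2 * ?b\<^sup>2"
  proof -
    have "0 \<le> (?a - c * ?b)\<^sup>2 / (2 * c)" using assms by simp
    also have "\<dots> = ?a\<^sup>2 / (2 * c) + c / 2 * ?b\<^sup>2 - ?a * ?b"
      using assms by (simp add: power2_eq_square field_simps)
    finally show ?thesis by simp
  qed
  finally show ?thesis by simp
qed

text \<open>Testing \<open>v\<close> against itself gives \<open>(norm v)\<^sup>2 \<le> dual_mnorm P v * mnorm P v\<close>, and the dual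
  norm is at most a multiple of the norm because the inverse matrix is a bounded map.\<close>

lemma norm_le_mnorm: "\<exists>C>0. \<forall>v. norm v \<le> C * mnorm P v"
proof -
  obtain K where K: "K > 0" "\<And>v. norm (matrix_inv P *v v) \<le> norm v * K"
    using bounded_linear.pos_bounded[OF matrix_vector_mul_bounded_linear[of "matrix_inv P"]] by blast
  have "norm v \<le> sqrt K * mnorm P v" for v
  proof (cases "v = 0")
    case False
    have "(dual_mnorm P v)\<^sup>2 = v \<bullet> (matrix_inv P *v v)"
      unfolding dual_mnorm_eq mnorm_sq by (simp add: q_def P_inv)
    also have "\<dots> \<le> norm v * norm (matrix_inv P *v v)" by (rule norm_cauchy_schwarz)
    also have "\<dots> \<le> norm v * (norm v * K)" using K(2) by (intro mult_left_mono) auto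
    also have "\<dots> = (norm v * sqrt K)\<^sup>2" using K(1) by (simp add: power2_eq_square)
    finally have d: "dual_mnorm P v \<le> norm v * sqrt K"
      by (rule power2_le_imp_le) (use K(1) in simp)
    have "norm v * norm v = v \<bullet> v" by (simp add: power2_norm_eq_inner[symmetric] power2_eq_square)
    also have "\<dots> \<le> dual_mnorm P v * mnorm P v" by (rule dual_cauchy_schwarz)
    also have "\<dots> \<le> (norm v * sqrt K) * mnorm P v" using d by (intro mult_right_mono) auto
    finally show ?thesis using False by (simp add: mult.assoc)
  qed (use K(1) in simp)
  then show ?thesis using K(1) by (intro exI[of _ "sqrt K"]) auto
qed

lemma dual_spd: "sym_pos_def (matrix_inv P)"
  unfolding sym_pos_def_def
proof
  have sym: "(matrix_inv P *v x) \<bullet> y = x \<bullet> (matrix_inv P *v y)" for x y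
    using P_sym[of "matrix_inv P *v x" "matrix_inv P *v y"] by (simp add: P_inv inner_commute)
  have "x \<bullet> (transpose (matrix_inv P) *v y) = x \<bullet> (matrix_inv P *v y)" for x y
    using sym[of x y] by (metis dot_lmul_matrix inner_commute transpose_matrix_vector transpose_transpose)
  then have "transpose (matrix_inv P) *v y = matrix_inv P *v y" for y
    using vector_eq_ldot by blast
  then show "transpose (matrix_inv P) = matrix_inv P"
    by (simp add: matrix_eq)
  have "matrix_inv P *v x \<noteq> 0" if "x \<noteq> 0" for x
    using that P_inv[of x] by auto
  then show "\<forall>x. x \<noteq> 0 \<longrightarrow> (matrix_inv P *v x) \<bullet> x > 0"
    using q_pos[of "matrix_inv P *v _"] by (simp add: q_def P_inv inner_commute)
qed

lemma norm_le_dual_mnorm: "\<exists>C>0. \<forall>v. norm v \<le> C * dual_mnorm P v"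
  using spd.norm_le_mnorm[of "matrix_inv P"] dual_spd by (simp add: spd_def dual_mnorm_def)

lemma continuous_q: "continuous_on A q"
  unfolding q_def by (intro continuous_intros linear_continuous_on matrix_vector_mul_bounded_linear)

section \<open>Proximal steps\<close>

text \<open>A family of terms, so that one shape covers both the leaf step, which sums over all levels,
  and the correction step of a loop, which has a single term.\<close>

definition prox_obj :: "'i set \<Rightarrow> ('i \<Rightarrow> real) \<Rightarrow> ('i \<Rightarrow> real^'d) \<Rightarrow> ('i \<Rightarrow> real^'d) \<Rightarrow> real^'d \<Rightarrow> real" where
  "prox_obj I h g a u = (\<Sum>i\<in>I. g i \<bullet> u + 1/2 * h i * (mnorm P (u - a i))\<^sup>2)"

lemma prox_obj_segment:
  "prox_obj I h g a (x + s *\<^sub>R (z - x)) = prox_obj I h g a x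
     + s * (\<Sum>i\<in>I. g i \<bullet> (z - x) + h i * ((P *v (x - a i)) \<bullet> (z - x)))
     + s\<^sup>2 * ((\<Sum>i\<in>I. h i) / 2 * q (z - x))"
proof -
  have *: "q (x + s *\<^sub>R (z - x) - b) = q (x - b) + 2 * s * ((P *v (x - b)) \<bullet> (z - x)) + s\<^sup>2 * q (z - x)" for b
  proof -
    have "x + s *\<^sub>R (z - x) - b = (x - b) + s *\<^sub>R (z - x)" by simp
    then show ?thesis by (simp only: q_add q_scale inner_scaleR_right mult.assoc)
  qed
  have "g i \<bullet> (x + s *\<^sub>R (z - x)) + 1/2 * h i * q (x + s *\<^sub>R (z - x) - a i)
      = (g i \<bullet> x + 1/2 * h i * q (x - a i))
        + s * (g i \<bullet> (z - x) + h i * ((P *v (x - a i)) \<bullet> (z - x))) + s\<^sup>2 * (h i / 2 * q (z - x))" for i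
    unfolding * inner_add_right inner_scaleR_right by (simp add: field_simps)
  then show ?thesis
    unfolding prox_obj_def mnorm_sq by (simp only: sum_distrib_left sum_distrib_right sum_divide_distrib flip: sum.distrib)
qed

text \<open>Up to a constant the objective depends on its data only through one linear coefficient. A
  minimiser is thus a function of one vector, and its measurability follows from continuity in that
  vector.\<close>

lemma prox_obj_shift:
  "prox_obj I h g a u = prox_obj {()} (\<lambda>_. \<Sum>i\<in>I. h i) (\<lambda>_. \<Sum>i\<in>I. g i - h i *\<^sub>R (P *v a i)) (\<lambda>_. 0) u
    + (\<Sum>i\<in>I. h i / 2 * q (a i))"
proof -
  have "g i \<bullet> u + 1/2 * h i * q (u - a i)
      = ((g i - h i *\<^sub>R (P *v a i)) \<bullet> u + 1/2 * h i * q u) + h i / 2 * q (a i)" for i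
    unfolding q_diff P_sym[of u] inner_diff_left inner_scaleR_left by (simp add: field_simps)
  then show ?thesis
    unfolding prox_obj_def mnorm_sq
    by (simp add: sum.distrib sum_distrib_left sum_distrib_right sum_divide_distrib inner_sum_left)
qed

end

lemma arg_min_on_add_const: "arg_min_on (\<lambda>u. f u + c) Z = arg_min_on f Z" for c :: real
  by (simp add: arg_min_on_def arg_min_def is_arg_min_def)

lemma linear_part_nonneg:
  fixes D C :: real
  assumes "\<And>s. 0 < s \<Longrightarrow> s \<le> 1 \<Longrightarrow> 0 \<le> s * D + s\<^sup>2 * C"
  shows "D \<ge> 0"
proof (rule tendsto_lowerbound)
  show "((\<lambda>s. D + s * C) \<longlongrightarrow> D) (at_right 0)"
    by (auto intro!: tendsto_eq_intros)
  have "0 \<le> D + s * C" if "0 < s" "s < 1" for s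
  proof -
    have "0 \<le> s * (D + s * C)" using assms[of s] that by (simp add: power2_eq_square algebra_simps)
    then show ?thesis using that by (simp add: zero_le_mult_iff)
  qed
  then show "\<forall>\<^sub>F s in at_right 0. 0 \<le> D + s * C"
    unfolding eventually_at_right_field by (intro exI[of _ 1]) auto
qed simp

locale prox = spd P for P :: "real^'d^'d" +
  fixes Z :: "(real^'d) set"
  assumes Z_ne: "Z \<noteq> {}" and Z_closed: "closed Z" and Z_conv: "convex Z" and Z_bdd: "bounded Z"
begin

lemma arg_min_on_Z:
  assumes "continuous_on Z f"
  shows "arg_min_on f Z \<in> Z" "y \<in> Z \<Longrightarrow> f (arg_min_on f Z) \<le> (f y :: real)"
proof -
  have "compact Z" using Z_closed Z_bdd compact_eq_bounded_closed by blast
  then obtain x where "is_arg_min f (\<lambda>x. x \<in> Z) x"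
    using continuous_attains_inf[OF _ Z_ne assms] by (auto simp: is_arg_min_linorder)
  then have "is_arg_min f (\<lambda>x. x \<in> Z) (arg_min_on f Z)"
    unfolding arg_min_on_def arg_min_def by (rule someI)
  then show "arg_min_on f Z \<in> Z" "y \<in> Z \<Longrightarrow> f (arg_min_on f Z) \<le> f y"
    by (auto simp: is_arg_min_linorder)
qed

lemma continuous_prox_obj: "continuous_on A (prox_obj I h g a)"
  unfolding prox_obj_def mnorm_sq
  by (intro continuous_intros continuous_on_compose2[OF continuous_q[of UNIV]]) auto

lemma prox_in: "arg_min_on (prox_obj I h g a) Z \<in> Z"
  by (rule arg_min_on_Z[OF continuous_prox_obj])

text \<open>First-order optimality: along the segment towards \<open>z\<close> the objective is a quadratic polynomial
  that is minimal at its left end, so its linear coefficient is nonnegative.\<close>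

lemma prox_variational:
  fixes I :: "'i set" and h g a
  assumes z: "z \<in> Z"
  defines "x \<equiv> arg_min_on (prox_obj I h g a) Z"
  shows "(\<Sum>i\<in>I. g i \<bullet> (z - x) + h i * ((P *v (x - a i)) \<bullet> (z - x))) \<ge> 0"
proof (rule linear_part_nonneg)
  fix s :: real assume s: "0 < s" "s \<le> 1"
  have x: "x \<in> Z" unfolding x_def by (rule prox_in)
  have "x + s *\<^sub>R (z - x) = (1 - s) *\<^sub>R x + s *\<^sub>R z" by (simp add: algebra_simps)
  then have "x + s *\<^sub>R (z - x) \<in> Z"
    using convexD_alt[OF Z_conv x z, of s] s by simp
  from arg_min_on_Z(2)[OF continuous_prox_obj this, of I h g a]
  show "0 \<le> s * (\<Sum>i\<in>I. g i \<bullet> (z - x) + h i * ((P *v (x - a i)) \<bullet> (z - x)))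
            + s\<^sup>2 * ((\<Sum>i\<in>I. h i) / 2 * q (z - x))"
    unfolding x_def[symmetric] prox_obj_segment by linarith
qed

text \<open>The optimality condition with the inner products expressed by squared distances; in this form
  consecutive steps telescope.\<close>

lemma three_point:
  fixes I :: "'i set" and h g a
  assumes z: "z \<in> Z"
  defines "x \<equiv> arg_min_on (prox_obj I h g a) Z"
  shows "(\<Sum>i\<in>I. g i \<bullet> (x - z) + h i / 2 * (q (x - a i) + q (z - x) - q (z - a i))) \<le> 0"
proof -
  have *: "q (z - b) = q (x - b) + 2 * ((P *v (x - b)) \<bullet> (z - x)) + q (z - x)" for b
    using q_add[of "x - b" "z - x"] by simp
  have "g i \<bullet> (x - z) + h i / 2 * (q (x - a i) + q (z - x) - q (z - a i))
      = - (g i \<bullet> (z - x) + h i * ((P *v (x - a i)) \<bullet> (z - x)))" for i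
    unfolding *[of "a i"] by (simp add: inner_diff_right field_simps)
  then show ?thesis using prox_variational[OF z, where I=I and g=g and h=h and a=a]
    unfolding x_def[symmetric] by (simp only: sum_negf neg_le_0_iff_le)
qed

text \<open>Adding the two optimality conditions leaves the strongly monotone quadratic part on one side
  and the difference of the linear coefficients on the other.\<close>

lemma variational_lipschitz:
  assumes "h > 0" and C: "C > 0" "\<And>v. norm v \<le> C * mnorm P v"
    and a: "c \<bullet> (y - x) + h * ((P *v x) \<bullet> (y - x)) \<ge> 0"
    and b: "c' \<bullet> (x - y) + h * ((P *v y) \<bullet> (x - y)) \<ge> 0"
  shows "h * norm (y - x) \<le> C\<^sup>2 * norm (c - c')"
proof -
  define v where "v = y - x"
  have v': "x - y = - v" by (simp add: v_def)
  have "q v = (P *v y) \<bullet> v - (P *v x) \<bullet> v"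
    by (simp add: q_def v_def matrix_vector_mult_diff_distrib inner_diff_left)
  then have "h * q v = h * ((P *v y) \<bullet> v) - h * ((P *v x) \<bullet> v)"
    by (simp only: right_diff_distrib)
  then have "h * q v \<le> (c - c') \<bullet> v"
    using a b unfolding v' v_def[symmetric] inner_diff_left inner_minus_right by linarith
  also have "\<dots> \<le> norm (c - c') * norm v" by (rule norm_cauchy_schwarz)
  finally have 1: "h * q v \<le> norm (c - c') * norm v" .
  have "(norm v)\<^sup>2 \<le> (C * mnorm P v)\<^sup>2" using C by (intro power_mono) auto
  also have "\<dots> = C\<^sup>2 * q v" by (simp add: power_mult_distrib)
  finally have "h * (norm v)\<^sup>2 \<le> h * (C\<^sup>2 * q v)" using \<open>h > 0\<close> by (intro mult_left_mono) auto
  also have "\<dots> = C\<^sup>2 * (h * q v)" by (simp only: mult.left_commute)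
  also have "\<dots> \<le> C\<^sup>2 * (norm (c - c') * norm v)" by (intro mult_left_mono 1) simp
  finally have "norm v * (h * norm v) \<le> norm v * (C\<^sup>2 * norm (c - c'))"
    by (simp only: power2_eq_square mult_ac)
  then have "h * norm v \<le> C\<^sup>2 * norm (c - c')"
    by (cases "v = 0") auto
  then show ?thesis by (simp only: v_def)
qed

lemma prox_continuous:
  assumes "h > 0"
  shows "continuous_on UNIV (\<lambda>c. arg_min_on (prox_obj {()} (\<lambda>_. h) (\<lambda>_. c) (\<lambda>_. 0)) Z)"
    (is "continuous_on _ ?x")
proof -
  obtain C where C: "C > 0" "\<And>v. norm v \<le> C * mnorm P v" using norm_le_mnorm by blast
  have var: "c \<bullet> (?x c' - ?x c) + h * ((P *v ?x c) \<bullet> (?x c' - ?x c)) \<ge> 0" for c c'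
    using prox_variational[OF prox_in, where I="{()}" and g="\<lambda>_. c" and h="\<lambda>_. h" and a="\<lambda>_. 0",
        of "{()}" "\<lambda>_. h" "\<lambda>_. c'" "\<lambda>_. 0"]
    by (simp only: sum.insert sum.empty finite.emptyI empty_iff not_False_eq_True add_0_right diff_zero)
  have "dist (?x c) (?x c') \<le> (C\<^sup>2 / h) * dist c c'" for c c'
  proof -
    have "norm (?x c' - ?x c) * h \<le> C\<^sup>2 * norm (c - c')"
      using variational_lipschitz[OF assms C var[of c c'] var[of c' c]] by (simp only: mult.commute)
    then have "norm (?x c' - ?x c) \<le> C\<^sup>2 * norm (c - c') / h"
      using assms by (simp only: pos_le_divide_eq)
    then show ?thesis by (simp only: dist_norm norm_minus_commute[of "?x c"] times_divide_eq_left)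
  qed
  then have "(C\<^sup>2 / h)-lipschitz_on UNIV ?x"
    using assms by (intro lipschitz_onI) auto
  then show ?thesis by (rule lipschitz_on_continuous_on)
qed

lemma prox_measurable:
  assumes "finite I" "(\<Sum>i\<in>I. h i) > 0"
    and "\<And>i. i \<in> I \<Longrightarrow> (\<lambda>\<omega>. g \<omega> i) \<in> borel_measurable F"
    and "\<And>i. i \<in> I \<Longrightarrow> (\<lambda>\<omega>. a \<omega> i) \<in> borel_measurable F"
  shows "(\<lambda>\<omega>. arg_min_on (prox_obj I h (g \<omega>) (a \<omega>)) Z) \<in> borel_measurable F"
proof -
  have Pm: "(\<lambda>x. P *v x) \<in> borel_measurable borel"
    by (intro borel_measurable_continuous_onI linear_continuous_on matrix_vector_mul_bounded_linear)
  have "(\<lambda>\<omega>. g \<omega> i - h i *\<^sub>R (P *v a \<omega> i)) \<in> borel_measurable F" if "i \<in> I" for i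
    by (rule borel_measurable_diff[OF assms(3)[OF that]
          borel_measurable_scaleR[OF borel_measurable_const measurable_compose[OF assms(4)[OF that] Pm]]])
  then have lin: "(\<lambda>\<omega>. \<Sum>i\<in>I. g \<omega> i - h i *\<^sub>R (P *v a \<omega> i)) \<in> borel_measurable F"
    by (rule borel_measurable_sum)
  have red: "arg_min_on (prox_obj I h (g \<omega>) (a \<omega>)) Z
      = (\<lambda>c. arg_min_on (prox_obj {()} (\<lambda>_. sum h I) (\<lambda>_. c) (\<lambda>_. 0)) Z)
          (\<Sum>i\<in>I. g \<omega> i - h i *\<^sub>R (P *v a \<omega> i))" for \<omega>
    using arg_min_on_add_const[of "prox_obj {()} (\<lambda>_. sum h I)
      (\<lambda>_. \<Sum>i\<in>I. g \<omega> i - h i *\<^sub>R (P *v a \<omega> i)) (\<lambda>_. 0)"]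
    by (simp only: prox_obj_shift[of I h "g \<omega>" "a \<omega>", abs_def])
  show ?thesis
    unfolding red
    by (rule measurable_compose[OF lin borel_measurable_continuous_onI[OF prox_continuous[OF assms(2)]]])
qed

section \<open>Smooth convex functions relative to a convex set\<close>

text \<open>The set \<open>Z\<close> may have empty interior and the derivative is taken within \<open>Z\<close>, so both
  inequalities of this part are obtained by restricting \<open>f\<close> to segments.\<close>

context
  fixes f :: "real^'d \<Rightarrow> real" and gf :: "real^'d \<Rightarrow> real^'d"
  assumes deriv: "\<And>v. v \<in> Z \<Longrightarrow> (f has_derivative (\<lambda>h. gf v \<bullet> h)) (at v within Z)"
begin

lemma segment_in:
  assumes "u \<in> Z" "v \<in> Z" "s \<in> {0..1}"
  shows "v + s *\<^sub>R (u - v) \<in> Z"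
  using convexD_alt[OF Z_conv assms(2,1), of s] assms(3) by (simp add: algebra_simps)

lemma segment_deriv:
  assumes "u \<in> Z" "v \<in> Z" "s \<in> {0..1}"
  shows "((\<lambda>s. f (v + s *\<^sub>R (u - v))) has_derivative (\<lambda>h. h * (gf (v + s *\<^sub>R (u - v)) \<bullet> (u - v))))
           (at s within {0..1})"
proof -
  have "((\<lambda>s. v + s *\<^sub>R (u - v)) has_derivative (\<lambda>h. h *\<^sub>R (u - v))) (at s within {0..1})"
    by (auto intro!: derivative_eq_intros)
  moreover have "(\<lambda>s. v + s *\<^sub>R (u - v)) ` {0..1} \<subseteq> Z" using segment_in[OF assms(1,2)] by blast
  then have "(f has_derivative (\<lambda>h. gf (v + s *\<^sub>R (u - v)) \<bullet> h))
      (at (v + s *\<^sub>R (u - v)) within (\<lambda>s. v + s *\<^sub>R (u - v)) ` {0..1})"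
    using has_derivative_subset[OF deriv[OF segment_in[OF assms]]] by blast
  ultimately show ?thesis
    by (rule has_derivative_eq_rhs[OF has_derivative_in_compose]) simp
qed

lemma above_tangent:
  assumes conv: "convex_on Z f" and u: "u \<in> Z" and v: "v \<in> Z"
  shows "f v + gf v \<bullet> (u - v) \<le> f u"
proof -
  let ?\<phi> = "\<lambda>s. f (v + s *\<^sub>R (u - v))"
  have "(?\<phi> has_field_derivative (gf v \<bullet> (u - v))) (at 0 within {0..1})"
    using segment_deriv[OF u v, of 0] by (simp add: has_field_derivative_def mult_commute_abs)
  then have lim: "((\<lambda>s. (?\<phi> s - ?\<phi> 0) / (s - 0)) \<longlongrightarrow> gf v \<bullet> (u - v)) (at 0 within {0..1})"
    by (simp add: has_field_derivative_iff)
  have "gf v \<bullet> (u - v) \<le> f u - f v"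
  proof (rule tendsto_upperbound[OF lim])
    have "(?\<phi> s - ?\<phi> 0) / (s - 0) \<le> f u - f v" if "s \<in> {0<..1}" for s
    proof -
      have "v + s *\<^sub>R (u - v) = (1 - s) *\<^sub>R v + s *\<^sub>R u" by (simp add: algebra_simps)
      then have "?\<phi> s \<le> (1 - s) * f v + s * f u"
        using convex_onD[OF conv, of s v u] that u v by simp
      then show ?thesis using that by (simp add: field_simps)
    qed
    then show "\<forall>\<^sub>F s in at 0 within {0..1}. (?\<phi> s - ?\<phi> 0) / (s - 0) \<le> f u - f v"
      by (intro eventually_at_filter[THEN iffD2] always_eventually) auto
    show "at (0::real) within {0..1} \<noteq> bot" by (simp add: trivial_limit_within islimpt_Icc)
  qed
  then show ?thesis by simp
qed

lemma descent:
  assumes lip: "mlipschitz_on P L Z gf" and u: "u \<in> Z" and v: "v \<in> Z"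
  shows "f u \<le> f v + gf v \<bullet> (u - v) + L / 2 * q (u - v)"
proof -
  let ?w = "\<lambda>s. v + s *\<^sub>R (u - v)"
  let ?\<psi> = "\<lambda>s. f (?w s) - s * (gf v \<bullet> (u - v)) - s\<^sup>2 * (L / 2 * q (u - v))"
  let ?d = "\<lambda>s. (gf (?w s) - gf v) \<bullet> (u - v) - L * s * q (u - v)"
  have "\<exists>x\<in>{0<..<1}. ?\<psi> 1 - ?\<psi> 0 = (1 - 0) * ?d x"
  proof (rule mvt_simple)
    fix s :: real assume "0 \<le> s" "s \<le> 1"
    then have s: "s \<in> {0..1}" by simp
    show "(?\<psi> has_derivative (\<lambda>h. h * ?d s)) (at s within {0..1})"
    proof (rule has_derivative_eq_rhs)
      show "(?\<psi> has_derivative (\<lambda>h. h * (gf (?w s) \<bullet> (u - v)) - h * (gf v \<bullet> (u - v))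
          - (2 * s * h) * (L / 2 * q (u - v)))) (at s within {0..1})"
        by (intro has_derivative_diff segment_deriv[OF u v s] has_derivative_mult_left)
           (auto intro!: derivative_eq_intros)
    qed (simp add: inner_diff_left fun_eq_iff field_simps)
  qed simp
  then obtain s where s: "s \<in> {0<..<1}" and eq: "?\<psi> 1 - ?\<psi> 0 = ?d s" by auto
  have "(gf (?w s) - gf v) \<bullet> (u - v) \<le> dual_mnorm P (gf (?w s) - gf v) * mnorm P (u - v)"
    by (rule dual_cauchy_schwarz)
  also have "\<dots> \<le> (L * mnorm P (?w s - v)) * mnorm P (u - v)"
    using segment_in[OF u v, of s] s v
    by (intro mult_right_mono mnorm_nonneg lip[unfolded mlipschitz_on_def, rule_format]) auto
  also have "\<dots> = L * s * (mnorm P (u - v))\<^sup>2"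
    using s by (simp add: mnorm_scale power2_eq_square)
  finally have "?d s \<le> 0" by simp
  with eq show ?thesis by simp
qed

end

end

section \<open>The recurrences satisfied by the final tables\<close>

lemma alpha_bounds: "0 < alpha t" "alpha t \<le> 1"
proof -
  have "0 < alpha t \<and> alpha t \<le> 1"
  proof (induction t)
    case (Suc t)
    have "sqrt (1 + 4 / (alpha t)\<^sup>2) \<ge> 1" using Suc by simp
    moreover have "0 < 2 / r \<and> 2 / r \<le> 1" if "r \<ge> 2" for r :: real
      using that by (simp add: divide_le_eq)
    ultimately show ?case by (simp only: alpha.simps)
  qed simp
  then show "0 < alpha t" "alpha t \<le> 1" by auto
qed

text \<open>The table entries that the procedure at \<open>t\<close> and the equations describing it may mention: those
  indexed by extensions of \<open>t\<close> and those indexed by prefixes of \<open>t\<close>.\<close>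

definition comparable :: "nat list \<Rightarrow> nat list \<Rightarrow> bool" where
  "comparable t u \<longleftrightarrow> (\<exists>v. u = t @ v) \<or> (\<exists>v. t = u @ v)"

lemma comparable_take: "comparable t (take i t)"
  unfolding comparable_def by (metis append_take_drop_id)

lemma comparable_append: "comparable t (t @ u)"
  unfolding comparable_def by blast

lemma comparable_extend: "comparable (t @ [j]) u \<Longrightarrow> comparable t u"
  unfolding comparable_def
  by (auto simp: append_eq_append_conv2 Cons_eq_append_conv append_eq_Cons_conv)

lemma fold_copy_other:
  assumes "idx \<notin> a ` set ls"
  shows "fold (\<lambda>l z. z(a l := z (b l))) ls z idx = z idx"
  using assms by (induction ls arbitrary: z) auto

lemma fold_copy_at:
  assumes "l \<in> set ls" "inj_on a (set ls)" "\<And>l l'. a l \<noteq> b l'"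
  shows "fold (\<lambda>l z. z(a l := z (b l))) ls z (a l) = z (b l)"
  using assms
proof (induction ls rule: rev_induct)
  case (snoc x ls)
  have "b x \<notin> a ` set ls" by (metis imageE snoc.prems(3))
  then have b: "fold (\<lambda>l z. z(a l := z (b l))) ls z (b x) = z (b x)" by (rule fold_copy_other)
  have "fold (\<lambda>l z. z(a l := z (b l))) (ls @ [x]) z
      = (fold (\<lambda>l z. z(a l := z (b l))) ls z)(a x := z (b x))"
    by (simp only: fold_append fold.simps comp_apply id_apply b)
  moreover have "fold (\<lambda>l z. z(a l := z (b l))) ls z (a l) = z (b l)" "a l \<noteq> a x" if "l \<noteq> x"
  proof -
    show "fold (\<lambda>l z. z(a l := z (b l))) ls z (a l) = z (b l)"
      using snoc.prems that by (intro snoc.IH) (auto simp: inj_on_def)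
    show "a l \<noteq> a x" using snoc.prems(1,2) that by (auto simp: inj_on_def)
  qed
  ultimately show ?case by (cases "l = x") (simp_all only: fun_upd_same fun_upd_other not_False_eq_True if_True)
qed simp

lemma carry_over_other:
  assumes "\<And>r. idx \<noteq> t @ [j + 1] @ replicate (Suc r) 0"
  shows "carry_over n T t j z idx = z idx"
proof -
  have "idx \<notin> (\<lambda>l. t @ [j + 1] @ replicate (l - (length t + 1)) 0) ` set [length t + 2..<n + 1]"
  proof
    assume "idx \<in> (\<lambda>l. t @ [j + 1] @ replicate (l - (length t + 1)) 0) ` set [length t + 2..<n + 1]"
    then obtain l where "l \<ge> length t + 2" "idx = t @ [j + 1] @ replicate (l - (length t + 1)) 0" by auto
    moreover then have "l - (length t + 1) = Suc (l - (length t + 2))" by simp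
    ultimately show False using assms by metis
  qed
  from fold_copy_other[OF this] show ?thesis
    unfolding carry_over_def Let_def .
qed

lemma carry_over_at:
  assumes "length t + r + 2 \<le> n"
  shows "carry_over n T t j z (t @ [j + 1] @ replicate (Suc r) 0)
       = z (t @ [j, T (length t + 2)] @ replicate r 0)"
proof -
  let ?a = "\<lambda>l. t @ [j + 1] @ replicate (l - (length t + 1)) 0"
  let ?b = "\<lambda>l. t @ [j, T (length t + 2)] @ replicate (l - (length t + 2)) 0"
  have inj: "inj_on ?a (set [length t + 2..<n + 1])"
    by (auto simp: inj_on_def)
  have mem: "length t + r + 2 \<in> set [length t + 2..<n + 1]" using assms by auto
  have ne: "?a l \<noteq> ?b l'" for l l' by simp
  have "fold (\<lambda>l z. z(?a l := z (?b l))) [length t + 2..<n + 1] z (?a (length t + r + 2))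
      = z (?b (length t + r + 2))"
    by (rule fold_copy_at[of _ _ ?a, OF mem inj ne])
  moreover have "length t + r + 2 - (length t + 1) = Suc r" "length t + r + 2 - (length t + 2) = r" by auto
  ultimately show ?thesis unfolding carry_over_def Let_def by (simp only:)
qed

locale sliding = prox P Z for P :: "real^'d^'d" and Z +
  fixes n :: nat and T :: "nat \<Rightarrow> nat"
    and Q :: "nat \<Rightarrow> real^'d \<Rightarrow> real^'d"
    and G :: "nat \<Rightarrow> real^'d \<Rightarrow> 's \<Rightarrow> real^'d"
    and \<eta> :: "nat \<Rightarrow> nat list \<Rightarrow> real"
begin

abbreviation leaf :: "(nat list \<Rightarrow> 's) \<Rightarrow> nat list \<Rightarrow> 'd table \<Rightarrow> 'd table \<Rightarrow> real^'d" where
  "leaf \<equiv> leaf_step n Z P Q G \<eta>"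

abbreviation Rec :: "(nat list \<Rightarrow> 's) \<Rightarrow> nat \<Rightarrow> nat list \<Rightarrow> 'd table \<times> 'd table
    \<Rightarrow> (real^'d) \<times> ('d table \<times> 'd table)" where
  "Rec \<equiv> sliding_rec n T Z P Q G \<eta>"

text \<open>The point returned by the procedure at \<open>t\<close>, read off from the final tables.\<close>

definition result :: "(nat list \<Rightarrow> 's) \<Rightarrow> nat \<Rightarrow> nat list \<Rightarrow> 'd table \<Rightarrow> 'd table \<Rightarrow> real^'d" where
  "result \<xi> d t z zb = (if d = 0 then leaf \<xi> t z zb else zb (t @ [T (length t + 1)]))"

text \<open>What one pass of the loop establishes: averaging, correction and carry-over. The padded
  carry-over uses \<open>Suc r\<close> zeros on the left because the entry with none is set by the correction.\<close>

definition loop_eqs :: "(nat list \<Rightarrow> 's) \<Rightarrow> nat \<Rightarrow> nat list \<Rightarrow> nat \<Rightarrow> 'd table \<Rightarrow> 'd table \<Rightarrow> bool" where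
  "loop_eqs \<xi> d t j z zb \<longleftrightarrow>
     zb (t @ [j + 1]) = alpha j *\<^sub>R result \<xi> d (t @ [j]) z zb + (1 - alpha j) *\<^sub>R zb (t @ [j])
     \<and> z (t @ [j + 1]) = arg_min_on (prox_obj {()} (\<lambda>_. \<eta> (length t + 1) (t @ [j]))
           (\<lambda>_. Q (length t + 1) (result \<xi> d (t @ [j]) z zb) - Q (length t + 1) (z (t @ [j])))
           (\<lambda>_. result \<xi> d (t @ [j]) z zb)) Z
     \<and> (\<forall>r<d. z (t @ [j + 1] @ replicate (Suc r) 0) = z (t @ [j, T (length t + 2)] @ replicate r 0))"

primrec trace :: "(nat list \<Rightarrow> 's) \<Rightarrow> nat \<Rightarrow> nat list \<Rightarrow> 'd table \<Rightarrow> 'd table \<Rightarrow> bool" where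
  "trace \<xi> 0 = (\<lambda>t z zb. True)"
| "trace \<xi> (Suc d) = (\<lambda>t z zb. zb (t @ [0]) = z (t @ [0])
     \<and> (\<forall>j<T (length t + 1). trace \<xi> d (t @ [j]) z zb \<and> loop_eqs \<xi> d t j z zb))"

lemma leaf_eq_prox:
  "leaf \<xi> t z zb = arg_min_on (prox_obj {1..n} (\<lambda>i. \<eta> i (take i t))
     (\<lambda>i. G i (query_point z zb (take i t)) (\<xi> (take i t)) + Q i (z (take i t))) (\<lambda>i. z (take i t))) Z"
  by (simp add: leaf_step_def prox_obj_def[abs_def])

lemma leaf_cong:
  assumes "\<And>u. comparable t u \<Longrightarrow> z u = z' u" "\<And>u. comparable t u \<Longrightarrow> zb u = zb' u"
  shows "leaf \<xi> t z zb = leaf \<xi> t z' zb'"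
proof -
  have z: "z (take i t) = z' (take i t)" for i
    using assms(1) comparable_take by blast
  have zb: "zb (take i t) = zb' (take i t)" for i
    using assms(2) comparable_take by blast
  have "query_point z zb (take i t) = query_point z' zb' (take i t)" for i
    unfolding query_point_def z by (intro foldr_cong) (simp_all add: zb take_take)
  then show ?thesis by (simp only: leaf_step_def z)
qed

lemma result_cong:
  assumes "\<And>u. comparable t u \<Longrightarrow> z u = z' u" "\<And>u. comparable t u \<Longrightarrow> zb u = zb' u"
  shows "result \<xi> d t z zb = result \<xi> d t z' zb'"
  unfolding result_def using leaf_cong[of t z z' zb zb', OF assms] assms(2)[OF comparable_append] by simp

lemma loop_eqs_cong:
  assumes z: "\<And>u. comparable (t @ [j]) u \<Longrightarrow> z u = z' u"
    and zb: "\<And>u. comparable (t @ [j]) u \<Longrightarrow> zb u = zb' u"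
    and z1: "\<And>r. z (t @ [j + 1] @ replicate r 0) = z' (t @ [j + 1] @ replicate r 0)"
    and zb1: "zb (t @ [j + 1]) = zb' (t @ [j + 1])"
  shows "loop_eqs \<xi> d t j z zb \<longleftrightarrow> loop_eqs \<xi> d t j z' zb'"
proof -
  have "result \<xi> d (t @ [j]) z zb = result \<xi> d (t @ [j]) z' zb'"
    by (rule result_cong[OF z zb])
  moreover have "z (t @ [j, T (length t + 2)] @ replicate r 0) = z' (t @ [j, T (length t + 2)] @ replicate r 0)" for r
    using z[of "t @ [j, T (length t + 2)] @ replicate r 0"] comparable_append[of "t @ [j]"] by simp
  moreover have "z (t @ [j]) = z' (t @ [j])" "zb (t @ [j]) = zb' (t @ [j])"
    using z zb comparable_append[of "t @ [j]" "[]"] by auto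
  moreover have "z (t @ [j + 1]) = z' (t @ [j + 1])" using z1[of 0] by simp
  ultimately show ?thesis unfolding loop_eqs_def z1 zb1 by (simp only:)
qed

text \<open>Later passes of a loop only touch entries that are not comparable with the earlier nodes. By
  this lemma they preserve the equations of the earlier passes.\<close>

lemma trace_cong:
  assumes "\<And>u. comparable t u \<Longrightarrow> z u = z' u" "\<And>u. comparable t u \<Longrightarrow> zb u = zb' u"
  shows "trace \<xi> d t z zb \<longleftrightarrow> trace \<xi> d t z' zb'"
  using assms
proof (induction d arbitrary: t)
  case (Suc d)
  have eq: "z (t @ u) = z' (t @ u)" "zb (t @ u) = zb' (t @ u)" for u
    using Suc.prems comparable_append by blast+
  have ext: "comparable (t @ [j]) u \<Longrightarrow> z u = z' u" "comparable (t @ [j]) u \<Longrightarrow> zb u = zb' u" for j u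
    using Suc.prems comparable_extend by blast+
  have "trace \<xi> d (t @ [j]) z zb = trace \<xi> d (t @ [j]) z' zb'" for j
    by (rule Suc.IH[OF ext])
  moreover have "loop_eqs \<xi> d t j z zb = loop_eqs \<xi> d t j z' zb'" for j
    by (rule loop_eqs_cong[OF ext]) (auto simp: eq)
  ultimately show ?case by (simp add: eq)
qed simp

text \<open>All-zero extensions of \<open>t\<close> are the starting values of the levels below \<open>t\<close>. They are prepared
  by the caller and stay fixed inside the procedure, hence the nonzero component.\<close>

definition z_frame :: "nat list \<Rightarrow> 'd table \<Rightarrow> 'd table \<Rightarrow> bool" where
  "z_frame t z z' \<longleftrightarrow> (\<forall>u. z' u \<noteq> z u \<longrightarrow> (\<exists>v. u = t @ v \<and> (\<exists>e\<in>set v. e \<noteq> 0)))"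

definition zbar_frame :: "nat list \<Rightarrow> 'd table \<Rightarrow> 'd table \<Rightarrow> bool" where
  "zbar_frame t z z' \<longleftrightarrow> (\<forall>u. z' u \<noteq> z u \<longrightarrow> (\<exists>v. u = t @ v \<and> v \<noteq> []))"

definition table_in :: "'d table \<Rightarrow> bool" where "table_in z \<longleftrightarrow> (\<forall>u. z u \<in> Z)"

lemma convex_comb_in:
  assumes "x \<in> Z" "y \<in> Z" shows "alpha j *\<^sub>R x + (1 - alpha j) *\<^sub>R y \<in> Z"
  using convexD[OF Z_conv assms, of "alpha j" "1 - alpha j"] alpha_bounds[of j] by simp

lemma carry_over_in: "table_in z \<Longrightarrow> table_in (carry_over n T t j z)"
proof -
  have "table_in z \<Longrightarrow> table_in (fold (\<lambda>l z. z(a l := z (b l))) ls z)" for a b and ls :: "nat list"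
    by (induction ls arbitrary: z) (auto simp: table_in_def)
  then show "table_in z \<Longrightarrow> table_in (carry_over n T t j z)"
    by (simp add: carry_over_def Let_def)
qed

text \<open>The only place where the program is executed. The invariant of the loop at \<open>t\<close> says that the
  passes completed so far satisfy their equations in the current tables; the frame conditions show that
  the next pass does not disturb them.\<close>

lemma Rec_trace:
  assumes "length t + d = n" "table_in z" "table_in zb"
    and "Rec \<xi> d t (z, zb) = (x, (z', zb'))"
  shows "trace \<xi> d t z' zb' \<and> x = result \<xi> d t z' zb' \<and> x \<in> Z \<and> table_in z' \<and> table_in zb'
    \<and> z_frame t z z' \<and> zbar_frame t zb zb'"
  using assms
proof (induction d arbitrary: t z zb x z' zb')
  case 0
  then show ?case
    by (auto simp: result_def z_frame_def zbar_frame_def leaf_eq_prox intro: prox_in)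
next
  case (Suc d)
  note outer_IH = Suc.IH
  have len: "length t + Suc d = n" by (rule Suc.prems(1))
  define body where "body = loop_body n T Z P Q \<eta> (Rec \<xi> d) t"
  define s where "s m = fold body [0..<m] (z, zb(t @ [0] := z (t @ [0])))" for m
  define Inv where "Inv m a b \<longleftrightarrow> table_in a \<and> table_in b \<and> b (t @ [0]) = a (t @ [0])
     \<and> (\<forall>j<m. trace \<xi> d (t @ [j]) a b \<and> loop_eqs \<xi> d t j a b) \<and> z_frame t z a \<and> zbar_frame t zb b"
    for m :: nat and a b
  have inv: "Inv m (fst (s m)) (snd (s m))" for m
  proof (induction m)
    case 0
    show ?case using Suc.prems(2,3)
      by (auto simp: Inv_def s_def table_in_def z_frame_def zbar_frame_def)
  next
    case (Suc m)
    obtain a b where ab: "s m = (a, b)" by fastforce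
    from Suc ab have I: "Inv m a b" by simp
    obtain y a1 b1 where R: "Rec \<xi> d (t @ [m]) (a, b) = (y, (a1, b1))" by (metis prod_cases3)
    have tr: "trace \<xi> d (t @ [m]) a1 b1" and y: "y = result \<xi> d (t @ [m]) a1 b1"
      and in1: "y \<in> Z" "table_in a1" "table_in b1"
      and fr: "z_frame (t @ [m]) a a1" "zbar_frame (t @ [m]) b b1"
      using outer_IH[OF _ _ _ R] I len by (auto simp: Inv_def)
    define x1 where "x1 = arg_min_on (prox_obj {()} (\<lambda>_. \<eta> (length t + 1) (t @ [m]))
           (\<lambda>_. Q (length t + 1) y - Q (length t + 1) (a1 (t @ [m]))) (\<lambda>_. y)) Z"
    define a2 where "a2 = a1(t @ [m + 1] := x1)"
    define b2 where "b2 = b1(t @ [m + 1] := alpha m *\<^sub>R y + (1 - alpha m) *\<^sub>R b1 (t @ [m]))"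
    define a3 where "a3 = carry_over n T t m a2"
    have s_Suc: "s (Suc m) = (a3, b2)"
    proof -
      have "s (Suc m) = body m (s m)" by (simp add: s_def)
      also have "\<dots> = (a3, b2)"
        by (simp add: ab body_def loop_body_def R Let_def a3_def a2_def b2_def x1_def prox_obj_def[abs_def])
      finally show ?thesis .
    qed
    \<comment> \<open>Two comparisons: with the tables after the recursive call, and with those before the pass.\<close>
    have B_z: "a3 u = a1 u" if "\<And>r. u \<noteq> t @ [m + 1] @ replicate r 0" for u
    proof -
      have "a3 u = a2 u" unfolding a3_def by (rule carry_over_other[OF that])
      then show ?thesis using that[of 0] by (simp add: a2_def)
    qed
    have B_b: "b2 u = b1 u" if "u \<noteq> t @ [m + 1]" for u
      using that by (simp add: b2_def)
    have A_z: "a3 u = a u" if "\<And>r. u \<noteq> t @ [m + 1] @ replicate r 0"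
        "\<And>v e. u = t @ [m] @ v \<Longrightarrow> e \<in> set v \<Longrightarrow> e = 0" for u
      using B_z[OF that(1)] fr(1) that(2) unfolding z_frame_def by (metis append_assoc)
    have A_b: "b2 u = b u" if "u \<noteq> t @ [m + 1]" "\<And>v. u = t @ [m] @ v \<Longrightarrow> v = []" for u
      using B_b[OF that(1)] fr(2) that(2) unfolding zbar_frame_def by (metis append_assoc)
    have cmp: "u \<noteq> t @ [i] @ v" if "comparable (t @ [j]) u" "j \<noteq> i" for u v i j
      using that by (auto simp: comparable_def)
    have in3: "table_in a3" "table_in b2"
    proof -
      have "x1 \<in> Z" unfolding x1_def by (rule prox_in)
      then have "table_in a2" using in1 by (simp add: table_in_def a2_def)
      then show "table_in a3" unfolding a3_def by (rule carry_over_in)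
      show "table_in b2" using in1 by (auto simp: b2_def table_in_def intro: convex_comb_in)
    qed
    have cB_z: "a3 u = a1 u" and cB_b: "b2 u = b1 u" if "comparable (t @ [m]) u" for u
    proof -
      show "a3 u = a1 u" using B_z cmp[OF that, of "m + 1"] by auto
      show "b2 u = b1 u" using B_b cmp[OF that, of "m + 1" "[]"] by auto
    qed
    have tr_m: "trace \<xi> d (t @ [m]) a3 b2"
    proof -
      have "trace \<xi> d (t @ [m]) a3 b2 = trace \<xi> d (t @ [m]) a1 b1"
        by (rule trace_cong[OF cB_z cB_b])
      then show ?thesis using tr by simp
    qed
    have y3: "y = result \<xi> d (t @ [m]) a3 b2"
      unfolding y by (rule result_cong[OF cB_z[symmetric] cB_b[symmetric]])
    have self: "a3 (t @ [m]) = a1 (t @ [m])" "b2 (t @ [m]) = b1 (t @ [m])"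
      using cB_z cB_b comparable_append[of "t @ [m]" "[]"] by auto
    have le_m: "loop_eqs \<xi> d t m a3 b2"
      unfolding loop_eqs_def y3[symmetric] self
    proof (intro conjI allI impI)
      show "b2 (t @ [m + 1]) = alpha m *\<^sub>R y + (1 - alpha m) *\<^sub>R b1 (t @ [m])"
        by (simp add: b2_def)
      have "a3 (t @ [m + 1]) = a2 (t @ [m + 1])"
        unfolding a3_def by (rule carry_over_other) simp
      then show "a3 (t @ [m + 1]) = arg_min_on (prox_obj {()} (\<lambda>_. \<eta> (length t + 1) (t @ [m]))
           (\<lambda>_. Q (length t + 1) y - Q (length t + 1) (a1 (t @ [m]))) (\<lambda>_. y)) Z"
        by (simp add: a2_def x1_def)
      fix r assume "r < d"
      then have "a3 (t @ [m + 1] @ replicate (Suc r) 0) = a2 (t @ [m, T (length t + 2)] @ replicate r 0)"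
        unfolding a3_def using len by (intro carry_over_at) simp
      also have "\<dots> = a3 (t @ [m, T (length t + 2)] @ replicate r 0)"
        unfolding a3_def by (rule carry_over_other[symmetric]) simp
      finally show "a3 (t @ [m + 1] @ replicate (Suc r) 0) = a3 (t @ [m, T (length t + 2)] @ replicate r 0)" .
    qed
    have old: "trace \<xi> d (t @ [j]) a3 b2 \<and> loop_eqs \<xi> d t j a3 b2" if "j < m" for j
    proof -
      have ca: "a3 u = a u" and cb: "b2 u = b u" if "comparable (t @ [j]) u" for u
      proof -
        show "a3 u = a u" using A_z cmp[OF that] \<open>j < m\<close> by (metis less_add_one less_irrefl less_trans)
        show "b2 u = b u" using A_b cmp[OF that] \<open>j < m\<close>
          by (metis append.right_neutral less_add_one less_irrefl less_trans)
      qed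
      have "trace \<xi> d (t @ [j]) a3 b2 = trace \<xi> d (t @ [j]) a b"
        by (rule trace_cong[OF ca cb])
      moreover have "loop_eqs \<xi> d t j a3 b2 = loop_eqs \<xi> d t j a b"
        using that by (intro loop_eqs_cong ca cb A_z A_b) auto
      ultimately show ?thesis using I that by (simp add: Inv_def)
    qed
    have "z_frame t z a3"
      unfolding z_frame_def
    proof (intro allI impI)
      fix u assume u: "a3 u \<noteq> z u"
      consider (1) r where "u = t @ [m + 1] @ replicate r 0"
        | (2) v e where "u = t @ [m] @ v" "e \<in> set v" "e \<noteq> 0" | (3) "a3 u = a u"
        using A_z[of u] by blast
      then show "\<exists>v. u = t @ v \<and> (\<exists>e\<in>set v. e \<noteq> 0)"
      proof cases
        case 1
        then show ?thesis by (intro exI[of _ "[m + 1] @ replicate r 0"]) auto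
      next
        case 2
        then show ?thesis by (intro exI[of _ "[m] @ v"]) auto
      next
        case 3
        then show ?thesis using u I by (auto simp: Inv_def z_frame_def)
      qed
    qed
    moreover have "zbar_frame t zb b2"
      unfolding zbar_frame_def
    proof (intro allI impI)
      fix u assume u: "b2 u \<noteq> zb u"
      consider (1) "u = t @ [m + 1]" | (2) v where "u = t @ [m] @ v" | (3) "b2 u = b u"
        using A_b[of u] by blast
      then show "\<exists>v. u = t @ v \<and> v \<noteq> []"
        using u I by cases (auto simp: Inv_def zbar_frame_def)
    qed
    moreover have "b2 (t @ [0]) = a3 (t @ [0])"
    proof -
      have "b2 (t @ [0]) = b (t @ [0])" by (rule A_b) auto
      moreover have "a3 (t @ [0]) = a (t @ [0])" by (rule A_z) auto
      ultimately show ?thesis using I by (simp add: Inv_def)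
    qed
    ultimately show ?case
      using in3 tr_m le_m old by (auto simp: Inv_def s_Suc less_Suc_eq)
  qed
  define N where "N = T (length t + 1)"
  obtain a b where ab: "s N = (a, b)" by fastforce
  have I: "Inv N a b" using inv[of N] ab by simp
  have "Rec \<xi> (Suc d) t (z, zb) = (b (t @ [N]), (a, b))"
    using ab by (simp add: s_def body_def N_def Let_def)
  with Suc.prems(4) have [simp]: "x = b (t @ [N])" "z' = a" "zb' = b" by auto
  show ?case using I by (simp add: Inv_def N_def result_def table_in_def)
qed

lemma sliding_output_trace:
  assumes "x0 \<in> Z"
  obtains z zb where "trace \<xi> n [] z zb" "table_in z" "table_in zb"
    "sliding_output n T Z P Q G \<eta> \<xi> x0 = result \<xi> n [] z zb" "\<And>i. z (replicate i 0) = x0"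
proof -
  obtain x z zb where R: "Rec \<xi> n [] (\<lambda>_. x0, \<lambda>_. x0) = (x, (z, zb))" by (metis prod_cases3)
  have *: "trace \<xi> n [] z zb \<and> x = result \<xi> n [] z zb \<and> x \<in> Z \<and> table_in z \<and> table_in zb
    \<and> z_frame [] (\<lambda>_. x0) z \<and> zbar_frame [] (\<lambda>_. x0) zb"
    by (rule Rec_trace[OF _ _ _ R]) (use assms in \<open>auto simp: table_in_def\<close>)
  have "z (replicate i 0) = x0" for i
    using * unfolding z_frame_def by (metis append.left_neutral in_set_replicate)
  then show ?thesis using that[of z zb] * R by (simp add: sliding_output_def)
qed

end

section \<open>The energy inequality for a realised run\<close>

definition index_prod :: "(nat \<Rightarrow> nat \<Rightarrow> real) \<Rightarrow> nat list \<Rightarrow> real" where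
  "index_prod f t = (\<Prod>l=1..length t. f l (t ! (l - 1)))"

lemma index_prod_Nil[simp]: "index_prod f [] = 1" by (simp add: index_prod_def)

lemma index_prod_snoc[simp]: "index_prod f (t @ [j]) = index_prod f t * f (Suc (length t)) j"
proof -
  have "(\<Prod>l=1..length t. f l ((t @ [j]) ! (l - 1))) = (\<Prod>l=1..length t. f l (t ! (l - 1)))"
    by (intro prod.cong) (auto simp: nth_append)
  then show ?thesis by (simp add: index_prod_def)
qed

lemma index_prod_mult: "index_prod f t * index_prod g t = index_prod (\<lambda>l j. f l j * g l j) t"
  by (simp add: index_prod_def prod.distrib)

lemma index_prod_pos: "(\<And>l j. f l j > 0) \<Longrightarrow> index_prod f t > 0"
  by (simp add: index_prod_def prod_pos)

abbreviation "alpha_prod \<equiv> index_prod (\<lambda>_. alpha)"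

lemma alpha_prod_pos[simp]: "alpha_prod t > 0"
  by (intro index_prod_pos alpha_bounds)

lemma alpha_pos[simp]: "alpha t > 0" "alpha t \<noteq> 0"
  using alpha_bounds[of t] by auto

text \<open>The sequence is defined so that this holds: \<open>alpha (Suc t)\<close> is the positive root of
  \<open>a\<^sup>2 = (1 - a) * (alpha t)\<^sup>2\<close>.\<close>

lemma alpha_recurrence: "(1 - alpha (Suc t)) / (alpha (Suc t))\<^sup>2 = 1 / (alpha t)\<^sup>2"
proof -
  define s where "s = sqrt (1 + 4 / (alpha t)\<^sup>2)"
  have s2: "s\<^sup>2 = 1 + 4 / (alpha t)\<^sup>2" by (simp add: s_def add_nonneg_nonneg)
  have s0: "1 + s > 0" by (simp add: s_def add_pos_nonneg)
  have "alpha (Suc t) = 2 / (1 + s)" by (simp add: s_def)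
  moreover have "(1 - 2 / (1 + s)) / (2 / (1 + s))\<^sup>2 = (s\<^sup>2 - 1) / 4"
    using s0 by (simp add: field_simps power2_eq_square)
  ultimately have "(1 - alpha (Suc t)) / (alpha (Suc t))\<^sup>2 = (s\<^sup>2 - 1) / 4" by (simp only:)
  then show ?thesis by (simp add: s2)
qed

lemma alpha_decreasing: "alpha (Suc t) \<le> alpha t"
proof -
  have "1 / (alpha t)\<^sup>2 \<le> 1 / (alpha (Suc t))\<^sup>2"
    unfolding alpha_recurrence[of t, symmetric]
    by (intro divide_right_mono) (simp_all add: less_imp_le del: alpha.simps)
  then have "(alpha (Suc t))\<^sup>2 \<le> (alpha t)\<^sup>2" by (simp add: field_simps del: alpha.simps)
  then show ?thesis by (rule power2_le_imp_le) (simp add: less_imp_le)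
qed

lemma alpha_antimono: "s \<le> t \<Longrightarrow> alpha t \<le> alpha s"
  by (rule lift_Suc_antimono_le[of alpha]) (rule alpha_decreasing)

text \<open>The composition of the averaging maps along \<open>t\<close>, as a map of its own: the analysis applies it
  to returned points and to comparison points, not only to the stored iterate.\<close>

definition point_map :: "'d::finite table \<Rightarrow> nat list \<Rightarrow> real^'d \<Rightarrow> real^'d" where
  "point_map zb t = foldr (\<lambda>l x. alpha (t ! (l - 1)) *\<^sub>R x + (1 - alpha (t ! (l - 1))) *\<^sub>R zb (take l t))
       [1..<Suc (length t)]"

lemma query_point_eq: "query_point z zb t = point_map zb t (z t)"
  by (simp add: query_point_def point_map_def)

lemma point_map_Nil[simp]: "point_map zb [] x = x"
  by (simp add: point_map_def)

lemma point_map_snoc: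
  "point_map zb (t @ [j]) x = point_map zb t (alpha j *\<^sub>R x + (1 - alpha j) *\<^sub>R zb (t @ [j]))"
proof -
  have "point_map zb (t @ [j]) x
      = foldr (\<lambda>l x. alpha ((t @ [j]) ! (l - 1)) *\<^sub>R x + (1 - alpha ((t @ [j]) ! (l - 1))) *\<^sub>R zb (take l (t @ [j])))
         [1..<Suc (length t)] (alpha j *\<^sub>R x + (1 - alpha j) *\<^sub>R zb (t @ [j]))"
    by (simp add: point_map_def)
  also have "\<dots> = point_map zb t (alpha j *\<^sub>R x + (1 - alpha j) *\<^sub>R zb (t @ [j]))"
    unfolding point_map_def by (intro foldr_cong) (auto simp: nth_append)
  finally show ?thesis .
qed

lemma point_map_diff: "point_map zb t x - point_map zb t y = alpha_prod t *\<^sub>R (x - y)"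
proof (induction t arbitrary: x y rule: rev_induct)
  case (snoc j t)
  show ?case unfolding point_map_snoc snoc by (simp add: algebra_simps)
qed simp

lemma point_map_affine:
  "point_map zb t (a *\<^sub>R x + (1 - a) *\<^sub>R y) = a *\<^sub>R point_map zb t x + (1 - a) *\<^sub>R point_map zb t y"
proof -
  have 1: "point_map zb t (a *\<^sub>R x + (1 - a) *\<^sub>R y) = point_map zb t y + alpha_prod t *\<^sub>R (a *\<^sub>R (x - y))"
    using point_map_diff[of zb t "a *\<^sub>R x + (1 - a) *\<^sub>R y" y] by (simp add: algebra_simps)
  have 2: "point_map zb t x = point_map zb t y + alpha_prod t *\<^sub>R (x - y)"
    using point_map_diff[of zb t x y] by (simp add: algebra_simps)
  show ?thesis unfolding 1 2 by (simp add: algebra_simps)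
qed

lemma (in spd) q_convex:
  assumes "0 \<le> a" "a \<le> 1"
  shows "q (a *\<^sub>R x + (1 - a) *\<^sub>R y) \<le> a * q x + (1 - a) * q y"
proof -
  have "q (a *\<^sub>R x + (1 - a) *\<^sub>R y) = a\<^sup>2 * q x + 2 * (a * (1 - a) * ((P *v x) \<bullet> y)) + (1 - a)\<^sup>2 * q y"
    by (simp add: q_add q_scale matrix_vector_mult_scaleR)
  also have "\<dots> = a * q x + (1 - a) * q y - a * (1 - a) * q (x - y)"
    unfolding q_diff by (simp add: power2_eq_square algebra_simps)
  finally show ?thesis using assms by simp
qed

locale sliding_problem = sliding P Z n T Q G "eta L \<tau> M T"
  for P :: "real^'d^'d" and Z n T Q and G :: "nat \<Rightarrow> real^'d \<Rightarrow> 's \<Rightarrow> real^'d" and L \<tau> M +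
  fixes p :: "nat \<Rightarrow> real^'d \<Rightarrow> real" and gradp :: "nat \<Rightarrow> real^'d \<Rightarrow> real^'d"
  assumes T_pos: "\<And>i. i \<in> {1..n} \<Longrightarrow> T i > 0"
    and L_nonneg: "\<And>i. i \<in> {1..n} \<Longrightarrow> L i \<ge> 0"
    and M_nonneg: "\<And>i. i \<in> {1..n} \<Longrightarrow> M i \<ge> 0"
    and tau_nonneg: "\<And>i. i \<in> {1..n} \<Longrightarrow> \<tau> i \<ge> 0"
    and coef_pos: "\<And>i. i \<in> {1..n} \<Longrightarrow> L i + \<tau> i + M i > 0"
    and Q_mono: "\<And>i. i \<in> {1..n} \<Longrightarrow> monotone_map_on Z (Q i)"
    and Q_lip: "\<And>i. i \<in> {1..n} \<Longrightarrow> mlipschitz_on P (M i) Z (Q i)"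
    and p_conv: "\<And>i. i \<in> {1..n} \<Longrightarrow> convex_on Z (p i)"
    and p_deriv: "\<And>i v. i \<in> {1..n} \<Longrightarrow> v \<in> Z \<Longrightarrow> (p i has_derivative (\<lambda>h. gradp i v \<bullet> h)) (at v within Z)"
    and p_lip: "\<And>i. i \<in> {1..n} \<Longrightarrow> mlipschitz_on P (L i) Z (gradp i)"
begin

abbreviation \<eta> where "\<eta> \<equiv> eta L \<tau> M T"

text \<open>The coefficient with which what happens at a node enters the final average: by
  \<open>alpha_recurrence\<close> the pass with counter \<open>j\<close> has the share \<open>(alpha (T l - 1))\<^sup>2 / alpha j\<close> in the
  average of its loop.\<close>

definition W :: "nat list \<Rightarrow> real" where
  "W = index_prod (\<lambda>l j. (alpha (T l - 1))\<^sup>2 / alpha j)"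

definition K :: "nat \<Rightarrow> real" where
  "K i = (L i + \<tau> i) * (\<Prod>l=1..i. (alpha (T l - 1))\<^sup>2) + M i * (\<Prod>l=1..i. alpha (T l - 1))"

lemma W_pos[simp]: "W t > 0" unfolding W_def by (rule index_prod_pos) simp

lemma W_snoc: "W (t @ [j]) = W t * ((alpha (T (Suc (length t)) - 1))\<^sup>2 / alpha j)"
  by (simp add: W_def)

lemma eta_index_prod:
  "\<eta> (length t) t = (L (length t) + \<tau> (length t)) * alpha_prod t
     + M (length t) * index_prod (\<lambda>l j. alpha j / alpha (T l - 1)) t"
  by (simp add: eta_def index_prod_def)

text \<open>The parameters are tuned for this cancellation: the weighted coefficient of the squared
  distances is the same at all nodes of a level, so that the distances telescope across loops.\<close>

lemma W_eta: "W t * \<eta> (length t) t = K (length t)"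
proof -
  have 1: "W t * alpha_prod t = (\<Prod>l=1..length t. (alpha (T l - 1))\<^sup>2)"
    unfolding W_def index_prod_mult by (simp add: index_prod_def)
  have 2: "W t * index_prod (\<lambda>l j. alpha j / alpha (T l - 1)) t = (\<Prod>l=1..length t. alpha (T l - 1))"
    unfolding W_def index_prod_mult by (simp add: index_prod_def power2_eq_square)
  show ?thesis unfolding eta_index_prod K_def 1[symmetric] 2[symmetric] by (simp add: algebra_simps)
qed

lemma K_nonneg: "i \<in> {1..n} \<Longrightarrow> K i \<ge> 0"
  unfolding K_def using L_nonneg M_nonneg tau_nonneg
  by (intro add_nonneg_nonneg mult_nonneg_nonneg prod_nonneg) (auto simp: less_imp_le)

lemma eta_pos:
  assumes "length t \<in> {1..n}" shows "\<eta> (length t) t > 0"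
proof -
  have "index_prod (\<lambda>l j. alpha j / alpha (T l - 1)) t > 0" by (rule index_prod_pos) simp
  then show ?thesis
    unfolding eta_index_prod using L_nonneg[OF assms] M_nonneg[OF assms] tau_nonneg[OF assms] coef_pos[OF assms]
    by (cases "M (length t) = 0") (auto intro!: add_nonneg_pos simp: less_imp_le)
qed

definition admissible :: "nat list \<Rightarrow> bool" where
  "admissible t \<longleftrightarrow> length t \<le> n \<and> (\<forall>l<length t. t ! l < T (Suc l))"

lemma admissible_snoc: "admissible (t @ [j]) \<longleftrightarrow> admissible t \<and> length t < n \<and> j < T (Suc (length t))"
  by (auto simp: admissible_def nth_append less_Suc_eq)

text \<open>For legal loop counters the ratios \<open>alpha (t ! (l - 1)) / alpha (T l - 1)\<close> are at least one,
  since \<open>alpha\<close> decreases. This leaves a full \<open>M\<close> for the extragradient step.\<close>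

lemma eta_lower:
  assumes "admissible t" "length t \<in> {1..n}"
  shows "\<eta> (length t) t \<ge> (L (length t) + \<tau> (length t)) * alpha_prod t + M (length t)"
proof -
  have "index_prod (\<lambda>l j. alpha j / alpha (T l - 1)) t \<ge> 1"
    unfolding index_prod_def
  proof (rule prod_ge_1)
    fix l assume l: "l \<in> {1..length t}"
    then have "l - 1 < length t" by auto
    then have "t ! (l - 1) < T (Suc (l - 1))" using assms(1) by (simp only: admissible_def)
    then have "t ! (l - 1) \<le> T l - 1" using l by simp
    then show "1 \<le> alpha (t ! (l - 1)) / alpha (T l - 1)"
      using alpha_antimono by (simp add: le_divide_eq)
  qed
  from mult_left_mono[OF this M_nonneg[OF assms(2)]] show ?thesis
    unfolding eta_index_prod by simp
qed

lemma oracle_calls_Suc: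
  "sum_list (map f (oracle_calls T (Suc d) t))
     = (\<Sum>j<T (Suc (length t)). f (t @ [j]) + sum_list (map f (oracle_calls T d (t @ [j]))))"
  for f :: "nat list \<Rightarrow> real"
proof -
  have "sum_list (map f (concat (map (\<lambda>j. (t @ [j]) # oracle_calls T d (t @ [j])) js)))
      = sum_list (map (\<lambda>j. f (t @ [j]) + sum_list (map f (oracle_calls T d (t @ [j])))) js)" for js
    by (induction js) auto
  then show ?thesis by (simp add: interv_sum_list_conv_sum_set_nat atLeast0LessThan)
qed

context
  fixes \<xi> :: "nat list \<Rightarrow> 's" and z zb :: "'d table"
  assumes z_in: "table_in z" and zb_in: "table_in zb"
begin

definition err :: "nat list \<Rightarrow> real^'d" where
  "err t = G (length t) (query_point z zb t) (\<xi> t) - gradp (length t) (query_point z zb t)"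

text \<open>The cost of replacing the gradient by the oracle answer at one node: the quadratic part is what
  Young's inequality leaves of the move from the iterate to the returned point, and the rest pairs the
  error with the offset of the iterate, which is known before the call, from \<open>v\<close>.\<close>

definition noise :: "real^'d \<Rightarrow> nat list \<Rightarrow> real" where
  "noise v t = (dual_mnorm P (err t))\<^sup>2 / (2 * (\<tau> (length t) * alpha_prod t)) - err t \<bullet> (z t - v)"

text \<open>The terms of the leaf objective of level \<open>i\<close>, in the form in which \<open>three_point\<close> bounds them.\<close>

definition model_gap :: "nat list \<Rightarrow> real^'d \<Rightarrow> nat \<Rightarrow> real^'d \<Rightarrow> real" where
  "model_gap t v i x = (G i (query_point z zb (take i t)) (\<xi> (take i t)) + Q i (z (take i t))) \<bullet> (x - v)
     + \<eta> i (take i t) / 2 * (q (x - z (take i t)) + q (v - x) - q (v - z (take i t)))"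

definition true_gap :: "nat list \<Rightarrow> real^'d \<Rightarrow> nat \<Rightarrow> real^'d \<Rightarrow> real" where
  "true_gap t v i x = (p i (point_map zb t x) - p i (point_map zb t v)) / alpha_prod t + Q i v \<bullet> (x - v)"

text \<open>The potential of the recursion: levels already entered are represented by their models, deeper
  levels by their true gaps. At the root it is the gap to be bounded, at a leaf it is nonpositive.\<close>

definition mixed_gap :: "nat list \<Rightarrow> real^'d \<Rightarrow> real^'d \<Rightarrow> real" where
  "mixed_gap t v x = (\<Sum>i=1..length t. model_gap t v i x) + (\<Sum>i=Suc (length t)..n. true_gap t v i x)"

lemma z_Z: "z u \<in> Z" and zb_Z: "zb u \<in> Z"
  using z_in zb_in by (auto simp: table_in_def)

lemma point_map_in: "x \<in> Z \<Longrightarrow> point_map zb t x \<in> Z"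
proof (induction t arbitrary: x rule: rev_induct)
  case (snoc j t)
  then show ?case using convex_comb_in zb_Z by (simp add: point_map_snoc)
qed simp

lemma smooth_step:
  assumes i: "length t = i" "i \<in> {1..n}" and x: "x \<in> Z" and v: "v \<in> Z"
  shows "(p i (point_map zb t x) - p i (point_map zb t v)) / alpha_prod t
    \<le> gradp i (query_point z zb t) \<bullet> (x - v) + L i * alpha_prod t / 2 * q (x - z t)"
proof -
  let ?y = "point_map zb t (z t)" and ?\<pi> = "alpha_prod t"
  have y: "?y \<in> Z" by (rule point_map_in[OF z_Z])
  have "p i (point_map zb t x) \<le> p i ?y + gradp i ?y \<bullet> (point_map zb t x - ?y)
      + L i / 2 * q (point_map zb t x - ?y)"
    by (rule descent[OF p_deriv[OF i(2)] p_lip[OF i(2)] point_map_in[OF x] y])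
  moreover have "p i ?y + gradp i ?y \<bullet> (point_map zb t v - ?y) \<le> p i (point_map zb t v)"
    by (rule above_tangent[OF p_deriv[OF i(2)] p_conv[OF i(2)] point_map_in[OF v] y])
  ultimately have "p i (point_map zb t x) - p i (point_map zb t v)
      \<le> gradp i ?y \<bullet> (?\<pi> *\<^sub>R (x - z t)) - gradp i ?y \<bullet> (?\<pi> *\<^sub>R (v - z t)) + L i / 2 * (?\<pi>\<^sup>2 * q (x - z t))"
    unfolding point_map_diff q_scale by linarith
  also have "\<dots> = (gradp i ?y \<bullet> (x - v) + L i * ?\<pi> / 2 * q (x - z t)) * ?\<pi>"
    by (simp add: inner_diff_right algebra_simps power2_eq_square)
  finally show ?thesis
    by (simp add: query_point_eq pos_divide_le_eq)
qed

text \<open>The terms in \<open>Q\<close> are those of an extragradient method: the correction step provides the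
  distance to the next iterate \<open>y\<close>, and the Lipschitz error is paid by the part \<open>M\<close> of the step
  parameter. The smoothness error and the noise are paid by the part \<open>L + \<tau>\<close>.\<close>

lemma node_step:
  assumes i: "length t = i" "i \<in> {1..n}" and adm: "admissible t"
    and x: "x \<in> Z" and v: "v \<in> Z" and err0: "\<tau> i = 0 \<Longrightarrow> err t = 0"
    and y: "y = arg_min_on (prox_obj {()} (\<lambda>_. \<eta> i t) (\<lambda>_. Q i x - Q i (z t)) (\<lambda>_. x)) Z"
  shows "true_gap t v i x \<le> model_gap t v i x + \<eta> i t / 2 * (q (v - z t) - q (v - y)) + noise v t"
proof -
  let ?\<pi> = "alpha_prod t" and ?g = "gradp i (query_point z zb t)"
  have G: "G i (query_point z zb t) (\<xi> t) = ?g + err t" by (simp add: err_def i)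
  have yZ: "y \<in> Z" unfolding y by (rule prox_in)
  have a: "(Q i x - Q i (z t)) \<bullet> (y - v) + \<eta> i t / 2 * (q (y - x) + q (v - y) - q (v - x)) \<le> 0"
    using three_point[OF v, where I="{()}" and g="\<lambda>_. Q i x - Q i (z t)" and h="\<lambda>_. \<eta> i t" and a="\<lambda>_. x"]
    by (simp add: y)
  have b: "(p i (point_map zb t x) - p i (point_map zb t v)) / ?\<pi> \<le> ?g \<bullet> (x - v) + L i * ?\<pi> / 2 * q (x - z t)"
    by (rule smooth_step[OF i x v])
  have c: "err t \<bullet> (x - z t) \<ge> - (dual_mnorm P (err t))\<^sup>2 / (2 * (\<tau> i * ?\<pi>)) - \<tau> i * ?\<pi> / 2 * q (x - z t)"
  proof (cases "\<tau> i = 0")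
    case False
    then have "\<tau> i * ?\<pi> > 0" using tau_nonneg[OF i(2)] by simp
    then show ?thesis by (rule young)
  qed (simp add: err0)
  have c': "err t \<bullet> (x - v) = err t \<bullet> (x - z t) + err t \<bullet> (z t - v)"
    by (simp add: inner_diff_right)
  have d: "(Q i x - Q i (z t)) \<bullet> (y - x) \<ge> - (M i / 2 * (q (x - z t) + q (y - x)))"
  proof -
    let ?a = "mnorm P (x - z t)" and ?b = "mnorm P (y - x)"
    have "- ((Q i x - Q i (z t)) \<bullet> (y - x)) \<le> dual_mnorm P (Q i x - Q i (z t)) * ?b"
      using dual_cauchy_schwarz[of "- (Q i x - Q i (z t))" "y - x"]
      unfolding dual_mnorm_minus inner_minus_left .
    also have "\<dots> \<le> (M i * ?a) * ?b"
      using Q_lip[OF i(2)] x z_Z by (intro mult_right_mono mnorm_nonneg) (auto simp: mlipschitz_on_def)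
    also have "\<dots> = M i / 2 * (2 * ?a * ?b)" by simp
    also have "\<dots> \<le> M i / 2 * (?a\<^sup>2 + ?b\<^sup>2)"
      using M_nonneg[OF i(2)] sum_squares_bound[of ?a ?b] by (intro mult_left_mono) auto
    finally show ?thesis unfolding mnorm_sq by linarith
  qed
  have e: "Q i x \<bullet> (x - v) \<ge> Q i v \<bullet> (x - v)"
    using Q_mono[OF i(2)] x v by (auto simp: monotone_map_on_def inner_diff_left)
  have f: "((L i + \<tau> i) * ?\<pi> + M i) / 2 * (q (x - z t) + q (y - x)) \<le> \<eta> i t / 2 * (q (x - z t) + q (y - x))"
    using eta_lower[OF adm] i by (intro mult_right_mono) auto
  have f': "(L i + \<tau> i) * ?\<pi> / 2 * q (y - x) \<ge> 0"
    using L_nonneg[OF i(2)] tau_nonneg[OF i(2)]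
    by (intro mult_nonneg_nonneg divide_nonneg_nonneg add_nonneg_nonneg) (auto simp: less_imp_le)
  have "Q i (z t) \<bullet> (x - v) + (Q i x - Q i (z t)) \<bullet> (y - v)
      = Q i x \<bullet> (x - v) + (Q i x - Q i (z t)) \<bullet> (y - x)"
    by (simp add: inner_diff_left inner_diff_right)
  then show ?thesis
    using a b c d e f f' i(1)
    unfolding true_gap_def model_gap_def noise_def
    by (simp add: G c' inner_add_left ring_distribs add_divide_distrib diff_divide_distrib)
qed

lemma model_gap_convex:
  assumes "i \<in> {1..n}" "i \<le> length t" "0 \<le> a" "a \<le> 1"
  shows "model_gap t v i (a *\<^sub>R x + (1 - a) *\<^sub>R y) \<le> a * model_gap t v i x + (1 - a) * model_gap t v i y"
proof -
  let ?b = "z (take i t)" and ?g = "G i (query_point z zb (take i t)) (\<xi> (take i t)) + Q i (z (take i t))"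
  have 1: "q (a *\<^sub>R x + (1 - a) *\<^sub>R y - ?b) \<le> a * q (x - ?b) + (1 - a) * q (y - ?b)"
    using q_convex[OF assms(3,4), of "x - ?b" "y - ?b"] by (simp add: algebra_simps)
  have 2: "q (v - (a *\<^sub>R x + (1 - a) *\<^sub>R y)) \<le> a * q (v - x) + (1 - a) * q (v - y)"
    using q_convex[OF assms(3,4), of "v - x" "v - y"] by (simp add: algebra_simps)
  have 3: "?g \<bullet> (a *\<^sub>R x + (1 - a) *\<^sub>R y - v) = a * (?g \<bullet> (x - v)) + (1 - a) * (?g \<bullet> (y - v))"
    by (simp add: inner_add_right inner_diff_right algebra_simps)
  have 4: "\<eta> i (take i t) / 2 \<ge> 0"
    using eta_pos[of "take i t"] assms(1,2) by (simp add: min_absorb2 less_imp_le)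
  have 5: "a * g1 + (1 - a) * g2 + h * (A + B - C) \<le> a * (g1 + h * (A1 + B1 - C)) + (1 - a) * (g2 + h * (A2 + B2 - C))"
    if "h * (A + B) \<le> h * ((a * A1 + (1 - a) * A2) + (a * B1 + (1 - a) * B2))"
    for g1 g2 h A B C A1 A2 B1 B2 :: real
    using that by (simp add: algebra_simps)
  show ?thesis
    unfolding model_gap_def 3 by (rule 5[OF mult_left_mono[OF add_mono[OF 1 2] 4]])
qed

text \<open>Passing to the deeper node replaces the comparison point \<open>v\<close> by its average with the current
  mean, where convexity applies; the factor \<open>alpha j\<close> is exactly the change of \<open>alpha_prod\<close>.\<close>

lemma true_gap_step:
  assumes "i \<in> {1..n}" "x \<in> Z" "v \<in> Z"
  shows "true_gap t v i (alpha j *\<^sub>R x + (1 - alpha j) *\<^sub>R zb (t @ [j]))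
    \<le> alpha j * true_gap (t @ [j]) v i x + (1 - alpha j) * true_gap t v i (zb (t @ [j]))"
proof -
  let ?y = "zb (t @ [j])" and ?a = "alpha j" and ?\<pi> = "alpha_prod t"
  let ?x = "?a *\<^sub>R x + (1 - ?a) *\<^sub>R ?y"
  have px: "point_map zb (t @ [j]) x = point_map zb t ?x" by (simp add: point_map_snoc)
  have pv: "point_map zb (t @ [j]) v = ?a *\<^sub>R point_map zb t v + (1 - ?a) *\<^sub>R point_map zb t ?y"
    by (simp add: point_map_snoc point_map_affine)
  have "p i (point_map zb (t @ [j]) v) \<le> ?a * p i (point_map zb t v) + (1 - ?a) * p i (point_map zb t ?y)"
    unfolding pv
    using convex_onD[OF p_conv[OF assms(1)], of "1 - ?a" "point_map zb t v" "point_map zb t ?y"]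
      point_map_in[OF assms(3)] point_map_in[OF zb_Z] alpha_bounds[of j] by simp
  then have "p i (point_map zb t ?x) - p i (point_map zb t v)
     \<le> (p i (point_map zb (t @ [j]) x) - p i (point_map zb (t @ [j]) v))
       + (1 - ?a) * (p i (point_map zb t ?y) - p i (point_map zb t v))"
    unfolding px by (simp add: algebra_simps)
  then have "(p i (point_map zb t ?x) - p i (point_map zb t v)) / ?\<pi>
     \<le> ((p i (point_map zb (t @ [j]) x) - p i (point_map zb (t @ [j]) v))
       + (1 - ?a) * (p i (point_map zb t ?y) - p i (point_map zb t v))) / ?\<pi>"
    by (intro divide_right_mono) (auto simp: less_imp_le)
  also have "\<dots> = ?a * ((p i (point_map zb (t @ [j]) x) - p i (point_map zb (t @ [j]) v)) / alpha_prod (t @ [j]))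
       + (1 - ?a) * ((p i (point_map zb t ?y) - p i (point_map zb t v)) / ?\<pi>)"
    by (simp add: add_divide_distrib)
  finally have 1: "(p i (point_map zb t ?x) - p i (point_map zb t v)) / ?\<pi> \<le> \<dots>" .
  have 2: "Q i v \<bullet> (?x - v) = ?a * (Q i v \<bullet> (x - v)) + (1 - ?a) * (Q i v \<bullet> (?y - v))"
    by (simp add: inner_add_right inner_diff_right algebra_simps)
  show ?thesis using 1 unfolding true_gap_def 2 by (simp add: distrib_left)
qed

lemma model_gap_snoc: "i \<le> length t \<Longrightarrow> model_gap (t @ [j]) v i x = model_gap t v i x"
  by (simp add: model_gap_def)

lemma mixed_gap_step:
  assumes adm: "admissible (t @ [j])"
    and x: "x \<in> Z" and v: "v \<in> Z" and err0: "\<tau> (Suc (length t)) = 0 \<Longrightarrow> err (t @ [j]) = 0"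
    and y: "y = arg_min_on (prox_obj {()} (\<lambda>_. \<eta> (Suc (length t)) (t @ [j]))
        (\<lambda>_. Q (Suc (length t)) x - Q (Suc (length t)) (z (t @ [j]))) (\<lambda>_. x)) Z"
  shows "mixed_gap t v (alpha j *\<^sub>R x + (1 - alpha j) *\<^sub>R zb (t @ [j]))
    \<le> (1 - alpha j) * mixed_gap t v (zb (t @ [j]))
      + alpha j * (mixed_gap (t @ [j]) v x
          + \<eta> (Suc (length t)) (t @ [j]) / 2 * (q (v - z (t @ [j])) - q (v - y)) + noise v (t @ [j]))"
    (is "mixed_gap t v ?x \<le> _ + _ * (_ + ?D + ?N)")
proof -
  let ?a = "alpha j" and ?k = "length t" and ?y = "zb (t @ [j])"
  have k: "Suc ?k \<in> {1..n}" using adm by (simp add: admissible_snoc)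
  have A: "(\<Sum>i=1..?k. model_gap t v i ?x)
      \<le> ?a * (\<Sum>i=1..?k. model_gap (t @ [j]) v i x) + (1 - ?a) * (\<Sum>i=1..?k. model_gap t v i ?y)"
    unfolding sum_distrib_left sum.distrib[symmetric]
  proof (rule sum_mono)
    fix i assume i: "i \<in> {1..?k}"
    then show "model_gap t v i ?x \<le> ?a * model_gap (t @ [j]) v i x + (1 - ?a) * model_gap t v i ?y"
      using model_gap_convex[of i t ?a v x ?y] alpha_bounds[of j] k by (simp add: model_gap_snoc)
  qed
  have B: "(\<Sum>i=Suc ?k..n. true_gap t v i ?x)
      \<le> ?a * (\<Sum>i=Suc ?k..n. true_gap (t @ [j]) v i x) + (1 - ?a) * (\<Sum>i=Suc ?k..n. true_gap t v i ?y)"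
    unfolding sum_distrib_left sum.distrib[symmetric]
    by (rule sum_mono) (auto intro!: true_gap_step x v)
  have split: "(\<Sum>i=Suc ?k..n. true_gap (t @ [j]) v i x)
      = true_gap (t @ [j]) v (Suc ?k) x + (\<Sum>i=Suc (Suc ?k)..n. true_gap (t @ [j]) v i x)"
    using k by (subst sum.atLeast_Suc_atMost) auto
  have C: "true_gap (t @ [j]) v (Suc ?k) x \<le> model_gap (t @ [j]) v (Suc ?k) x + ?D + ?N"
    by (rule node_step[OF _ k adm x v err0 y]) simp_all
  have "(\<Sum>i=1..?k. model_gap (t @ [j]) v i x) + (\<Sum>i=Suc ?k..n. true_gap (t @ [j]) v i x)
     \<le> mixed_gap (t @ [j]) v x + ?D + ?N"
    unfolding mixed_gap_def split using C by simp
  then have "?a * ((\<Sum>i=1..?k. model_gap (t @ [j]) v i x) + (\<Sum>i=Suc ?k..n. true_gap (t @ [j]) v i x))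
     \<le> ?a * (mixed_gap (t @ [j]) v x + ?D + ?N)"
    by (intro mult_left_mono) (auto simp: less_imp_le)
  then show ?thesis
    using A B unfolding mixed_gap_def[of t] by (simp only: distrib_left)
qed

text \<open>Dividing the averaging step by \<open>(alpha j)\<^sup>2\<close> makes the coefficient of the old mean equal to
  the one with which it left the previous step.\<close>

lemma loop_telescope:
  assumes tr: "trace \<xi> (Suc d) t z zb" and len: "length t + Suc d = n" and adm: "admissible t"
    and v: "v \<in> Z" and err0: "\<And>u. admissible u \<Longrightarrow> u \<noteq> [] \<Longrightarrow> \<tau> (length u) = 0 \<Longrightarrow> err u = 0"
    and m: "m < T (Suc (length t))"
  defines "b \<equiv> \<lambda>j. mixed_gap (t @ [j]) v (result \<xi> d (t @ [j]) z zb)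
      + \<eta> (Suc (length t)) (t @ [j]) / 2 * (q (v - z (t @ [j])) - q (v - z (t @ [j + 1])))
      + noise v (t @ [j])"
  shows "mixed_gap t v (zb (t @ [Suc m])) / (alpha m)\<^sup>2 \<le> (\<Sum>j\<le>m. b j / alpha j)"
proof -
  have step: "mixed_gap t v (zb (t @ [Suc j])) \<le> (1 - alpha j) * mixed_gap t v (zb (t @ [j])) + alpha j * b j"
    if "j < T (Suc (length t))" for j
  proof -
    have l: "loop_eqs \<xi> d t j z zb" using tr that by simp
    have adm': "admissible (t @ [j])" using adm that len by (simp add: admissible_snoc)
    have "result \<xi> d (t @ [j]) z zb \<in> Z"
      using z_in zb_in by (auto simp: result_def leaf_eq_prox table_in_def intro: prox_in)
    from mixed_gap_step[OF adm' this v, of "z (t @ [j + 1])"]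
    show ?thesis using l err0[OF adm'] by (simp add: loop_eqs_def b_def)
  qed
  show ?thesis using m
  proof (induction m)
    case 0
    \<comment> \<open>As \<open>alpha 0 = 1\<close>, the first pass forgets the initial mean.\<close>
    have "mixed_gap t v (zb (t @ [Suc 0])) \<le> b 0" using step[of 0] 0 by simp
    then show ?case by simp
  next
    case (Suc m)
    let ?a = "alpha (Suc m)"
    have "mixed_gap t v (zb (t @ [Suc (Suc m)])) / ?a\<^sup>2
       \<le> ((1 - ?a) * mixed_gap t v (zb (t @ [Suc m])) + ?a * b (Suc m)) / ?a\<^sup>2"
      using step[OF Suc.prems] by (intro divide_right_mono) auto
    also have "\<dots> = (1 - ?a) / ?a\<^sup>2 * mixed_gap t v (zb (t @ [Suc m])) + b (Suc m) / ?a"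
      by (simp add: add_divide_distrib power2_eq_square del: alpha.simps)
    also have "\<dots> = mixed_gap t v (zb (t @ [Suc m])) / (alpha m)\<^sup>2 + b (Suc m) / ?a"
      unfolding alpha_recurrence by simp
    also have "\<dots> \<le> (\<Sum>j\<le>m. b j / alpha j) + b (Suc m) / ?a"
      using Suc by simp
    finally show ?case by (simp del: alpha.simps)
  qed
qed

text \<open>Induction from the leaves upwards. The distances of the deeper levels telescope because the
  carry-over starts each pass of the loop where the inner loops of the previous pass ended; those of the
  level of the loop telescope by the correction steps.\<close>

lemma energy:
  assumes "trace \<xi> d t z zb" and "length t + d = n" and "admissible t"
    and v: "v \<in> Z" and err0: "\<And>u. admissible u \<Longrightarrow> u \<noteq> [] \<Longrightarrow> \<tau> (length u) = 0 \<Longrightarrow> err u = 0"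
  shows "W t * mixed_gap t v (result \<xi> d t z zb)
    \<le> (\<Sum>i=Suc (length t)..n. K i / 2 * (q (v - z (t @ replicate (i - length t) 0))
         - q (v - z (t @ [T (Suc (length t))] @ replicate (i - Suc (length t)) 0))))
      + sum_list (map (\<lambda>u. W u * noise v u) (oracle_calls T d t))"
  using assms(1-3)
proof (induction d arbitrary: t)
  case 0
  then have len: "length t = n" by simp
  have "mixed_gap t v (leaf \<xi> t z zb) \<le> 0"
    using three_point[OF v, where I="{1..n}" and h="\<lambda>i. \<eta> i (take i t)" and a="\<lambda>i. z (take i t)"
        and g="\<lambda>i. G i (query_point z zb (take i t)) (\<xi> (take i t)) + Q i (z (take i t))"]
    by (simp add: mixed_gap_def model_gap_def len leaf_eq_prox)
  then show ?case by (simp add: result_def len mult_nonneg_nonpos less_imp_le)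
next
  case (Suc d)
  let ?k = "length t"
  let ?T = "T (Suc ?k)"
  have k: "Suc ?k \<in> {1..n}" using Suc.prems by auto
  have T: "?T > 0" by (rule T_pos[OF k])
  define b where "b j = mixed_gap (t @ [j]) v (result \<xi> d (t @ [j]) z zb)
      + \<eta> (Suc ?k) (t @ [j]) / 2 * (q (v - z (t @ [j])) - q (v - z (t @ [j + 1])))
      + noise v (t @ [j])" for j
  define g where "g i j = K i / 2 * q (v - z (t @ [j] @ replicate (i - Suc ?k) 0))" for i j
  define S where "S u d = sum_list (map (\<lambda>u. W u * noise v u) (oracle_calls T d u))" for u d
  have node: "W (t @ [j]) * b j \<le> (\<Sum>i=Suc ?k..n. g i j - g i (Suc j))
      + (W (t @ [j]) * noise v (t @ [j]) + S (t @ [j]) d)" if j: "j < ?T" for j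
  proof -
    have tr: "trace \<xi> d (t @ [j]) z zb" and l: "loop_eqs \<xi> d t j z zb" using Suc.prems(1) j by auto
    have "W (t @ [j]) * mixed_gap (t @ [j]) v (result \<xi> d (t @ [j]) z zb)
      \<le> (\<Sum>i=Suc (Suc ?k)..n. K i / 2 * (q (v - z ((t @ [j]) @ replicate (i - Suc ?k) 0))
         - q (v - z ((t @ [j]) @ [T (Suc (Suc ?k))] @ replicate (i - Suc (Suc ?k)) 0)))) + S (t @ [j]) d"
      using Suc.IH[OF tr] Suc.prems j by (simp add: admissible_snoc S_def)
    \<comment> \<open>The carry-over identifies the end of this pass with the start of the next one.\<close>
    also have "(\<Sum>i=Suc (Suc ?k)..n. K i / 2 * (q (v - z ((t @ [j]) @ replicate (i - Suc ?k) 0))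
         - q (v - z ((t @ [j]) @ [T (Suc (Suc ?k))] @ replicate (i - Suc (Suc ?k)) 0))))
       = (\<Sum>i=Suc (Suc ?k)..n. g i j - g i (Suc j))"
    proof (rule sum.cong[OF refl])
      fix i assume i: "i \<in> {Suc (Suc ?k)..n}"
      define r where "r = i - Suc (Suc ?k)"
      have r: "r < d" "i - Suc ?k = Suc r" using i Suc.prems(2) by (auto simp: r_def)
      have "z (t @ [j + 1] @ replicate (Suc r) 0) = z (t @ [j, T (?k + 2)] @ replicate r 0)"
        using l r(1) unfolding loop_eqs_def by blast
      then show "K i / 2 * (q (v - z ((t @ [j]) @ replicate (i - Suc ?k) 0))
         - q (v - z ((t @ [j]) @ [T (Suc (Suc ?k))] @ replicate (i - Suc (Suc ?k)) 0))) = g i j - g i (Suc j)"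
        unfolding g_def r(2) r_def[symmetric] by (simp add: right_diff_distrib)
    qed
    finally have 1: "W (t @ [j]) * mixed_gap (t @ [j]) v (result \<xi> d (t @ [j]) z zb)
      \<le> (\<Sum>i=Suc (Suc ?k)..n. g i j - g i (Suc j)) + S (t @ [j]) d" .
    have "W (t @ [j]) * \<eta> (Suc ?k) (t @ [j]) = K (Suc ?k)"
      using W_eta[of "t @ [j]"] by (simp only: length_append_singleton)
    then have "W (t @ [j]) * (\<eta> (Suc ?k) (t @ [j]) / 2 * (q (v - z (t @ [j])) - q (v - z (t @ [j + 1]))))
        = K (Suc ?k) / 2 * (q (v - z (t @ [j])) - q (v - z (t @ [j + 1])))"
      by (simp only: mult.assoc[symmetric] times_divide_eq_right)
    also have "\<dots> = g (Suc ?k) j - g (Suc ?k) (Suc j)"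
      by (simp add: g_def right_diff_distrib)
    finally have 2: "W (t @ [j]) * (\<eta> (Suc ?k) (t @ [j]) / 2 * (q (v - z (t @ [j])) - q (v - z (t @ [j + 1]))))
        = g (Suc ?k) j - g (Suc ?k) (Suc j)" .
    have 3: "(\<Sum>i=Suc ?k..n. g i j - g i (Suc j))
        = (g (Suc ?k) j - g (Suc ?k) (Suc j)) + (\<Sum>i=Suc (Suc ?k)..n. g i j - g i (Suc j))"
      using k by (subst sum.atLeast_Suc_atMost) auto
    show ?thesis unfolding b_def distrib_left 2 3 using 1 by linarith
  qed
  obtain m where m: "?T = Suc m" using T by (cases ?T) auto
  have "mixed_gap t v (zb (t @ [Suc m])) / (alpha m)\<^sup>2 \<le> (\<Sum>j\<le>m. b j / alpha j)"
    unfolding b_def by (rule loop_telescope[OF Suc.prems v err0]) (use m in auto)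
  then have "W t * (alpha m)\<^sup>2 * (mixed_gap t v (zb (t @ [Suc m])) / (alpha m)\<^sup>2)
      \<le> W t * (alpha m)\<^sup>2 * (\<Sum>j\<le>m. b j / alpha j)"
    by (intro mult_left_mono) (auto simp: less_imp_le)
  then have "W t * mixed_gap t v (zb (t @ [?T])) \<le> (\<Sum>j\<le>m. W t * (alpha m)\<^sup>2 * (b j / alpha j))"
    by (simp add: m sum_distrib_left)
  also have "\<dots> = (\<Sum>j<?T. W (t @ [j]) * b j)"
    unfolding W_snoc m by (intro sum.cong) auto
  also have "\<dots> \<le> (\<Sum>j<?T. (\<Sum>i=Suc ?k..n. g i j - g i (Suc j))
      + (W (t @ [j]) * noise v (t @ [j]) + S (t @ [j]) d))"
    by (intro sum_mono node) auto
  also have "\<dots> = (\<Sum>i=Suc ?k..n. \<Sum>j<?T. g i j - g i (Suc j))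
      + (\<Sum>j<?T. W (t @ [j]) * noise v (t @ [j]) + S (t @ [j]) d)"
    unfolding sum.distrib by (subst sum.swap) simp
  also have "(\<Sum>j<?T. W (t @ [j]) * noise v (t @ [j]) + S (t @ [j]) d)
      = sum_list (map (\<lambda>u. W u * noise v u) (oracle_calls T (Suc d) t))"
    unfolding oracle_calls_Suc S_def ..
  also have "(\<Sum>i=Suc ?k..n. \<Sum>j<?T. g i j - g i (Suc j))
     = (\<Sum>i=Suc ?k..n. K i / 2 * (q (v - z (t @ replicate (i - ?k) 0))
         - q (v - z (t @ [?T] @ replicate (i - Suc ?k) 0))))"
  proof (rule sum.cong[OF refl])
    fix i assume i: "i \<in> {Suc ?k..n}"
    then have "replicate (i - ?k) 0 = [0] @ replicate (i - Suc ?k) (0::nat)"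
      by (metis Suc_diff_le append_Cons append_Nil atLeastAtMost_iff diff_Suc_Suc replicate_Suc)
    then show "(\<Sum>j<?T. g i j - g i (Suc j)) = K i / 2 * (q (v - z (t @ replicate (i - ?k) 0))
         - q (v - z (t @ [?T] @ replicate (i - Suc ?k) 0)))"
      unfolding sum_lessThan_telescope' by (simp only: g_def right_diff_distrib)
  qed
  finally show ?case by (simp add: result_def)
qed

lemma energy_total:
  assumes "trace \<xi> n [] z zb" and z0: "\<And>i. z (replicate i 0) = z0"
    and v: "v \<in> Z" and err0: "\<And>u. admissible u \<Longrightarrow> u \<noteq> [] \<Longrightarrow> \<tau> (length u) = 0 \<Longrightarrow> err u = 0"
  defines "x \<equiv> result \<xi> n [] z zb"
  shows "(\<Sum>i=1..n. p i x) - (\<Sum>i=1..n. p i v) + (\<Sum>i=1..n. Q i v) \<bullet> (x - v)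
    \<le> (\<Sum>i=1..n. K i / 2) * q (v - z0) + sum_list (map (\<lambda>u. W u * noise v u) (oracle_calls T n []))"
proof -
  have "mixed_gap [] v x = (\<Sum>i=1..n. p i x - p i v + Q i v \<bullet> (x - v))"
    by (simp add: mixed_gap_def true_gap_def)
  also have "\<dots> = (\<Sum>i=1..n. p i x) - (\<Sum>i=1..n. p i v) + (\<Sum>i=1..n. Q i v) \<bullet> (x - v)"
    by (simp add: sum.distrib sum_subtractf inner_sum_left)
  finally have 1: "mixed_gap [] v x = \<dots>" .
  have "W [] * mixed_gap [] v x \<le> (\<Sum>i=Suc 0..n. K i / 2 * (q (v - z ([] @ replicate (i - 0) 0))
         - q (v - z ([] @ [T (Suc 0)] @ replicate (i - Suc 0) 0))))
      + sum_list (map (\<lambda>u. W u * noise v u) (oracle_calls T n []))"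
    unfolding x_def by (rule energy[OF assms(1) _ _ v err0, unfolded list.size(3)]) (simp_all add: admissible_def)
  also have "(\<Sum>i=Suc 0..n. K i / 2 * (q (v - z ([] @ replicate (i - 0) 0))
         - q (v - z ([] @ [T (Suc 0)] @ replicate (i - Suc 0) 0))))
     \<le> (\<Sum>i=1..n. K i / 2 * q (v - z0))"
    unfolding One_nat_def append_Nil diff_zero z0
  proof (rule sum_mono)
    fix i assume "i \<in> {Suc 0..n}"
    then have "K i / 2 \<ge> 0" using K_nonneg[of i] by simp
    then show "K i / 2 * (q (v - z0) - q (v - z ([T (Suc 0)] @ replicate (i - Suc 0) 0))) \<le> K i / 2 * q (v - z0)"
      by (intro mult_left_mono) auto
  qed
  also have "\<dots> = (\<Sum>i=1..n. K i / 2) * q (v - z0)" by (rule sum_distrib_right[symmetric])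
  finally show ?thesis by (simp only: 1 W_def index_prod_Nil mult_1)
qed

end

end

section \<open>Weights of the nodes\<close>

lemma sum_inverse_alpha: "(\<Sum>j<Suc m. 1 / alpha j) = 1 / (alpha m)\<^sup>2"
proof (induction m)
  case (Suc m)
  have "1 / (alpha (Suc m))\<^sup>2 - 1 / alpha (Suc m) = 1 / (alpha m)\<^sup>2"
    unfolding alpha_recurrence[of m, symmetric]
    by (simp add: diff_divide_distrib power2_eq_square del: alpha.simps)
  then show ?case unfolding sum.lessThan_Suc[of _ "Suc m"] Suc by linarith
qed simp

lemma alpha_upper: "alpha m \<le> 2 / (real m + 2)"
proof -
  have "1 / alpha m \<ge> (real m + 2) / 2"
  proof (induction m)
    case (Suc m)
    have "2 / alpha m \<le> sqrt (1 + 4 / (alpha m)\<^sup>2)"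
      by (rule real_le_rsqrt) (simp add: power_divide)
    moreover have "1 / alpha (Suc m) = (1 + sqrt (1 + 4 / (alpha m)\<^sup>2)) / 2" by simp
    ultimately show ?case using Suc by (simp del: alpha.simps)
  qed simp
  then show ?thesis by (simp add: field_simps)
qed

lemma sum_alpha_ratio_le: "(\<Sum>j<T. (alpha (T - 1))\<^sup>2 / alpha j / alpha j) \<le> real T"
proof -
  have "(\<Sum>j<T. (alpha (T - 1))\<^sup>2 / alpha j / alpha j) \<le> (\<Sum>j<T. 1)"
  proof (rule sum_mono)
    fix j assume "j \<in> {..<T}"
    then have "alpha (T - 1) \<le> alpha j" by (intro alpha_antimono) auto
    then have "(alpha (T - 1))\<^sup>2 \<le> (alpha j)\<^sup>2" by (intro power_mono) (auto simp: less_imp_le)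
    then show "(alpha (T - 1))\<^sup>2 / alpha j / alpha j \<le> 1" by (simp add: divide_le_eq power2_eq_square)
  qed
  then show ?thesis by simp
qed

text \<open>One factor \<open>alpha (T - 1) / alpha j \<le> 1\<close> is given away; the remaining sum is
  \<open>sum_inverse_alpha\<close>, and the result is \<open>alpha (T - 1)\<close> itself.\<close>

lemma sum_weight_square_le:
  assumes "T > 0"
  shows "(\<Sum>j<T. ((alpha (T - 1))\<^sup>2 / alpha j)\<^sup>2) \<le> 2 / real T"
proof -
  let ?a = "alpha (T - 1)"
  obtain m where m: "T = Suc m" using assms by (cases T) auto
  have "(\<Sum>j<T. (?a\<^sup>2 / alpha j)\<^sup>2) \<le> (\<Sum>j<T. ?a ^ 3 * (1 / alpha j))"
  proof (rule sum_mono)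
    fix j assume "j \<in> {..<T}"
    then have "?a \<le> alpha j" by (intro alpha_antimono) auto
    then have "?a ^ 3 / alpha j * (?a / alpha j) \<le> ?a ^ 3 / alpha j * 1"
      by (intro mult_left_mono) (auto simp: less_imp_le divide_le_eq)
    then show "(?a\<^sup>2 / alpha j)\<^sup>2 \<le> ?a ^ 3 * (1 / alpha j)"
      by (simp add: power2_eq_square power3_eq_cube)
  qed
  also have "\<dots> = ?a"
    unfolding sum_distrib_left[symmetric] m sum_inverse_alpha
    by (simp add: power2_eq_square power3_eq_cube)
  also have "\<dots> \<le> 2 / (real (T - 1) + 2)" by (rule alpha_upper)
  also have "\<dots> \<le> 2 / real T" using assms by (intro divide_left_mono) auto
  finally show ?thesis .
qed

text \<open>Membership of all iterates along the path to \<open>t\<close> in the history at time \<open>m\<close>. The whole path is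
  needed, since a query point averages over the means of all its prefixes.\<close>

definition adapted_at :: "(nat \<Rightarrow> 'w measure) \<Rightarrow> ('w \<Rightarrow> 'd::finite table) \<Rightarrow> ('w \<Rightarrow> 'd table)
    \<Rightarrow> nat \<Rightarrow> nat list \<Rightarrow> bool" where
  "adapted_at F z zb m t \<longleftrightarrow> (\<forall>l\<in>{1..length t}. (\<lambda>\<omega>. z \<omega> (take l t)) \<in> borel_measurable (F m)
     \<and> (\<lambda>\<omega>. zb \<omega> (take l t)) \<in> borel_measurable (F m))"

context sliding_problem
begin

lemma oracle_calls_admissible:
  assumes "u \<in> set (oracle_calls T d t)" "admissible t" "length t + d = n"
  shows "admissible u \<and> length t < length u \<and> length u \<le> n"
  using assms
proof (induction d arbitrary: t)
  case (Suc d)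
  then obtain j where j: "j < T (Suc (length t))" "u = t @ [j] \<or> u \<in> set (oracle_calls T d (t @ [j]))"
    by auto
  have adm: "admissible (t @ [j])" using Suc.prems j(1) by (simp add: admissible_snoc)
  show ?case
  proof (cases "u = t @ [j]")
    case False
    then have "u \<in> set (oracle_calls T d (t @ [j]))" using j by simp
    from Suc.IH[OF this adm] Suc.prems(3) show ?thesis by simp
  qed (use adm Suc.prems in simp)
qed simp

lemma admissible_oracle_calls:
  assumes "admissible (t @ v)" "v \<noteq> []" "length t + d = n"
  shows "t @ v \<in> set (oracle_calls T d t)"
  using assms
proof (induction d arbitrary: t v)
  case 0
  then show ?case by (cases v) (auto simp: admissible_def)
next
  case (Suc d)
  then obtain j v' where v: "v = j # v'" by (cases v) auto
  have j: "j < T (length t + 1)"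
  proof -
    have "\<forall>l<length (t @ v). (t @ v) ! l < T (Suc l)"
      using Suc.prems(1) unfolding admissible_def by blast
    then have "(t @ v) ! length t < T (Suc (length t))"
      using v by (metis length_append less_add_same_cancel1 length_greater_0_conv list.distinct(1))
    then show ?thesis by (simp add: v)
  qed
  have "t @ v \<in> set ((t @ [j]) # oracle_calls T d (t @ [j]))"
    using Suc.IH[of "t @ [j]" v'] Suc.prems by (cases "v' = []") (auto simp: v)
  then show ?case using j by auto
qed

text \<open>The nodes of a level form a box, so a sum of products of components is a product of sums.\<close>

lemma level_sum:
  assumes "length t < i" "i \<le> length t + d"
  shows "sum_list (map (\<lambda>u. if length u = i then index_prod f u else 0) (oracle_calls T d t))
    = index_prod f t * (\<Prod>l=Suc (length t)..i. \<Sum>j<T l. f l j)"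
  using assms
proof (induction d arbitrary: t)
  case (Suc d)
  let ?S = "\<lambda>u. sum_list (map (\<lambda>u. if length u = i then index_prod f u else 0) (oracle_calls T d u))"
  let ?k = "length t"
  show ?case
  proof (cases "i = Suc ?k")
    case True
    have longer: "u \<in> set (oracle_calls T d t) \<Longrightarrow> length t < length u" for t d u
      by (induction d arbitrary: t) fastforce+
    have "?S (t @ [j]) = 0" for j
    proof -
      have "map (\<lambda>u. if length u = i then index_prod f u else 0) (oracle_calls T d (t @ [j]))
          = map (\<lambda>u. 0) (oracle_calls T d (t @ [j]))"
        using longer[of _ d "t @ [j]"] True by (intro map_cong) force+
      then show ?thesis unfolding \<open>map _ _ = _\<close> by simp
    qed
    then show ?thesis unfolding oracle_calls_Suc by (simp add: True sum_distrib_left)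
  next
    case False
    then have "?S (t @ [j]) = index_prod f (t @ [j]) * (\<Prod>l=Suc (Suc ?k)..i. \<Sum>j<T l. f l j)" for j
      using Suc by simp
    moreover have "(\<Prod>l=Suc ?k..i. \<Sum>j<T l. f l j)
        = (\<Sum>j<T (Suc ?k). f (Suc ?k) j) * (\<Prod>l=Suc (Suc ?k)..i. \<Sum>j<T l. f l j)"
      using Suc.prems by (subst prod.atLeast_Suc_atMost) auto
    ultimately show ?thesis
      unfolding oracle_calls_Suc using False
      by (simp add: sum_distrib_left sum_distrib_right mult.assoc)
  qed
qed simp

definition nodes :: "nat list list" where "nodes = oracle_calls T n []"

lemma nodes_admissible: "u \<in> set nodes \<Longrightarrow> admissible u \<and> length u \<in> {1..n}"
  using oracle_calls_admissible[of u n "[]"] by (auto simp: nodes_def admissible_def Suc_le_eq)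

lemma admissible_nodes: "admissible u \<Longrightarrow> u \<noteq> [] \<Longrightarrow> u \<in> set nodes"
  using admissible_oracle_calls[of "[]" u n] by (simp add: nodes_def)

lemma nodes_level_sum:
  assumes "i \<in> {1..n}"
  shows "(\<Sum>m<length nodes. if length (nodes ! m) = i then index_prod f (nodes ! m) else 0)
    = (\<Prod>l=1..i. \<Sum>j<T l. f l j)"
proof -
  have conv: "(\<Sum>m<length us. if length (us ! m) = i then index_prod f (us ! m) else 0)
      = sum_list (map (\<lambda>u. if length u = i then index_prod f u else 0) us)" for us
    by (simp add: sum_list_sum_nth atLeast0LessThan)
  show ?thesis
    unfolding conv nodes_def using level_sum[of "[]" i n f] assms by simp
qed

lemma sum_W_alpha_le:
  assumes i: "i \<in> {1..n}"
  shows "(\<Sum>m<length nodes. if length (nodes ! m) = i then W (nodes ! m) / alpha_prod (nodes ! m) else 0)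
    \<le> (\<Prod>l=1..i. real (T l))"
proof -
  have "W u / alpha_prod u = index_prod (\<lambda>l j. (alpha (T l - 1))\<^sup>2 / alpha j / alpha j) u" for u
    unfolding W_def index_prod_def by (simp only: prod_dividef[symmetric])
  then have "(\<Sum>m<length nodes. if length (nodes ! m) = i then W (nodes ! m) / alpha_prod (nodes ! m) else 0)
      = (\<Prod>l=1..i. \<Sum>j<T l. (alpha (T l - 1))\<^sup>2 / alpha j / alpha j)"
    by (simp only: nodes_level_sum[OF i])
  also have "\<dots> \<le> (\<Prod>l=1..i. real (T l))"
    by (intro prod_mono conjI sum_alpha_ratio_le sum_nonneg) (auto simp: less_imp_le)
  finally show ?thesis .
qed

lemma sum_W_square_le:
  assumes i: "i \<in> {1..n}"
  shows "(\<Sum>m<length nodes. if length (nodes ! m) = i then (W (nodes ! m))\<^sup>2 else 0)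
    \<le> 2 ^ i / (\<Prod>l=1..i. real (T l))"
proof -
  have "(W u)\<^sup>2 = index_prod (\<lambda>l j. ((alpha (T l - 1))\<^sup>2 / alpha j)\<^sup>2) u" for u
    unfolding W_def index_prod_def by (simp only: prod_power_distrib)
  then have "(\<Sum>m<length nodes. if length (nodes ! m) = i then (W (nodes ! m))\<^sup>2 else 0)
      = (\<Prod>l=1..i. \<Sum>j<T l. ((alpha (T l - 1))\<^sup>2 / alpha j)\<^sup>2)"
    by (simp only: nodes_level_sum[OF i])
  also have "\<dots> \<le> (\<Prod>l=1..i. 2 / real (T l))"
    using i T_pos by (intro prod_mono conjI sum_weight_square_le sum_nonneg) auto
  also have "\<dots> = 2 ^ i / (\<Prod>l=1..i. real (T l))"
    by (simp add: prod_dividef)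
  finally show ?thesis .
qed

lemma K_le:
  assumes i: "i \<in> {1..n}"
  shows "K i \<le> (L i + \<tau> i) * 4 ^ i / (\<Prod>l=1..i. real (T l))\<^sup>2 + M i * 2 ^ i / (\<Prod>l=1..i. real (T l))"
proof -
  have le: "alpha (T l - 1) \<le> 2 / real (T l)" if "l \<in> {1..i}" for l
  proof -
    have "T l > 0" using T_pos[of l] that i by auto
    then show ?thesis
      using order_trans[OF alpha_upper[of "T l - 1"], of "2 / real (T l)"]
      by (simp add: divide_left_mono)
  qed
  have 1: "(\<Prod>l=1..i. alpha (T l - 1)) \<le> 2 ^ i / (\<Prod>l=1..i. real (T l))"
  proof -
    have "(\<Prod>l=1..i. alpha (T l - 1)) \<le> (\<Prod>l=1..i. 2 / real (T l))"
      using le by (intro prod_mono conjI) (auto simp: less_imp_le)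
    then show ?thesis by (simp add: prod_dividef)
  qed
  have "(\<Prod>l=1..i. (alpha (T l - 1))\<^sup>2) \<le> (2 ^ i / (\<Prod>l=1..i. real (T l)))\<^sup>2"
    unfolding prod_power_distrib[symmetric] using 1 by (intro power_mono prod_nonneg) (auto simp: less_imp_le)
  also have "\<dots> = 4 ^ i / (\<Prod>l=1..i. real (T l))\<^sup>2"
    by (simp add: power_divide power2_eq_square power_mult_distrib[symmetric])
  finally have 2: "(\<Prod>l=1..i. (alpha (T l - 1))\<^sup>2) \<le> 4 ^ i / (\<Prod>l=1..i. real (T l))\<^sup>2" .
  show ?thesis
    unfolding K_def
    using mult_left_mono[OF 1 M_nonneg[OF i]] mult_left_mono[OF 2, of "L i + \<tau> i"] L_nonneg[OF i] tau_nonneg[OF i]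
    by simp
qed

section \<open>The iterates are adapted to the oracle calls\<close>

lemma point_map_measurable:
  assumes "\<And>l. l \<in> {1..length t} \<Longrightarrow> (\<lambda>\<omega>. zb \<omega> (take l t)) \<in> borel_measurable N"
    and "f \<in> borel_measurable N"
  shows "(\<lambda>\<omega>. point_map (zb \<omega>) t (f \<omega>)) \<in> borel_measurable N"
  using assms
proof (induction t arbitrary: f rule: rev_induct)
  case (snoc j t)
  have "(\<lambda>\<omega>. zb \<omega> (t @ [j])) \<in> borel_measurable N"
    using snoc.prems(1)[of "length (t @ [j])"] by simp
  then have "(\<lambda>\<omega>. alpha j *\<^sub>R f \<omega> + (1 - alpha j) *\<^sub>R zb \<omega> (t @ [j])) \<in> borel_measurable N"
    using snoc.prems(2) by measurable
  moreover have "(\<lambda>\<omega>. zb \<omega> (take l t)) \<in> borel_measurable N" if "l \<in> {1..length t}" for l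
    using snoc.prems(1)[of l] that by simp
  ultimately show ?case unfolding point_map_snoc by (rule snoc.IH[rotated])
qed simp

end

locale sliding_run = sliding_problem P Z n T Q G L \<tau> M p gradp
  for P :: "real^'d^'d" and Z n T Q and G :: "nat \<Rightarrow> real^'d \<Rightarrow> 's \<Rightarrow> real^'d" and L \<tau> M p gradp +
  fixes F :: "nat \<Rightarrow> 'w measure" and S :: "'s measure" and \<xi> :: "'w \<Rightarrow> nat list \<Rightarrow> 's"
    and z zb :: "'w \<Rightarrow> 'd table"
  assumes n_pos: "n \<ge> 1"
    and tables: "\<And>\<omega>. table_in (z \<omega>)" "\<And>\<omega>. table_in (zb \<omega>)"
    and F_mono: "\<And>m m' (f :: 'w \<Rightarrow> real^'d). m \<le> m' \<Longrightarrow> f \<in> borel_measurable (F m) \<Longrightarrow> f \<in> borel_measurable (F m')"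
    and xi_meas: "\<And>m u. u \<in> set (take m nodes) \<Longrightarrow> (\<lambda>\<omega>. \<xi> \<omega> u) \<in> measurable (F m) S"
    and G_meas: "\<And>i. i \<in> {1..n} \<Longrightarrow> (\<lambda>(v, x). G i v x) \<in> borel_measurable (restrict_space borel Z \<Otimes>\<^sub>M S)"
    and Q_cont: "\<And>i. i \<in> {1..n} \<Longrightarrow> continuous_on Z (Q i)"
begin

abbreviation "adapted \<equiv> adapted_at F z zb"

lemma adapted_mono: "m \<le> m' \<Longrightarrow> adapted m t \<Longrightarrow> adapted m' t"
  unfolding adapted_at_def using F_mono by blast

lemma adapted_take: "adapted m t \<Longrightarrow> adapted m (take i t)"
  unfolding adapted_at_def by (auto simp: min_def)

lemma adapted_snoc:
  "adapted m (t @ [j]) \<longleftrightarrow> adapted m t \<and> (\<lambda>\<omega>. z \<omega> (t @ [j])) \<in> borel_measurable (F m)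
     \<and> (\<lambda>\<omega>. zb \<omega> (t @ [j])) \<in> borel_measurable (F m)"
  unfolding adapted_at_def by (auto simp: atLeastAtMostSuc_conv)

lemma query_measurable:
  assumes "adapted m t" "t \<noteq> []"
  shows "(\<lambda>\<omega>. query_point (z \<omega>) (zb \<omega>) t) \<in> borel_measurable (F m)"
  unfolding query_point_eq
proof (rule point_map_measurable)
  have "length t \<in> {1..length t}" using assms(2) by (cases t) auto
  then show "(\<lambda>\<omega>. z \<omega> t) \<in> borel_measurable (F m)"
    using assms(1) unfolding adapted_at_def by fastforce
qed (use assms(1) in \<open>auto simp: adapted_at_def\<close>)

lemma query_in: "query_point (z \<omega>) (zb \<omega>) t \<in> Z"
  unfolding query_point_eq
  using point_map_in[OF tables, of "z \<omega> t" \<omega>] tables by (auto simp: table_in_def)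

lemma into_Z: "f \<in> borel_measurable N \<Longrightarrow> (\<And>\<omega>. f \<omega> \<in> Z) \<Longrightarrow> f \<in> measurable N (restrict_space borel Z)"
  by (rule measurable_restrict_space2) auto

lemma Q_measurable:
  assumes "i \<in> {1..n}" "f \<in> borel_measurable N" "\<And>\<omega>. f \<omega> \<in> Z"
  shows "(\<lambda>\<omega>. Q i (f \<omega>)) \<in> borel_measurable N"
  by (rule measurable_compose[OF into_Z[OF assms(2,3)]
        borel_measurable_continuous_on_restrict[OF Q_cont[OF assms(1)]]])

lemma G_measurable:
  assumes "i \<in> {1..n}" "adapted m t" "t \<noteq> []" "(\<lambda>\<omega>. \<xi> \<omega> t) \<in> measurable N S"
    and "\<And>f :: 'w \<Rightarrow> real^'d. f \<in> borel_measurable (F m) \<Longrightarrow> f \<in> borel_measurable N"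
  shows "(\<lambda>\<omega>. G i (query_point (z \<omega>) (zb \<omega>) t) (\<xi> \<omega> t)) \<in> borel_measurable N"
proof -
  have "(\<lambda>\<omega>. query_point (z \<omega>) (zb \<omega>) t) \<in> borel_measurable N"
    by (rule assms(5)[OF query_measurable[OF assms(2,3)]])
  then have "(\<lambda>\<omega>. query_point (z \<omega>) (zb \<omega>) t) \<in> measurable N (restrict_space borel Z)"
    by (rule into_Z[OF _ query_in])
  from measurable_compose[OF measurable_Pair[OF this assms(4)] G_meas[OF assms(1)]]
  show ?thesis by simp
qed

text \<open>The list \<open>pre\<close> holds the calls made before the procedure at \<open>t\<close> starts, so \<open>length pre\<close> is the
  current time. The equations of the trace then express every new iterate by measurable operations on
  older ones.\<close>

lemma adapted_run:
  assumes "nodes = pre @ oracle_calls T d t @ post" "length t + d = n" "admissible t"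
    and "\<And>l. l \<in> {1..length t} \<Longrightarrow> take l t \<in> set pre" "adapted (length pre) t"
    and "\<And>r. r \<in> {1..d} \<Longrightarrow> (\<lambda>\<omega>. z \<omega> (t @ replicate r 0)) \<in> borel_measurable (F (length pre))"
    and "\<And>\<omega>. trace (\<xi> \<omega>) d t (z \<omega>) (zb \<omega>)"
  shows "(\<forall>m\<in>{length pre..<length pre + length (oracle_calls T d t)}. adapted m (nodes ! m))
    \<and> (\<lambda>\<omega>. result (\<xi> \<omega>) d t (z \<omega>) (zb \<omega>)) \<in> borel_measurable (F (length pre + length (oracle_calls T d t)))
    \<and> (\<forall>r<d. (\<lambda>\<omega>. z \<omega> (t @ [T (Suc (length t))] @ replicate r 0))
          \<in> borel_measurable (F (length pre + length (oracle_calls T d t))))"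
  using assms
proof (induction d arbitrary: t pre post)
  case 0
  let ?m = "length pre"
  have len: "length t = n" using 0 by simp
  have ne: "take i t \<noteq> []" if "i \<in> {1..n}" for i using that len by auto
  have h_pos: "(\<Sum>i=1..n. \<eta> i (take i t)) > 0"
  proof (rule sum_pos)
    show "\<eta> i (take i t) > 0" if "i \<in> {1..n}" for i
      using eta_pos[of "take i t"] that len by (simp add: min_absorb2)
  qed (use n_pos in auto)
  have "(\<lambda>\<omega>. leaf (\<xi> \<omega>) t (z \<omega>) (zb \<omega>)) \<in> borel_measurable (F ?m)"
    unfolding leaf_eq_prox
  proof (rule prox_measurable[OF _ h_pos])
    fix i assume i: "i \<in> {1..n}"
    show zm: "(\<lambda>\<omega>. z \<omega> (take i t)) \<in> borel_measurable (F ?m)"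
      using 0(5) i len by (auto simp: adapted_at_def)
    have "take i t \<in> set (take ?m nodes)" using 0(4)[of i] i len 0(1) by simp
    then have "(\<lambda>\<omega>. \<xi> \<omega> (take i t)) \<in> measurable (F ?m) S" by (rule xi_meas)
    then have "(\<lambda>\<omega>. G i (query_point (z \<omega>) (zb \<omega>) (take i t)) (\<xi> \<omega> (take i t))) \<in> borel_measurable (F ?m)"
      using G_measurable[OF i adapted_take[OF 0(5)] ne[OF i]] by blast
    moreover have "(\<lambda>\<omega>. Q i (z \<omega> (take i t))) \<in> borel_measurable (F ?m)"
      using tables by (intro Q_measurable[OF i zm]) (auto simp: table_in_def)
    ultimately show "(\<lambda>\<omega>. G i (query_point (z \<omega>) (zb \<omega>) (take i t)) (\<xi> \<omega> (take i t)) + Q i (z \<omega> (take i t)))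
        \<in> borel_measurable (F ?m)" by (rule borel_measurable_add)
  qed simp
  then show ?case by (simp add: result_def)
next
  case (Suc d)
  note outer = Suc.prems and outer_IH = Suc.IH
  let ?k = "length t"
  let ?N = "T (Suc ?k)"
  define block where "block j = (t @ [j]) # oracle_calls T d (t @ [j])" for j
  define pos where "pos j = pre @ concat (map block [0..<j])" for j
  have calls: "oracle_calls T (Suc d) t = concat (map block [0..<?N])"
    by (simp add: block_def[abs_def])
  have pos_Suc: "pos (Suc j) = pos j @ block j" for j by (simp add: pos_def)
  have k: "Suc ?k \<in> {1..n}" using outer(2) by simp
  have in_Z: "result (\<xi> \<omega>) d u (z \<omega>) (zb \<omega>) \<in> Z" for \<omega> u
    using tables by (auto simp: result_def leaf_eq_prox table_in_def intro: prox_in)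
  have main: "(\<forall>m\<in>{length pre..<length (pos j)}. adapted m (nodes ! m))
      \<and> (\<forall>r\<le>d. (\<lambda>\<omega>. z \<omega> (t @ [j] @ replicate r 0)) \<in> borel_measurable (F (length (pos j))))
      \<and> (\<lambda>\<omega>. zb \<omega> (t @ [j])) \<in> borel_measurable (F (length (pos j)))"
    if "j \<le> ?N" for j
    using that
  proof (induction j)
    case 0
    have "(\<lambda>\<omega>. z \<omega> (t @ [0] @ replicate r 0)) \<in> borel_measurable (F (length pre))" if "r \<le> d" for r
      using outer(6)[of "Suc r"] that by simp
    moreover from this[of 0] have "(\<lambda>\<omega>. zb \<omega> (t @ [0])) \<in> borel_measurable (F (length pre))"
      using outer(7) by simp
    ultimately show ?case by (simp add: pos_def)
  next
    case (Suc j)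
    let ?\<nu> = "t @ [j]" and ?m = "length (pos j)" and ?m' = "length (pos (Suc j))"
    have j: "j < ?N" using Suc.prems by simp
    have IH: "\<And>m. m\<in>{length pre..<?m} \<Longrightarrow> adapted m (nodes ! m)"
      "\<And>r. r \<le> d \<Longrightarrow> (\<lambda>\<omega>. z \<omega> (?\<nu> @ replicate r 0)) \<in> borel_measurable (F ?m)"
      "(\<lambda>\<omega>. zb \<omega> ?\<nu>) \<in> borel_measurable (F ?m)"
      using Suc.IH j by auto
    have le: "length pre \<le> ?m" by (simp add: pos_def)
    have "adapted ?m t" by (rule adapted_mono[OF le outer(5)])
    then have ad: "adapted ?m ?\<nu>" using IH(2)[of 0] IH(3) by (simp add: adapted_snoc)
    have "[0..<?N] = [0..<j] @ j # [Suc j..<?N]"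
      using upt_add_eq_append[of 0 j "?N - j"] upt_conv_Cons[OF j] j by simp
    then have nodes_split: "nodes = (pos j @ [?\<nu>]) @ oracle_calls T d ?\<nu> @ (concat (map block [Suc j..<?N]) @ post)"
      unfolding outer(1) calls by (simp add: pos_def block_def)
    have m'_eq: "length (pos j @ [?\<nu>]) + length (oracle_calls T d ?\<nu>) = ?m'"
      by (simp add: pos_Suc block_def)
    have l: "loop_eqs (\<xi> \<omega>) d t j (z \<omega>) (zb \<omega>)" and tr: "trace (\<xi> \<omega>) d ?\<nu> (z \<omega>) (zb \<omega>)" for \<omega>
      using outer(7)[of \<omega>] j by auto
    have A: "(\<forall>m\<in>{length (pos j @ [?\<nu>])..<?m'}. adapted m (nodes ! m))
      \<and> (\<lambda>\<omega>. result (\<xi> \<omega>) d ?\<nu> (z \<omega>) (zb \<omega>)) \<in> borel_measurable (F ?m')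
      \<and> (\<forall>r<d. (\<lambda>\<omega>. z \<omega> (?\<nu> @ [T (Suc (length ?\<nu>))] @ replicate r 0)) \<in> borel_measurable (F ?m'))"
      unfolding m'_eq[symmetric]
    proof (rule outer_IH[OF nodes_split])
      show "length ?\<nu> + d = n" "admissible ?\<nu>" using outer j by (auto simp: admissible_snoc)
      show "take l ?\<nu> \<in> set (pos j @ [?\<nu>])" if "l \<in> {1..length ?\<nu>}" for l
        using outer(4)[of l] that by (cases "l = Suc ?k") (auto simp: pos_def)
      show "adapted (length (pos j @ [?\<nu>])) ?\<nu>" by (rule adapted_mono[OF _ ad]) simp
      show "(\<lambda>\<omega>. z \<omega> (?\<nu> @ replicate r 0)) \<in> borel_measurable (F (length (pos j @ [?\<nu>])))"
        if "r \<in> {1..d}" for r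
        using that by (intro F_mono[OF _ IH(2)]) auto
    qed (rule tr)
    have mm': "?m \<le> ?m'" by (simp add: pos_Suc)
    have at: "nodes ! ?m = ?\<nu>" by (simp add: nodes_split nth_append)
    have "adapted m (nodes ! m)" if "m \<in> {length pre..<?m'}" for m
    proof -
      consider "m \<in> {length pre..<?m}" | "m = ?m" | "m \<in> {length (pos j @ [?\<nu>])..<?m'}"
        using \<open>m \<in> _\<close> by fastforce
      then show ?thesis using IH(1) A at ad by cases auto
    qed
    moreover have zj: "(\<lambda>\<omega>. z \<omega> (t @ [Suc j])) \<in> borel_measurable (F ?m')"
    proof -
      have Qr: "(\<lambda>\<omega>. Q (Suc ?k) (result (\<xi> \<omega>) d ?\<nu> (z \<omega>) (zb \<omega>))) \<in> borel_measurable (F ?m')"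
        by (rule Q_measurable[OF k _ in_Z]) (use A in blast)
      have zm: "(\<lambda>\<omega>. z \<omega> ?\<nu>) \<in> borel_measurable (F ?m')"
        using F_mono[OF mm' IH(2)[of 0]] by simp
      have Qz: "(\<lambda>\<omega>. Q (Suc ?k) (z \<omega> ?\<nu>)) \<in> borel_measurable (F ?m')"
        using tables by (intro Q_measurable[OF k zm]) (auto simp: table_in_def)
      have eq: "z \<omega> (t @ [Suc j]) = arg_min_on (prox_obj {()} (\<lambda>_. \<eta> (Suc ?k) ?\<nu>)
           (\<lambda>_. Q (Suc ?k) (result (\<xi> \<omega>) d ?\<nu> (z \<omega>) (zb \<omega>)) - Q (Suc ?k) (z \<omega> ?\<nu>))
           (\<lambda>_. result (\<xi> \<omega>) d ?\<nu> (z \<omega>) (zb \<omega>))) Z" for \<omega>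
        using l[of \<omega>] unfolding loop_eqs_def Suc_eq_plus1 by blast
      have pos: "(\<Sum>u\<in>{()}. \<eta> (Suc ?k) ?\<nu>) > 0"
        using eta_pos[of ?\<nu>] k by simp
      show ?thesis unfolding eq
        by (rule prox_measurable[OF _ pos]) (use A in \<open>auto intro: borel_measurable_diff[OF Qr Qz]\<close>)
    qed
    moreover have "(\<lambda>\<omega>. z \<omega> (t @ [Suc j] @ replicate r 0)) \<in> borel_measurable (F ?m')" if "r \<le> d" for r
    proof (cases r)
      case 0
      then show ?thesis using zj by simp
    next
      case (Suc r')
      then have "r' < d" using that by simp
      then have eq: "z \<omega> (t @ [Suc j] @ replicate r 0) = z \<omega> (?\<nu> @ [T (Suc (length ?\<nu>))] @ replicate r' 0)" for \<omega>
        using l[of \<omega>] unfolding loop_eqs_def Suc by simp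
      show ?thesis unfolding eq using A \<open>r' < d\<close> by blast
    qed
    moreover have "(\<lambda>\<omega>. zb \<omega> (t @ [Suc j])) \<in> borel_measurable (F ?m')"
    proof -
      have eq: "zb \<omega> (t @ [Suc j]) = alpha j *\<^sub>R result (\<xi> \<omega>) d ?\<nu> (z \<omega>) (zb \<omega>) + (1 - alpha j) *\<^sub>R zb \<omega> ?\<nu>" for \<omega>
        using l[of \<omega>] unfolding loop_eqs_def Suc_eq_plus1 by blast
      show ?thesis unfolding eq
        using A F_mono[OF mm' IH(3)]
        by (intro borel_measurable_add borel_measurable_scaleR borel_measurable_const) auto
    qed
    ultimately show ?case by blast
  qed
  have end_pos: "length pre + length (oracle_calls T (Suc d) t) = length (pos ?N)"
    unfolding calls pos_def by simp
  have res: "result (\<xi> \<omega>) (Suc d) t (z \<omega>) (zb \<omega>) = zb \<omega> (t @ [?N])" for \<omega>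
    by (simp add: result_def)
  show ?case unfolding end_pos res using main[OF order_refl] less_Suc_eq_le by blast
qed

end

section \<open>Conditionally centred noise\<close>

text \<open>The consequence of a vanishing conditional expectation that the proof uses: orthogonality to
  every square-integrable function of the past.\<close>

definition centred_given :: "'w measure \<Rightarrow> 'w measure \<Rightarrow> ('w \<Rightarrow> real^'d) \<Rightarrow> bool" where
  "centred_given Pr F X \<longleftrightarrow> (\<forall>Y. Y \<in> borel_measurable F \<longrightarrow> integrable Pr (\<lambda>\<omega>. (norm (Y \<omega>))\<^sup>2)
     \<longrightarrow> integrable Pr (\<lambda>\<omega>. Y \<omega> \<bullet> X \<omega>) \<and> (\<integral>\<omega>. Y \<omega> \<bullet> X \<omega> \<partial>Pr) = 0)"

context spd
begin

lemma dual: "spd (matrix_inv P)"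
  by (rule spd.intro[OF dual_spd])

lemma dual_q: "(dual_mnorm P s)\<^sup>2 = spd.q (matrix_inv P) s"
  by (simp add: dual_mnorm_def spd.mnorm_sq[OF dual])

lemma dual_sq_measurable:
  "X \<in> borel_measurable N \<Longrightarrow> (\<lambda>\<omega>. (dual_mnorm P (X \<omega>))\<^sup>2) \<in> borel_measurable N"
  unfolding dual_q
  by (rule measurable_compose[OF _ borel_measurable_continuous_onI[OF spd.continuous_q[OF dual]]])

lemma dual_measurable:
  assumes "X \<in> borel_measurable N" shows "(\<lambda>\<omega>. dual_mnorm P (X \<omega>)) \<in> borel_measurable N"
proof -
  have "(\<lambda>\<omega>. sqrt ((dual_mnorm P (X \<omega>))\<^sup>2)) \<in> borel_measurable N"
    using dual_sq_measurable[OF assms] by measurable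
  then show ?thesis by simp
qed

lemma cond_second_moment:
  assumes Pr: "prob_space Pr" and sub: "subalgebra Pr F" and X: "X \<in> borel_measurable Pr"
    and var: "AE \<omega> in Pr. nn_cond_exp Pr F (\<lambda>\<omega>. ennreal ((dual_mnorm P (X \<omega>))\<^sup>2)) \<omega> \<le> ennreal (s\<^sup>2)"
  shows "integrable Pr (\<lambda>\<omega>. (dual_mnorm P (X \<omega>))\<^sup>2)" "(\<integral>\<omega>. (dual_mnorm P (X \<omega>))\<^sup>2 \<partial>Pr) \<le> s\<^sup>2"
proof -
  interpret prob_space Pr by fact
  interpret finite_measure_subalgebra Pr F by unfold_locales (rule sub)
  let ?f = "\<lambda>\<omega>. (dual_mnorm P (X \<omega>))\<^sup>2"
  have m: "?f \<in> borel_measurable Pr" by (rule dual_sq_measurable[OF X])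
  have "(\<integral>\<^sup>+\<omega>. ennreal (?f \<omega>) \<partial>Pr) = (\<integral>\<^sup>+\<omega>. 1 * nn_cond_exp Pr F (\<lambda>\<omega>. ennreal (?f \<omega>)) \<omega> \<partial>Pr)"
    using m by (subst nn_cond_exp_intg) auto
  also have "\<dots> \<le> (\<integral>\<^sup>+\<omega>. ennreal (s\<^sup>2) \<partial>Pr)"
    by (rule nn_integral_mono_AE) (use var in simp)
  also have "\<dots> = ennreal (s\<^sup>2)" by (simp add: emeasure_space_1)
  finally have le: "(\<integral>\<^sup>+\<omega>. ennreal (?f \<omega>) \<partial>Pr) \<le> ennreal (s\<^sup>2)" .
  then have "(\<integral>\<^sup>+\<omega>. ennreal (?f \<omega>) \<partial>Pr) < \<infinity>"
    using ennreal_less_top order_le_less_trans by (metis infinity_ennreal_def)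
  then show int: "integrable Pr ?f"
    using m by (intro integrableI_bounded) auto
  from le show "(\<integral>\<omega>. ?f \<omega> \<partial>Pr) \<le> s\<^sup>2"
    by (subst (asm) nn_integral_eq_integral[OF int]) auto
qed

lemma norm_sq_integrable:
  assumes "X \<in> borel_measurable Pr" "integrable Pr (\<lambda>\<omega>. (dual_mnorm P (X \<omega>))\<^sup>2)"
  shows "integrable Pr (\<lambda>\<omega>. (norm (X \<omega>))\<^sup>2)"
proof -
  obtain C where C: "C > 0" "\<And>v. norm v \<le> C * dual_mnorm P v" using norm_le_dual_mnorm by blast
  show ?thesis
  proof (rule Bochner_Integration.integrable_bound)
    show "integrable Pr (\<lambda>\<omega>. C\<^sup>2 * (dual_mnorm P (X \<omega>))\<^sup>2)" using assms(2) by simp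
    have "(norm (X \<omega>))\<^sup>2 \<le> (C * dual_mnorm P (X \<omega>))\<^sup>2" for \<omega>
      using C by (intro power_mono) auto
    then show "AE \<omega> in Pr. norm ((norm (X \<omega>))\<^sup>2) \<le> norm (C\<^sup>2 * (dual_mnorm P (X \<omega>))\<^sup>2)"
      by (intro always_eventually allI) (simp add: power_mult_distrib)
  qed (use assms(1) in measurable)
qed

lemma cond_centred:
  assumes Pr: "prob_space Pr" and sub: "subalgebra Pr F" and X: "X \<in> borel_measurable Pr"
    and mean: "AE \<omega> in Pr. vec_cond_exp Pr F X \<omega> = 0"
    and int: "integrable Pr (\<lambda>\<omega>. (dual_mnorm P (X \<omega>))\<^sup>2)"
  shows "centred_given Pr F X"
  unfolding centred_given_def
proof (intro allI impI)
  fix Y :: "'a \<Rightarrow> real^'d"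
  assume Y: "Y \<in> borel_measurable F" and Y2: "integrable Pr (\<lambda>\<omega>. (norm (Y \<omega>))\<^sup>2)"
  interpret prob_space Pr by fact
  interpret finite_measure_subalgebra Pr F by unfold_locales (rule sub)
  have YM: "Y \<in> borel_measurable Pr" by (rule measurable_from_subalg[OF sub Y])
  have X2: "integrable Pr (\<lambda>\<omega>. (norm (X \<omega>))\<^sup>2)" by (rule norm_sq_integrable[OF X int])
  have nth: "(\<lambda>x :: real^'d. x $ c) \<in> borel_measurable borel" for c
    by (intro borel_measurable_continuous_onI continuous_intros)
  have meas: "(\<lambda>\<omega>. Y \<omega> $ c) \<in> borel_measurable F" "(\<lambda>\<omega>. Y \<omega> $ c) \<in> borel_measurable Pr"
    "(\<lambda>\<omega>. X \<omega> $ c) \<in> borel_measurable Pr" for c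
    by (rule measurable_compose[OF Y nth], rule measurable_compose[OF YM nth], rule measurable_compose[OF X nth])
  have int_c: "integrable Pr (\<lambda>\<omega>. Y \<omega> $ c * X \<omega> $ c)" for c
  proof (rule Bochner_Integration.integrable_bound)
    show "integrable Pr (\<lambda>\<omega>. (norm (Y \<omega>))\<^sup>2 + (norm (X \<omega>))\<^sup>2)" using X2 Y2 by simp
    show "(\<lambda>\<omega>. Y \<omega> $ c * X \<omega> $ c) \<in> borel_measurable Pr" using meas by measurable
    have "\<bar>Y \<omega> $ c * X \<omega> $ c\<bar> \<le> (norm (Y \<omega>))\<^sup>2 + (norm (X \<omega>))\<^sup>2" for \<omega>
    proof -
      have "\<bar>Y \<omega> $ c * X \<omega> $ c\<bar> \<le> norm (Y \<omega>) * norm (X \<omega>)"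
        unfolding abs_mult by (intro mult_mono component_le_norm_cart) auto
      also have "\<dots> \<le> 2 * norm (Y \<omega>) * norm (X \<omega>)" by simp
      also have "\<dots> \<le> (norm (Y \<omega>))\<^sup>2 + (norm (X \<omega>))\<^sup>2" by (rule sum_squares_bound)
      finally show ?thesis .
    qed
    then show "AE \<omega> in Pr. norm (Y \<omega> $ c * X \<omega> $ c) \<le> norm ((norm (Y \<omega>))\<^sup>2 + (norm (X \<omega>))\<^sup>2)"
      by (intro always_eventually allI) (simp add: abs_of_nonneg)
  qed
  have zero_c: "(\<integral>\<omega>. Y \<omega> $ c * X \<omega> $ c \<partial>Pr) = 0" for c
  proof -
    have AE0: "AE \<omega> in Pr. real_cond_exp Pr F (\<lambda>\<omega>. X \<omega> $ c) \<omega> = 0"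
      using mean by eventually_elim (simp add: vec_cond_exp_def vec_eq_iff)
    have "(\<integral>\<omega>. Y \<omega> $ c * X \<omega> $ c \<partial>Pr) = (\<integral>\<omega>. Y \<omega> $ c * real_cond_exp Pr F (\<lambda>\<omega>. X \<omega> $ c) \<omega> \<partial>Pr)"
      by (rule real_cond_exp_intg(2)[OF int_c meas(1,3), symmetric])
    also have "\<dots> = 0"
      by (rule integral_eq_zero_AE) (use AE0 in eventually_elim, simp)
    finally show ?thesis .
  qed
  show "integrable Pr (\<lambda>\<omega>. Y \<omega> \<bullet> X \<omega>) \<and> (\<integral>\<omega>. Y \<omega> \<bullet> X \<omega> \<partial>Pr) = 0"
    using int_c zero_c by (simp add: inner_vec_def Bochner_Integration.integral_sum)
qed

text \<open>The dual norm is Euclidean for the inverse matrix, and the cross term of the partial sum with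
  the next increment is tested against the past, hence vanishes in the mean.\<close>

lemma martingale_second_moment:
  fixes X :: "nat \<Rightarrow> 'w \<Rightarrow> real^'d" and c s :: "nat \<Rightarrow> real"
  assumes X: "\<And>m. m < N \<Longrightarrow> X m \<in> borel_measurable Pr"
    and sub: "\<And>m. m < N \<Longrightarrow> subalgebra Pr (F m)"
    and past: "\<And>l m. l < m \<Longrightarrow> m < N \<Longrightarrow> X l \<in> borel_measurable (F m)"
    and centred: "\<And>m. m < N \<Longrightarrow> centred_given Pr (F m) (X m)"
    and int: "\<And>m. m < N \<Longrightarrow> integrable Pr (\<lambda>\<omega>. (dual_mnorm P (X m \<omega>))\<^sup>2)"
    and bound: "\<And>m. m < N \<Longrightarrow> (\<integral>\<omega>. (dual_mnorm P (X m \<omega>))\<^sup>2 \<partial>Pr) \<le> s m"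
  shows "k \<le> N \<Longrightarrow> integrable Pr (\<lambda>\<omega>. (dual_mnorm P (\<Sum>m<k. c m *\<^sub>R X m \<omega>))\<^sup>2)
    \<and> (\<integral>\<omega>. (dual_mnorm P (\<Sum>m<k. c m *\<^sub>R X m \<omega>))\<^sup>2 \<partial>Pr) \<le> (\<Sum>m<k. (c m)\<^sup>2 * s m)"
proof (induction k)
  case 0
  then show ?case by (simp add: dual_q spd.q_def[OF dual])
next
  case (Suc k)
  let ?S = "\<lambda>\<omega>. \<Sum>m<k. c m *\<^sub>R X m \<omega>"
  let ?Y = "\<lambda>\<omega>. (2 * c k) *\<^sub>R (matrix_inv P *v ?S \<omega>)"
  have k: "k < N" using Suc.prems by simp
  have IH: "integrable Pr (\<lambda>\<omega>. (dual_mnorm P (?S \<omega>))\<^sup>2)"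
    "(\<integral>\<omega>. (dual_mnorm P (?S \<omega>))\<^sup>2 \<partial>Pr) \<le> (\<Sum>m<k. (c m)\<^sup>2 * s m)"
    using Suc.IH k by auto
  have SF: "?S \<in> borel_measurable (F k)"
    using past[OF _ k] by (intro borel_measurable_sum borel_measurable_scaleR borel_measurable_const) auto
  have SP: "?S \<in> borel_measurable Pr" by (rule measurable_from_subalg[OF sub[OF k] SF])
  have lin: "(\<lambda>x. matrix_inv P *v x) \<in> borel_measurable borel"
    by (intro borel_measurable_continuous_onI linear_continuous_on matrix_vector_mul_bounded_linear)
  have YF: "?Y \<in> borel_measurable (F k)"
    by (rule borel_measurable_scaleR[OF borel_measurable_const measurable_compose[OF SF lin]])
  have YP: "?Y \<in> borel_measurable Pr" by (rule measurable_from_subalg[OF sub[OF k] YF])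
  obtain B where B: "B > 0" "\<And>v. norm (matrix_inv P *v v) \<le> norm v * B"
    using bounded_linear.pos_bounded[OF matrix_vector_mul_bounded_linear[of "matrix_inv P"]] by blast
  have Y2: "integrable Pr (\<lambda>\<omega>. (norm (?Y \<omega>))\<^sup>2)"
  proof (rule Bochner_Integration.integrable_bound)
    show "integrable Pr (\<lambda>\<omega>. (2 * \<bar>c k\<bar> * B)\<^sup>2 * (norm (?S \<omega>))\<^sup>2)"
      using norm_sq_integrable[OF SP IH(1)] by simp
    show "(\<lambda>\<omega>. (norm (?Y \<omega>))\<^sup>2) \<in> borel_measurable Pr" using YP by measurable
    have "(norm (?Y \<omega>))\<^sup>2 \<le> (2 * \<bar>c k\<bar> * B)\<^sup>2 * (norm (?S \<omega>))\<^sup>2" for \<omega>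
    proof -
      have "norm (?Y \<omega>) = 2 * \<bar>c k\<bar> * norm (matrix_inv P *v ?S \<omega>)" by (simp add: abs_mult)
      also have "\<dots> \<le> 2 * \<bar>c k\<bar> * (norm (?S \<omega>) * B)" by (intro mult_left_mono B) auto
      also have "\<dots> = (2 * \<bar>c k\<bar> * B) * norm (?S \<omega>)" by simp
      finally have "(norm (?Y \<omega>))\<^sup>2 \<le> ((2 * \<bar>c k\<bar> * B) * norm (?S \<omega>))\<^sup>2" by (rule power_mono) simp
      then show ?thesis by (simp only: power_mult_distrib)
    qed
    then show "AE \<omega> in Pr. norm ((norm (?Y \<omega>))\<^sup>2) \<le> norm ((2 * \<bar>c k\<bar> * B)\<^sup>2 * (norm (?S \<omega>))\<^sup>2)"
      by (intro always_eventually allI) (simp only: real_norm_def abs_mult abs_power2)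
  qed
  have cross: "integrable Pr (\<lambda>\<omega>. ?Y \<omega> \<bullet> X k \<omega>)" "(\<integral>\<omega>. ?Y \<omega> \<bullet> X k \<omega> \<partial>Pr) = 0"
    using centred[OF k, unfolded centred_given_def, rule_format, OF YF Y2] by auto
  have expand: "(dual_mnorm P (\<Sum>m<Suc k. c m *\<^sub>R X m \<omega>))\<^sup>2
      = (dual_mnorm P (?S \<omega>))\<^sup>2 + ?Y \<omega> \<bullet> X k \<omega> + (c k)\<^sup>2 * (dual_mnorm P (X k \<omega>))\<^sup>2" for \<omega>
    unfolding dual_q sum.lessThan_Suc spd.q_add[OF dual] spd.q_scale[OF dual] by simp
  have "(\<integral>\<omega>. (dual_mnorm P (\<Sum>m<Suc k. c m *\<^sub>R X m \<omega>))\<^sup>2 \<partial>Pr)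
      = (\<integral>\<omega>. (dual_mnorm P (?S \<omega>))\<^sup>2 \<partial>Pr) + (c k)\<^sup>2 * (\<integral>\<omega>. (dual_mnorm P (X k \<omega>))\<^sup>2 \<partial>Pr)"
    unfolding expand
      Bochner_Integration.integral_add[OF Bochner_Integration.integrable_add[OF IH(1) cross(1)] integrable_mult_right[OF int[OF k]]]
      Bochner_Integration.integral_add[OF IH(1) cross(1)] cross(2)
    by simp
  also have "\<dots> \<le> (\<Sum>m<k. (c m)\<^sup>2 * s m) + (c k)\<^sup>2 * s k"
    by (intro add_mono IH mult_left_mono bound k) simp
  finally have "(\<integral>\<omega>. (dual_mnorm P (\<Sum>m<Suc k. c m *\<^sub>R X m \<omega>))\<^sup>2 \<partial>Pr) \<le> (\<Sum>m<Suc k. (c m)\<^sup>2 * s m)"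
    by simp
  moreover have "integrable Pr (\<lambda>\<omega>. (dual_mnorm P (\<Sum>m<Suc k. c m *\<^sub>R X m \<omega>))\<^sup>2)"
    unfolding expand using IH(1) cross(1) int[OF k] by (intro Bochner_Integration.integrable_add) auto
  ultimately show ?case by blast
qed

end

lemma (in prob_space) first_moment_le_sqrt:
  fixes f :: "'a \<Rightarrow> real"
  assumes "f \<in> borel_measurable M" "integrable M (\<lambda>x. (f x)\<^sup>2)" "(\<integral>x. (f x)\<^sup>2 \<partial>M) \<le> b"
  shows "integrable M f" "(\<integral>x. f x \<partial>M) \<le> sqrt b"
proof -
  show i: "integrable M f"
  proof (rule Bochner_Integration.integrable_bound)
    show "integrable M (\<lambda>x. 1 + (f x)\<^sup>2)" using assms(2) by simp
    have "\<bar>y\<bar> \<le> 1 + y\<^sup>2" for y :: real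
      using sum_squares_bound[of 1 "\<bar>y\<bar>"] by simp
    then show "AE x in M. norm (f x) \<le> norm (1 + (f x)\<^sup>2)"
      by (intro always_eventually allI) (simp add: abs_of_nonneg add_nonneg_nonneg)
  qed fact
  have "0 \<le> variance f" by (rule variance_positive)
  also have "\<dots> = (\<integral>x. (f x)\<^sup>2 \<partial>M) - (\<integral>x. f x \<partial>M)\<^sup>2" by (rule variance_eq[OF i assms(2)])
  finally have "(\<integral>x. f x \<partial>M)\<^sup>2 \<le> b" using assms(3) by simp
  then show "(\<integral>x. f x \<partial>M) \<le> sqrt b" by (rule real_le_rsqrt)
qed

section \<open>The history\<close>

context
  fixes Pr :: "'w measure" and S :: "'s measure" and zin :: "'w \<Rightarrow> real^'d"
    and \<xi> :: "nat list \<Rightarrow> 'w \<Rightarrow> 's" and us :: "nat list list"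
  assumes zin: "zin \<in> borel_measurable Pr"
    and samples: "\<And>u. u \<in> set us \<Longrightarrow> \<xi> u \<in> measurable Pr S"
begin

abbreviation "gens m \<equiv> {zin -` B \<inter> space Pr | B. B \<in> sets borel}
  \<union> (\<Union>u\<in>set (take m us). {\<xi> u -` A \<inter> space Pr | A. A \<in> sets S})"

lemma gens_Pow: "gens m \<subseteq> Pow (space Pr)" by blast

lemma space_history: "space (history Pr S zin \<xi> us m) = space Pr"
  unfolding history_def by (rule space_measure_of[OF gens_Pow])

lemma sets_history: "sets (history Pr S zin \<xi> us m) = sigma_sets (space Pr) (gens m)"
  unfolding history_def by (rule sets_measure_of[OF gens_Pow])

lemma history_subalgebra: "subalgebra Pr (history Pr S zin \<xi> us m)"
proof -
  have "gens m \<subseteq> sets Pr"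
    using measurable_sets[OF zin] measurable_sets[OF samples] set_take_subset[of m us] by blast
  then show ?thesis
    unfolding subalgebra_def space_history sets_history
    using sets.sigma_sets_subset by blast
qed

lemma history_zin: "zin \<in> borel_measurable (history Pr S zin \<xi> us m)"
proof (rule measurableI)
  show "A \<in> sets borel \<Longrightarrow> zin -` A \<inter> space (history Pr S zin \<xi> us m) \<in> sets (history Pr S zin \<xi> us m)" for A
    unfolding space_history sets_history by (rule sigma_sets.Basic, rule UnI1) auto
qed simp

lemma history_sample:
  assumes "u \<in> set (take m us)" shows "\<xi> u \<in> measurable (history Pr S zin \<xi> us m) S"
proof (rule measurableI)
  have u: "u \<in> set us" using assms by (rule in_set_takeD)
  show "x \<in> space (history Pr S zin \<xi> us m) \<Longrightarrow> \<xi> u x \<in> space S" for x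
    using measurable_space[OF samples[OF u]] by (simp add: space_history)
  show "A \<in> sets S \<Longrightarrow> \<xi> u -` A \<inter> space (history Pr S zin \<xi> us m) \<in> sets (history Pr S zin \<xi> us m)" for A
    unfolding space_history sets_history
    by (rule sigma_sets.Basic, rule UnI2, rule UN_I[OF assms], rule CollectI, rule exI[of _ A]) simp
qed

lemma history_mono:
  assumes "m \<le> m'" "f \<in> borel_measurable (history Pr S zin \<xi> us m)"
  shows "f \<in> borel_measurable (history Pr S zin \<xi> us m')"
proof -
  have "gens m \<subseteq> gens m'" using set_take_subset_set_take[OF assms(1), of us] by blast
  then have "sigma_sets (space Pr) (gens m) \<subseteq> sigma_sets (space Pr) (gens m')" by (rule sigma_sets_mono')
  then have "subalgebra (history Pr S zin \<xi> us m') (history Pr S zin \<xi> us m)"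
    by (simp add: subalgebra_def space_history sets_history)
  then show ?thesis using assms(2) by (rule measurable_from_subalg)
qed

end

section \<open>The gap function\<close>

context prox
begin

lemma compact_Z: "compact Z"
  using Z_closed Z_bdd compact_eq_bounded_closed by blast

lemma mlipschitz_continuous:
  assumes "mlipschitz_on P C Z f" shows "continuous_on Z f"
proof -
  obtain A where A: "A > 0" "\<And>v. norm v \<le> A * dual_mnorm P v" using norm_le_dual_mnorm by blast
  obtain B where B: "B > 0" "\<And>v. norm (P *v v) \<le> norm v * B"
    using bounded_linear.pos_bounded[OF matrix_vector_mul_bounded_linear[of P]] by blast
  have mn: "mnorm P v \<le> sqrt B * norm v" for v
  proof (rule power2_le_imp_le)
    have "q v \<le> norm (P *v v) * norm v" unfolding q_def by (rule norm_cauchy_schwarz)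
    also have "\<dots> \<le> (norm v * B) * norm v" by (intro mult_right_mono B) simp
    also have "\<dots> = (sqrt B * norm v)\<^sup>2"
      using B(1) by (simp add: power_mult_distrib) (simp add: power2_eq_square)
    finally show "(mnorm P v)\<^sup>2 \<le> (sqrt B * norm v)\<^sup>2" by simp
  qed (use B(1) in simp)
  have "norm (f u - f v) \<le> (A * \<bar>C\<bar> * sqrt B) * norm (u - v)" if "u \<in> Z" "v \<in> Z" for u v
  proof -
    have "norm (f u - f v) \<le> A * dual_mnorm P (f u - f v)" by (rule A)
    also have "\<dots> \<le> A * (C * mnorm P (u - v))"
      using assms that A(1) by (intro mult_left_mono) (auto simp: mlipschitz_on_def)
    also have "\<dots> \<le> A * (\<bar>C\<bar> * (sqrt B * norm (u - v)))"
      using A(1) by (intro mult_left_mono mult_mono mn) auto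
    finally show ?thesis by (simp add: mult.assoc)
  qed
  then have "(A * \<bar>C\<bar> * sqrt B)-lipschitz_on Z f"
    using A(1) B(1) by (intro lipschitz_onI) (auto simp: dist_norm)
  then show ?thesis by (rule lipschitz_on_continuous_on)
qed

text \<open>Apart from the term \<open>f x\<close> the gap is a supremum of affine functions whose slopes \<open>R v\<close> are
  bounded on the compact set \<open>Z\<close>, hence Lipschitz. Measurability and boundedness of the gap along the
  run follow.\<close>

lemma gap_continuous:
  fixes f :: "real^'d \<Rightarrow> real" and R :: "real^'d \<Rightarrow> real^'d"
  assumes f: "continuous_on Z f" and R: "continuous_on Z R"
  shows "continuous_on Z (\<lambda>x. SUP v\<in>Z. f x - f v + R v \<bullet> (x - v))"
proof -
  let ?g = "\<lambda>x v. f x - f v + R v \<bullet> (x - v)" and ?h = "\<lambda>x v. R v \<bullet> x - (f v + R v \<bullet> v)"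
  have bdd: "bdd_above (g ` Z)" if "continuous_on Z g" for g :: "real^'d \<Rightarrow> real"
    by (intro bounded_imp_bdd_above compact_imp_bounded compact_continuous_image that compact_Z)
  have bg: "bdd_above (?g x ` Z)" for x
    by (intro bdd continuous_intros f R)
  have bh: "bdd_above (?h x ` Z)" for x
    by (intro bdd continuous_intros f R)
  obtain C where C: "\<And>v. v \<in> Z \<Longrightarrow> norm (R v) \<le> C"
    using compact_imp_bounded[OF compact_continuous_image[OF R compact_Z]] by (auto simp: bounded_iff)
  then have C0: "C \<ge> 0" using Z_ne norm_ge_zero order_trans by blast
  have half: "(SUP v\<in>Z. ?h x v) - (SUP v\<in>Z. ?h y v) \<le> C * norm (x - y)" for x y
  proof -
    have "(SUP v\<in>Z. ?h x v) \<le> (SUP v\<in>Z. ?h y v) + C * norm (x - y)"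
    proof (rule cSUP_least[OF Z_ne])
      fix v assume v: "v \<in> Z"
      have "R v \<bullet> (x - y) \<le> C * norm (x - y)"
        using norm_cauchy_schwarz[of "R v" "x - y"] mult_right_mono[OF C[OF v], of "norm (x - y)"] by simp
      moreover have "?h y v \<le> (SUP v\<in>Z. ?h y v)" by (rule cSUP_upper[OF v bh])
      ultimately show "?h x v \<le> (SUP v\<in>Z. ?h y v) + C * norm (x - y)"
        by (simp add: inner_diff_right)
    qed
    then show ?thesis by simp
  qed
  have "C-lipschitz_on Z (\<lambda>x. SUP v\<in>Z. ?h x v)"
  proof (rule lipschitz_onI[OF _ C0])
    fix x y
    show "dist (SUP v\<in>Z. ?h x v) (SUP v\<in>Z. ?h y v) \<le> C * dist x y"
      using half[of x y] half[of y x] by (simp add: dist_norm norm_minus_commute abs_le_iff)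
  qed
  then have "continuous_on Z (\<lambda>x. f x + (SUP v\<in>Z. ?h x v))"
    by (intro continuous_on_add f lipschitz_on_continuous_on)
  moreover have "(SUP v\<in>Z. ?g x v) = f x + (SUP v\<in>Z. ?h x v)" for x
  proof (rule antisym)
    have gh: "?g x v = f x + ?h x v" for v by (simp add: inner_diff_right)
    show "(SUP v\<in>Z. ?g x v) \<le> f x + (SUP v\<in>Z. ?h x v)"
      unfolding gh by (rule cSUP_least[OF Z_ne]) (use cSUP_upper[OF _ bh] in simp)
    have "(SUP v\<in>Z. ?h x v) \<le> (SUP v\<in>Z. ?g x v) - f x"
    proof (rule cSUP_least[OF Z_ne])
      fix v assume "v \<in> Z"
      from cSUP_upper[OF this bg, of x] show "?h x v \<le> (SUP v\<in>Z. ?g x v) - f x" using gh[of v] by linarith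
    qed
    then show "f x + (SUP v\<in>Z. ?h x v) \<le> (SUP v\<in>Z. ?g x v)" by simp
  qed
  ultimately show "continuous_on Z (\<lambda>x. SUP v\<in>Z. ?g x v)" by simp
qed

end

section \<open>From paths to expectations\<close>

context sliding_problem
begin

definition level_weight :: "nat \<Rightarrow> nat \<Rightarrow> real" where
  "level_weight i m = (if length (nodes ! m) = i then W (nodes ! m) else 0)"

lemma p_continuous: "i \<in> {1..n} \<Longrightarrow> continuous_on Z (p i)"
  unfolding continuous_on_eq_continuous_within
  by (intro ballI has_derivative_continuous[OF p_deriv])

lemma sum_over_levels:
  fixes h :: "nat \<Rightarrow> 'b::comm_monoid_add"
  shows "(\<Sum>m<length nodes. h m) = (\<Sum>i=1..n. \<Sum>m<length nodes. if length (nodes ! m) = i then h m else 0)"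
proof -
  have "h m = (\<Sum>i=1..n. if length (nodes ! m) = i then h m else 0)" if "m < length nodes" for m
    using nodes_admissible[OF nth_mem[OF that]] by simp
  then have "(\<Sum>m<length nodes. h m) = (\<Sum>m<length nodes. \<Sum>i=1..n. if length (nodes ! m) = i then h m else 0)"
    by (intro sum.cong) auto
  then show ?thesis by (simp only: sum.swap[of _ "{1..n}"])
qed

text \<open>The bound does not involve the comparison point \<open>v\<close>: the martingale part is grouped by
  levels and estimated by the dual norm before the supremum is taken. Grouping first gives one square
  root for each level. The condition on the errors concerns levels with \<open>\<tau> = 0\<close>, where Young's
  inequality is not available.\<close>

lemma pathwise_bound:
  assumes tin: "table_in z" "table_in zb" and tr: "trace \<xi> n [] z zb"
    and z0: "\<And>i. z (replicate i 0) = z0" and v: "v \<in> Z"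
    and err0: "\<And>u. u \<in> set nodes \<Longrightarrow> \<tau> (length u) = 0 \<Longrightarrow> err \<xi> z zb u = 0"
    and Om: "q (v - z0) \<le> \<Omega>"
  defines "x \<equiv> result \<xi> n [] z zb" and "e \<equiv> \<lambda>m. err \<xi> z zb (nodes ! m)"
  shows "(\<Sum>i=1..n. p i x) - (\<Sum>i=1..n. p i v) + (\<Sum>i=1..n. Q i v) \<bullet> (x - v)
    \<le> (\<Sum>i=1..n. K i / 2) * \<Omega>
      + (\<Sum>m<length nodes. W (nodes ! m) / alpha_prod (nodes ! m) / (2 * \<tau> (length (nodes ! m))) * (dual_mnorm P (e m))\<^sup>2)
      + sqrt \<Omega> * (\<Sum>i=1..n. dual_mnorm P (\<Sum>m<length nodes. level_weight i m *\<^sub>R e m))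
      + (\<Sum>m<length nodes. (W (nodes ! m) *\<^sub>R (z0 - z (nodes ! m))) \<bullet> e m)"
proof -
  let ?N = "length nodes"
  let ?D = "\<lambda>m. W (nodes ! m) / alpha_prod (nodes ! m) / (2 * \<tau> (length (nodes ! m))) * (dual_mnorm P (e m))\<^sup>2"
  let ?S = "\<lambda>i. \<Sum>m<?N. level_weight i m *\<^sub>R e m"
  have "sum_list (map (\<lambda>u. W u * noise \<xi> z zb v u) (oracle_calls T n []))
      = (\<Sum>m<?N. W (nodes ! m) * noise \<xi> z zb v (nodes ! m))"
    by (simp add: nodes_def sum_list_sum_nth atLeast0LessThan)
  also have "\<dots> = (\<Sum>m<?N. ?D m + (W (nodes ! m) *\<^sub>R e m) \<bullet> (v - z0) + (W (nodes ! m) *\<^sub>R (z0 - z (nodes ! m))) \<bullet> e m)"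
  proof (rule sum.cong[OF refl])
    fix m
    have split: "e m \<bullet> (z (nodes ! m) - v) = - (e m \<bullet> (v - z0)) - (z0 - z (nodes ! m)) \<bullet> e m"
      by (simp add: inner_diff_right inner_diff_left inner_commute)
    show "W (nodes ! m) * noise \<xi> z zb v (nodes ! m)
        = ?D m + (W (nodes ! m) *\<^sub>R e m) \<bullet> (v - z0) + (W (nodes ! m) *\<^sub>R (z0 - z (nodes ! m))) \<bullet> e m"
      unfolding noise_def[OF tin] split[unfolded e_def] e_def
      by (simp add: right_diff_distrib distrib_left mult_ac)
  qed
  also have "\<dots> = (\<Sum>m<?N. ?D m) + (\<Sum>m<?N. W (nodes ! m) *\<^sub>R e m) \<bullet> (v - z0)
      + (\<Sum>m<?N. (W (nodes ! m) *\<^sub>R (z0 - z (nodes ! m))) \<bullet> e m)"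
    by (simp add: sum.distrib inner_sum_left)
  finally have noise: "sum_list (map (\<lambda>u. W u * noise \<xi> z zb v u) (oracle_calls T n [])) = \<dots>" .
  have "(\<Sum>m<?N. W (nodes ! m) *\<^sub>R e m) = (\<Sum>i=1..n. ?S i)"
    by (subst sum_over_levels) (auto intro!: sum.cong simp: level_weight_def)
  then have "(\<Sum>m<?N. W (nodes ! m) *\<^sub>R e m) \<bullet> (v - z0) = (\<Sum>i=1..n. ?S i \<bullet> (v - z0))"
    by (simp add: inner_sum_left)
  also have "\<dots> \<le> (\<Sum>i=1..n. sqrt \<Omega> * dual_mnorm P (?S i))"
  proof (rule sum_mono)
    fix i
    have "mnorm P (v - z0) \<le> sqrt \<Omega>" using Om by (intro real_le_rsqrt) simp
    then have "dual_mnorm P (?S i) * mnorm P (v - z0) \<le> dual_mnorm P (?S i) * sqrt \<Omega>"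
      by (intro mult_left_mono) auto
    then show "?S i \<bullet> (v - z0) \<le> sqrt \<Omega> * dual_mnorm P (?S i)"
      using dual_cauchy_schwarz[of "?S i" "v - z0"] by (simp add: mult.commute)
  qed
  finally have mart: "(\<Sum>m<?N. W (nodes ! m) *\<^sub>R e m) \<bullet> (v - z0) \<le> sqrt \<Omega> * (\<Sum>i=1..n. dual_mnorm P (?S i))"
    by (simp add: sum_distrib_left)
  have "(\<Sum>i=1..n. K i / 2) * q (v - z0) \<le> (\<Sum>i=1..n. K i / 2) * \<Omega>"
    using K_nonneg by (intro mult_left_mono Om sum_nonneg) auto
  moreover have "(\<Sum>i=1..n. p i x) - (\<Sum>i=1..n. p i v) + (\<Sum>i=1..n. Q i v) \<bullet> (x - v)
    \<le> (\<Sum>i=1..n. K i / 2) * q (v - z0) + sum_list (map (\<lambda>u. W u * noise \<xi> z zb v u) (oracle_calls T n []))"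
    unfolding x_def
    by (rule energy_total[OF tin tr z0 v]) (use err0 admissible_nodes in blast)
  ultimately show ?thesis using mart unfolding noise by linarith
qed

lemma K_sum_le:
  assumes "\<Omega> \<ge> 0"
  shows "(\<Sum>i=1..n. K i / 2) * \<Omega>
    \<le> (\<Sum>i=1..n. 2 ^ (2 * i - 1) * (L i + \<tau> i) * \<Omega> / (real (\<Prod>j=1..i. T j))\<^sup>2)
      + (\<Sum>i=1..n. 2 ^ (i - 1) * M i * \<Omega> / real (\<Prod>j=1..i. T j))"
  unfolding sum_distrib_right sum.distrib[symmetric]
proof (rule sum_mono)
  fix i assume i: "i \<in> {1..n}"
  define A where "A = (\<Prod>l=1..i. real (T l))"
  obtain j where j: "i = Suc j" using i by (cases i) auto
  have four: "(4::real) ^ i = 2 * 2 ^ (2 * i - 1)" by (simp add: j power_mult)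
  have two: "(2::real) ^ i = 2 * 2 ^ (i - 1)" by (simp add: j)
  have "K i \<le> (L i + \<tau> i) * 4 ^ i / A\<^sup>2 + M i * 2 ^ i / A"
    using K_le[OF i] by (simp only: A_def)
  also have "\<dots> = 2 * ((L i + \<tau> i) * 2 ^ (2 * i - 1) / A\<^sup>2 + M i * 2 ^ (i - 1) / A)"
    unfolding four two by (simp add: distrib_left mult.left_commute)
  finally have "K i \<le> 2 * ((L i + \<tau> i) * 2 ^ (2 * i - 1) / A\<^sup>2 + M i * 2 ^ (i - 1) / A)" .
  then have "K i / 2 * \<Omega> \<le> ((L i + \<tau> i) * 2 ^ (2 * i - 1) / A\<^sup>2 + M i * 2 ^ (i - 1) / A) * \<Omega>"
    using assms by (intro mult_right_mono) (simp_all only: pos_divide_le_eq zero_less_numeral mult.commute)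
  also have "\<dots> = 2 ^ (2 * i - 1) * (L i + \<tau> i) * \<Omega> / A\<^sup>2 + 2 ^ (i - 1) * M i * \<Omega> / A"
    unfolding distrib_right[of _ _ \<Omega>] by (simp only: times_divide_eq_left times_divide_eq_right mult_ac)
  finally show "K i / 2 * \<Omega> \<le> 2 ^ (2 * i - 1) * (L i + \<tau> i) * \<Omega> / (real (\<Prod>j=1..i. T j))\<^sup>2
      + 2 ^ (i - 1) * M i * \<Omega> / real (\<Prod>j=1..i. T j)"
    by (simp only: A_def of_nat_prod)
qed

lemma variance_sum_le:
  assumes "\<And>m. m < length nodes \<Longrightarrow> d m \<le> (\<sigma> (length (nodes ! m)))\<^sup>2"
  shows "(\<Sum>m<length nodes. W (nodes ! m) / alpha_prod (nodes ! m) / (2 * \<tau> (length (nodes ! m))) * d m)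
    \<le> (\<Sum>i=1..n. (\<sigma> i)\<^sup>2 * real (\<Prod>j=1..i. T j) / (2 * \<tau> i))"
proof -
  have "(\<Sum>m<length nodes. W (nodes ! m) / alpha_prod (nodes ! m) / (2 * \<tau> (length (nodes ! m))) * d m)
      \<le> (\<Sum>m<length nodes. W (nodes ! m) / alpha_prod (nodes ! m)
            * ((\<sigma> (length (nodes ! m)))\<^sup>2 / (2 * \<tau> (length (nodes ! m)))))"
  proof (rule sum_mono)
    fix m assume "m \<in> {..<length nodes}"
    then have m: "m < length nodes" by simp
    have "\<tau> (length (nodes ! m)) \<ge> 0" using nodes_admissible[OF nth_mem[OF m]] tau_nonneg by blast
    then have "W (nodes ! m) / alpha_prod (nodes ! m) / (2 * \<tau> (length (nodes ! m))) * d m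
      \<le> W (nodes ! m) / alpha_prod (nodes ! m) / (2 * \<tau> (length (nodes ! m))) * (\<sigma> (length (nodes ! m)))\<^sup>2"
      by (intro mult_left_mono assms m divide_nonneg_nonneg) (auto simp: less_imp_le)
    then show "W (nodes ! m) / alpha_prod (nodes ! m) / (2 * \<tau> (length (nodes ! m))) * d m
      \<le> W (nodes ! m) / alpha_prod (nodes ! m) * ((\<sigma> (length (nodes ! m)))\<^sup>2 / (2 * \<tau> (length (nodes ! m))))"
      by simp
  qed
  also have "\<dots> = (\<Sum>i=1..n. (\<sigma> i)\<^sup>2 / (2 * \<tau> i) *
      (\<Sum>m<length nodes. if length (nodes ! m) = i then W (nodes ! m) / alpha_prod (nodes ! m) else 0))"
    unfolding sum_distrib_left by (subst sum_over_levels) (auto intro!: sum.cong)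
  also have "\<dots> \<le> (\<Sum>i=1..n. (\<sigma> i)\<^sup>2 / (2 * \<tau> i) * (\<Prod>l=1..i. real (T l)))"
    using tau_nonneg by (intro sum_mono mult_left_mono sum_W_alpha_le) auto
  finally show ?thesis by simp
qed

lemma level_weight_sum_le:
  assumes i: "i \<in> {1..n}"
  shows "sqrt (\<Sum>m<length nodes. (level_weight i m)\<^sup>2 * (\<sigma> (length (nodes ! m)))\<^sup>2)
    \<le> 2 powr (real i / 2) * \<bar>\<sigma> i\<bar> / sqrt (real (\<Prod>j=1..i. T j))"
proof -
  have "(\<Sum>m<length nodes. (level_weight i m)\<^sup>2 * (\<sigma> (length (nodes ! m)))\<^sup>2)
      = (\<sigma> i)\<^sup>2 * (\<Sum>m<length nodes. if length (nodes ! m) = i then (W (nodes ! m))\<^sup>2 else 0)"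
    unfolding sum_distrib_left by (intro sum.cong) (auto simp: level_weight_def)
  also have "\<dots> \<le> (\<sigma> i)\<^sup>2 * (2 ^ i / (\<Prod>l=1..i. real (T l)))"
    by (intro mult_left_mono sum_W_square_le i) simp
  finally have "sqrt (\<Sum>m<length nodes. (level_weight i m)\<^sup>2 * (\<sigma> (length (nodes ! m)))\<^sup>2)
      \<le> sqrt ((\<sigma> i)\<^sup>2 * (2 ^ i / (\<Prod>l=1..i. real (T l))))" by (rule real_sqrt_le_mono)
  also have "\<dots> = \<bar>\<sigma> i\<bar> * (sqrt (2 ^ i) / sqrt (\<Prod>l=1..i. real (T l)))"
    by (simp add: real_sqrt_mult real_sqrt_divide)
  also have "sqrt (2 ^ i) = 2 powr (real i / 2)"
    by (simp add: powr_half_sqrt[symmetric] powr_realpow[symmetric] powr_powr)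
  finally show ?thesis by (simp add: mult_ac)
qed

end

theorem theoremK8:
  fixes n :: nat
    and Z :: "(real^'d) set"
    and P :: "real^'d^'d"
    and p :: "nat \<Rightarrow> real^'d \<Rightarrow> real"
    and gradp :: "nat \<Rightarrow> real^'d \<Rightarrow> real^'d"
    and Q :: "nat \<Rightarrow> real^'d \<Rightarrow> real^'d"
    and G :: "nat \<Rightarrow> real^'d \<Rightarrow> 's \<Rightarrow> real^'d"
    and L M \<sigma> \<tau> :: "nat \<Rightarrow> real"
    and T A :: "nat \<Rightarrow> nat"
    and \<Omega> :: real
    and Pr :: "'w measure"
    and S :: "'s measure"
    and \<xi> :: "nat list \<Rightarrow> 'w \<Rightarrow> 's"
    and zin zout :: "'w \<Rightarrow> real^'d"
    and gap :: "'w \<Rightarrow> real"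
  assumes n: "n \<ge> 1"
    and Z: "Z \<noteq> {}" "closed Z" "convex Z" "bounded Z"
    and P: "sym_pos_def P"
    and T_pos: "\<And>i. i \<in> {1..n} \<Longrightarrow> T i > 0"
    and A_def: "\<And>i. A i = (\<Prod>j=1..i. T j)"
    and LM_nonneg: "\<And>i. i \<in> {1..n} \<Longrightarrow> L i \<ge> 0" "\<And>i. i \<in> {1..n} \<Longrightarrow> M i \<ge> 0"
    and sigma_nonneg: "\<And>i. i \<in> {1..n} \<Longrightarrow> \<sigma> i \<ge> 0"
    and tau_nonneg: "\<And>i. i \<in> {1..n} \<Longrightarrow> \<tau> i \<ge> 0"
    and tau_pos: "\<And>i. i \<in> {1..n} \<Longrightarrow> \<sigma> i > 0 \<Longrightarrow> \<tau> i > 0"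
    and LtauM_pos: "\<And>i. i \<in> {1..n} \<Longrightarrow> L i + \<tau> i + M i > 0"
    and Q: "\<And>i. i \<in> {1..n} \<Longrightarrow> continuous_on Z (Q i)"
      "\<And>i. i \<in> {1..n} \<Longrightarrow> monotone_map_on Z (Q i)"
      "\<And>i. i \<in> {1..n} \<Longrightarrow> mlipschitz_on P (M i) Z (Q i)"
    and prob_Pr: "prob_space Pr"
    and zin_rv: "zin \<in> borel_measurable Pr" "\<And>\<omega>. \<omega> \<in> space Pr \<Longrightarrow> zin \<omega> \<in> Z"
    and samples: "\<And>\<nu>. \<nu> \<in> set (oracle_calls T n []) \<Longrightarrow> \<xi> \<nu> \<in> measurable Pr S"
    and sfo: "\<And>i. i \<in> {1..n} \<Longrightarrow>
      stochastic_oracle Pr S zin \<xi> (oracle_calls T n []) Z P (p i) (gradp i) (G i) (L i) (\<sigma> i)"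
    and Omega_pos: "0 < \<Omega>"
    and Omega: "AE \<omega> in Pr. (SUP z\<in>Z. (mnorm P (zin \<omega> - z))\<^sup>2) \<le> \<Omega>"
    and zout_def: "\<And>\<omega>. zout \<omega> =
      sliding_output n T Z P Q G (eta L \<tau> M T) (\<lambda>\<nu>. \<xi> \<nu> \<omega>) (zin \<omega>)"
    and gap_def: "\<And>\<omega>. gap \<omega> =
      (SUP z\<in>Z. (\<Sum>i=1..n. p i (zout \<omega>)) - (\<Sum>i=1..n. p i z)
                 + (\<Sum>i=1..n. Q i z) \<bullet> (zout \<omega> - z))"
  shows "integrable Pr gap \<and>
    (\<integral>\<omega>. gap \<omega> \<partial>Pr) \<le>
      (\<Sum>i=1..n. 2 ^ (2 * i - 1) * (L i + \<tau> i) * \<Omega> / (real (A i))\<^sup>2)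
      + (\<Sum>i=1..n. 2 ^ (i - 1) * M i * \<Omega> / real (A i))
      + (\<Sum>i=1..n. (\<sigma> i)\<^sup>2 * real (A i) / (2 * \<tau> i))
      + sqrt \<Omega> * (\<Sum>i=1..n. 2 powr (real i / 2) * \<sigma> i / sqrt (real (A i)))"

proof -
  interpret prob_space Pr by fact
  have sfo_parts: "convex_on Z (p i)" "\<And>v. v \<in> Z \<Longrightarrow> (p i has_derivative (\<lambda>h. gradp i v \<bullet> h)) (at v within Z)"
    "mlipschitz_on P (L i) Z (gradp i)"
    "(\<lambda>(v, x). G i v x) \<in> borel_measurable (restrict_space borel Z \<Otimes>\<^sub>M S)"
    if "i \<in> {1..n}" for i
    using sfo[OF that] unfolding stochastic_oracle_def by blast+
  interpret sl: sliding_problem P Z n T Q G L \<tau> M p gradp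
    by unfold_locales (use assms(2-6) LM_nonneg tau_nonneg LtauM_pos T_pos Q sfo_parts in blast)+
  have nodes: "oracle_calls T n [] = sl.nodes" by (simp add: sl.nodes_def)
  let ?N = "length sl.nodes"
  define F where "F m = history Pr S zin \<xi> sl.nodes m" for m
  have samples': "\<And>u. u \<in> set sl.nodes \<Longrightarrow> \<xi> u \<in> measurable Pr S" using samples nodes by simp
  have sub: "subalgebra Pr (F m)" for m
    unfolding F_def by (rule history_subalgebra[OF zin_rv(1) samples'])
  have mono: "f \<in> borel_measurable (F m')" if "m \<le> m'" "f \<in> borel_measurable (F m)"
    for m m' and f :: "'w \<Rightarrow> real^'d"
    unfolding F_def by (rule history_mono[OF zin_rv(1) samples' that(1) that(2)[unfolded F_def]])
  have sampleF: "\<xi> u \<in> measurable (F m) S" if "u \<in> set (take m sl.nodes)" for u m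
    unfolding F_def by (rule history_sample[OF zin_rv(1) samples' that])
  have spaceF: "space (F m) = space Pr" for m
    using sub[of m] by (simp add: subalgebra_def)
  obtain c where c: "c \<in> Z" using Z(1) by blast
  \<comment> \<open>The input lies in \<open>Z\<close> only on the sample space; a fixed point of \<open>Z\<close> elsewhere gives a run for
    every \<open>\<omega>\<close>.\<close>
  define z0 where "z0 \<omega> = (if \<omega> \<in> space Pr then zin \<omega> else c)" for \<omega>
  have z0Z: "z0 \<omega> \<in> Z" for \<omega> using zin_rv(2) c by (simp add: z0_def)
  have z0F: "z0 \<in> borel_measurable (F m)" for m
  proof -
    have "zin \<in> borel_measurable (F m)" unfolding F_def by (rule history_zin[OF zin_rv(1) samples'])
    then show ?thesis
      by (rule measurable_cong[THEN iffD1, rotated]) (simp add: z0_def spaceF)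
  qed
  define run where "run \<omega> ab \<longleftrightarrow> sl.trace (\<lambda>u. \<xi> u \<omega>) n [] (fst ab) (snd ab)
      \<and> sl.table_in (fst ab) \<and> sl.table_in (snd ab)
      \<and> sliding_output n T Z P Q G (eta L \<tau> M T) (\<lambda>u. \<xi> u \<omega>) (z0 \<omega>) = sl.result (\<lambda>u. \<xi> u \<omega>) n [] (fst ab) (snd ab)
      \<and> (\<forall>i. fst ab (replicate i 0) = z0 \<omega>)" for \<omega> ab
  have "\<exists>ab. run \<omega> ab" for \<omega>
  proof -
    obtain a b where "sl.trace (\<lambda>u. \<xi> u \<omega>) n [] a b" "sl.table_in a" "sl.table_in b"
      "sliding_output n T Z P Q G (eta L \<tau> M T) (\<lambda>u. \<xi> u \<omega>) (z0 \<omega>) = sl.result (\<lambda>u. \<xi> u \<omega>) n [] a b"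
      "\<And>i. a (replicate i 0) = z0 \<omega>"
      by (rule sl.sliding_output_trace[OF z0Z[of \<omega>], where \<xi> = "\<lambda>u. \<xi> u \<omega>"]) blast
    then have "run \<omega> (a, b)" by (simp add: run_def)
    then show ?thesis ..
  qed
  then obtain ab where ab: "\<And>\<omega>. run \<omega> (ab \<omega>)" by metis
  define z zb where "z \<omega> = fst (ab \<omega>)" and "zb \<omega> = snd (ab \<omega>)" for \<omega>
  have tr: "sl.trace (\<lambda>u. \<xi> u \<omega>) n [] (z \<omega>) (zb \<omega>)" and tin: "sl.table_in (z \<omega>)" "sl.table_in (zb \<omega>)"
    and out: "sliding_output n T Z P Q G (eta L \<tau> M T) (\<lambda>u. \<xi> u \<omega>) (z0 \<omega>) = sl.result (\<lambda>u. \<xi> u \<omega>) n [] (z \<omega>) (zb \<omega>)"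
    and zz0: "z \<omega> (replicate i 0) = z0 \<omega>" for \<omega> i
    using ab[of \<omega>] by (auto simp: run_def z_def zb_def)
  interpret run: sliding_run P Z n T Q G L \<tau> M p gradp F S "\<lambda>\<omega> u. \<xi> u \<omega>" z zb
  proof
    show "1 \<le> n" by (rule n)
    show "sl.table_in (z \<omega>)" "sl.table_in (zb \<omega>)" for \<omega> by (rule tin)+
    show "f \<in> borel_measurable (F m')" if "m \<le> m'" "f \<in> borel_measurable (F m)"
      for m m' and f :: "'w \<Rightarrow> real^'d" by (rule mono[OF that])
    show "\<xi> u \<in> measurable (F m) S" if "u \<in> set (take m sl.nodes)" for m u
      by (rule sampleF[OF that])
    show "(\<lambda>(v, x). G i v x) \<in> borel_measurable (restrict_space borel Z \<Otimes>\<^sub>M S)" "continuous_on Z (Q i)"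
      if "i \<in> {1..n}" for i by (rule sfo_parts(4)[OF that], rule Q(1)[OF that])
  qed
  have run_adapted: "(\<forall>m\<in>{length ([] :: nat list list)..<length ([] :: nat list list) + length (oracle_calls T n [])}. adapted_at F z zb m (sl.nodes ! m))
    \<and> (\<lambda>\<omega>. sl.result (\<lambda>u. \<xi> u \<omega>) n [] (z \<omega>) (zb \<omega>)) \<in> borel_measurable (F (length ([] :: nat list list) + length (oracle_calls T n [])))
    \<and> (\<forall>r<n. (\<lambda>\<omega>. z \<omega> ([] @ [T (Suc (length ([] :: nat list)))] @ replicate r 0))
          \<in> borel_measurable (F (length ([] :: nat list list) + length (oracle_calls T n []))))"
  proof (rule run.adapted_run[where pre = "[]" and t = "[]" and d = n and post = "[]"])
    show "sl.nodes = [] @ oracle_calls T n [] @ []" by (simp only: nodes append_Nil append_Nil2)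
    show "length [] + n = n" "sl.admissible []" "adapted_at F z zb (length ([] :: nat list list)) []"
      by (simp_all add: sl.admissible_def adapted_at_def)
  qed (simp_all add: zz0 z0F tr)
  have ad: "adapted_at F z zb m (sl.nodes ! m)" if "m < ?N" for m
    using run_adapted that nodes by simp
  have outF: "(\<lambda>\<omega>. sl.result (\<lambda>u. \<xi> u \<omega>) n [] (z \<omega>) (zb \<omega>)) \<in> borel_measurable (F ?N)"
    using run_adapted nodes by simp
  define lev where "lev m = length (sl.nodes ! m)" for m
  have lev: "lev m \<in> {1..n}" "sl.nodes ! m \<noteq> []" if "m < ?N" for m
    using sl.nodes_admissible[OF nth_mem[OF that]] by (auto simp: lev_def)
  define w where "w m \<omega> = query_point (z \<omega>) (zb \<omega>) (sl.nodes ! m)" for m \<omega>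
  define X where "X m \<omega> = sl.err (\<lambda>u. \<xi> u \<omega>) (z \<omega>) (zb \<omega>) (sl.nodes ! m)" for m \<omega>
  have X_eq: "X m \<omega> = G (lev m) (w m \<omega>) (\<xi> (sl.nodes ! m) \<omega>) - gradp (lev m) (w m \<omega>)" for m \<omega>
    by (simp add: X_def w_def lev_def sl.err_def[OF tin])
  have wF: "w m \<in> borel_measurable (F m)" if "m < ?N" for m
    unfolding w_def[abs_def]
    by (rule run.query_measurable[OF ad[OF that] lev(2)[OF that]])
  have wZ: "w m \<omega> \<in> Z" for m \<omega>
    unfolding w_def by (rule run.query_in)
  have zF: "(\<lambda>\<omega>. z \<omega> (sl.nodes ! m)) \<in> borel_measurable (F m)" if "m < ?N" for m
    using ad[OF that] lev[OF that]
    unfolding adapted_at_def lev_def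
    by (metis atLeastAtMost_iff order_refl take_all)
  have XF: "X m \<in> borel_measurable (F (Suc m))" if m: "m < ?N" for m
  proof -
    have "sl.nodes ! m \<in> set (take (Suc m) sl.nodes)" using m by (simp add: take_Suc_conv_app_nth)
    then have sample: "\<xi> (sl.nodes ! m) \<in> measurable (F (Suc m)) S" by (rule sampleF)
    have "(\<lambda>\<omega>. G (lev m) (w m \<omega>) (\<xi> (sl.nodes ! m) \<omega>)) \<in> borel_measurable (F (Suc m))"
      unfolding w_def
      by (rule run.G_measurable[OF lev(1)[OF m] ad[OF m] lev(2)[OF m] sample mono[OF le_SucI[OF order_refl]]])
    moreover have "(\<lambda>\<omega>. gradp (lev m) (w m \<omega>)) \<in> borel_measurable (F (Suc m))"
      by (rule measurable_compose[OF run.into_Z[OF mono[OF le_SucI[OF order_refl] wF[OF m]] wZ]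
            borel_measurable_continuous_on_restrict[OF sl.mlipschitz_continuous[OF sfo_parts(3)[OF lev(1)[OF m]]]]])
    ultimately show ?thesis unfolding X_eq[abs_def] by (rule borel_measurable_diff)
  qed
  have past: "X l \<in> borel_measurable (F m)" if "l < m" "m < ?N" for l m
    by (rule mono[OF _ XF]) (use that in auto)
  have XP: "X m \<in> borel_measurable Pr" if "m < ?N" for m
    by (rule measurable_from_subalg[OF sub XF[OF that]])
  let ?D = "\<lambda>m \<omega>. (dual_mnorm P (X m \<omega>))\<^sup>2"
  have cond: "AE \<omega> in Pr. vec_cond_exp Pr (F m) (X m) \<omega> = 0"
    "AE \<omega> in Pr. nn_cond_exp Pr (F m) (\<lambda>\<omega>. ennreal (?D m \<omega>)) \<omega> \<le> ennreal ((\<sigma> (lev m))\<^sup>2)" if m: "m < ?N" for m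
  proof -
    have "w m \<in> borel_measurable (history Pr S zin \<xi> (oracle_calls T n []) m) \<and> (\<forall>\<omega>\<in>space Pr. w m \<omega> \<in> Z)"
      using wF[OF m] wZ unfolding F_def nodes by blast
    with sfo[OF lev(1)[OF m]] m
    show "AE \<omega> in Pr. vec_cond_exp Pr (F m) (X m) \<omega> = 0"
      "AE \<omega> in Pr. nn_cond_exp Pr (F m) (\<lambda>\<omega>. ennreal (?D m \<omega>)) \<omega> \<le> ennreal ((\<sigma> (lev m))\<^sup>2)"
      unfolding stochastic_oracle_def F_def nodes X_eq[abs_def] X_eq by blast+
  qed
  note D = sl.cond_second_moment[OF prob_Pr sub XP cond(2)]
  have centred: "centred_given Pr (F m) (X m)" if "m < ?N" for m
    by (rule sl.cond_centred[OF prob_Pr sub XP cond(1) D(1)]) (rule that)+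
  let ?E = "\<lambda>i \<omega>. dual_mnorm P (\<Sum>m<?N. sl.level_weight i m *\<^sub>R X m \<omega>)"
  have E: "integrable Pr (?E i)" "(\<integral>\<omega>. ?E i \<omega> \<partial>Pr) \<le> 2 powr (real i / 2) * \<sigma> i / sqrt (real (A i))"
    if i: "i \<in> {1..n}" for i
  proof -
    have sum: "(\<lambda>\<omega>. \<Sum>m<?N. sl.level_weight i m *\<^sub>R X m \<omega>) \<in> borel_measurable Pr"
      using XP by (intro borel_measurable_sum borel_measurable_scaleR borel_measurable_const) auto
    have "integrable Pr (\<lambda>\<omega>. (?E i \<omega>)\<^sup>2)
      \<and> (\<integral>\<omega>. (?E i \<omega>)\<^sup>2 \<partial>Pr) \<le> (\<Sum>m<?N. (sl.level_weight i m)\<^sup>2 * (\<sigma> (lev m))\<^sup>2)"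
      by (rule sl.martingale_second_moment[where N = ?N and F = F]) (use XP sub past centred D in auto)
    then have i2: "integrable Pr (\<lambda>\<omega>. (?E i \<omega>)\<^sup>2)"
      and b2: "(\<integral>\<omega>. (?E i \<omega>)\<^sup>2 \<partial>Pr) \<le> (\<Sum>m<?N. (sl.level_weight i m)\<^sup>2 * (\<sigma> (lev m))\<^sup>2)" by auto
    note fm = first_moment_le_sqrt[OF sl.dual_measurable[OF sum] i2 b2]
    show "integrable Pr (?E i)" by (rule fm(1))
    show "(\<integral>\<omega>. ?E i \<omega> \<partial>Pr) \<le> 2 powr (real i / 2) * \<sigma> i / sqrt (real (A i))"
      using order_trans[OF fm(2) sl.level_weight_sum_le[OF i, of \<sigma>, folded lev_def]] sigma_nonneg[OF i]
      by (simp add: A_def)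
  qed
  obtain B where B: "\<And>v. v \<in> Z \<Longrightarrow> norm v \<le> B" using Z(4) by (auto simp: bounded_iff)
  let ?Y = "\<lambda>m \<omega>. sl.W (sl.nodes ! m) *\<^sub>R (z0 \<omega> - z \<omega> (sl.nodes ! m))"
  have Y: "integrable Pr (\<lambda>\<omega>. ?Y m \<omega> \<bullet> X m \<omega>)" "(\<integral>\<omega>. ?Y m \<omega> \<bullet> X m \<omega> \<partial>Pr) = 0" if m: "m < ?N" for m
  proof -
    have YF: "?Y m \<in> borel_measurable (F m)"
      by (rule borel_measurable_scaleR[OF borel_measurable_const borel_measurable_diff[OF z0F zF[OF m]]])
    have "(\<lambda>\<omega>. (norm (?Y m \<omega>))\<^sup>2) \<in> borel_measurable Pr"
      using measurable_from_subalg[OF sub YF] by measurable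
    moreover have "(norm (?Y m \<omega>))\<^sup>2 \<le> (sl.W (sl.nodes ! m) * (B + B))\<^sup>2" for \<omega>
    proof (rule power_mono)
      have "norm (z0 \<omega> - z \<omega> (sl.nodes ! m)) \<le> B + B"
        using norm_triangle_ineq4 B[OF z0Z] B tin(1)[unfolded sl.table_in_def] by (meson add_mono order_trans)
      then show "norm (?Y m \<omega>) \<le> sl.W (sl.nodes ! m) * (B + B)"
        by (simp add: less_imp_le)
    qed simp
    ultimately have "integrable Pr (\<lambda>\<omega>. (norm (?Y m \<omega>))\<^sup>2)"
      by (intro integrable_const_bound[of _ "(sl.W (sl.nodes ! m) * (B + B))\<^sup>2"]) auto
    then show "integrable Pr (\<lambda>\<omega>. ?Y m \<omega> \<bullet> X m \<omega>)" "(\<integral>\<omega>. ?Y m \<omega> \<bullet> X m \<omega> \<partial>Pr) = 0"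
      using centred[OF m, unfolded centred_given_def, rule_format, OF YF] by auto
  qed
  let ?a = "\<lambda>m. sl.W (sl.nodes ! m) / alpha_prod (sl.nodes ! m) / (2 * \<tau> (lev m))"
  define bound where "bound \<omega> = (\<Sum>i=1..n. sl.K i / 2) * \<Omega> + (\<Sum>m<?N. ?a m * ?D m \<omega>)
      + sqrt \<Omega> * (\<Sum>i=1..n. ?E i \<omega>) + (\<Sum>m<?N. ?Y m \<omega> \<bullet> X m \<omega>)" for \<omega>
  have i1: "integrable Pr (\<lambda>\<omega>. \<Sum>m<?N. ?a m * ?D m \<omega>)" using D(1) by auto
  have i2: "integrable Pr (\<lambda>\<omega>. sqrt \<Omega> * (\<Sum>i=1..n. ?E i \<omega>))" using E(1) by auto
  have i3: "integrable Pr (\<lambda>\<omega>. \<Sum>m<?N. ?Y m \<omega> \<bullet> X m \<omega>)" using Y(1) by auto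
  have bound_int: "integrable Pr bound"
    unfolding bound_def[abs_def] by (intro Bochner_Integration.integrable_add i1 i2 i3 integrable_const)
  have "(\<integral>\<omega>. bound \<omega> \<partial>Pr) = (\<Sum>i=1..n. sl.K i / 2) * \<Omega> + (\<integral>\<omega>. (\<Sum>m<?N. ?a m * ?D m \<omega>) \<partial>Pr)
      + (\<integral>\<omega>. sqrt \<Omega> * (\<Sum>i=1..n. ?E i \<omega>) \<partial>Pr) + (\<integral>\<omega>. (\<Sum>m<?N. ?Y m \<omega> \<bullet> X m \<omega>) \<partial>Pr)"
    unfolding bound_def using i1 i2 i3 by (simp add: prob_space del: integral_mult_right_zero)
  also have "(\<integral>\<omega>. (\<Sum>m<?N. ?a m * ?D m \<omega>) \<partial>Pr) = (\<Sum>m<?N. ?a m * (\<integral>\<omega>. ?D m \<omega> \<partial>Pr))"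
    using D(1) by (subst Bochner_Integration.integral_sum) auto
  also have "(\<integral>\<omega>. sqrt \<Omega> * (\<Sum>i=1..n. ?E i \<omega>) \<partial>Pr) = sqrt \<Omega> * (\<Sum>i=1..n. (\<integral>\<omega>. ?E i \<omega> \<partial>Pr))"
    using E(1) by (subst integral_mult_right_zero, subst Bochner_Integration.integral_sum) auto
  also have "(\<integral>\<omega>. (\<Sum>m<?N. ?Y m \<omega> \<bullet> X m \<omega>) \<partial>Pr) = 0"
  proof -
    have "(\<integral>\<omega>. (\<Sum>m<?N. ?Y m \<omega> \<bullet> X m \<omega>) \<partial>Pr) = (\<Sum>m<?N. \<integral>\<omega>. ?Y m \<omega> \<bullet> X m \<omega> \<partial>Pr)"
      by (rule Bochner_Integration.integral_sum) (simp only: Y(1) lessThan_iff)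
    also have "\<dots> = 0" by (rule sum.neutral) (use Y(2) in blast)
    finally show ?thesis .
  qed
  finally have "(\<integral>\<omega>. bound \<omega> \<partial>Pr) = (\<Sum>i=1..n. sl.K i / 2) * \<Omega> + (\<Sum>m<?N. ?a m * (\<integral>\<omega>. ?D m \<omega> \<partial>Pr))
      + sqrt \<Omega> * (\<Sum>i=1..n. (\<integral>\<omega>. ?E i \<omega> \<partial>Pr))" by simp
  also have "\<dots> \<le> ((\<Sum>i=1..n. 2 ^ (2 * i - 1) * (L i + \<tau> i) * \<Omega> / (real (A i))\<^sup>2)
      + (\<Sum>i=1..n. 2 ^ (i - 1) * M i * \<Omega> / real (A i)))
      + (\<Sum>i=1..n. (\<sigma> i)\<^sup>2 * real (A i) / (2 * \<tau> i))
      + sqrt \<Omega> * (\<Sum>i=1..n. 2 powr (real i / 2) * \<sigma> i / sqrt (real (A i)))"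
  proof (intro add_mono mult_left_mono sum_mono E(2))
    show "(\<Sum>i=1..n. sl.K i / 2) * \<Omega> \<le> (\<Sum>i=1..n. 2 ^ (2 * i - 1) * (L i + \<tau> i) * \<Omega> / (real (A i))\<^sup>2)
      + (\<Sum>i=1..n. 2 ^ (i - 1) * M i * \<Omega> / real (A i))"
      unfolding A_def by (rule sl.K_sum_le) (use Omega_pos in simp)
    show "(\<Sum>m<?N. ?a m * (\<integral>\<omega>. ?D m \<omega> \<partial>Pr)) \<le> (\<Sum>i=1..n. (\<sigma> i)\<^sup>2 * real (A i) / (2 * \<tau> i))"
      unfolding A_def lev_def by (rule sl.variance_sum_le) (use D(2) in \<open>simp add: lev_def\<close>)
  qed (use Omega_pos in auto)
  finally have bound_le: "(\<integral>\<omega>. bound \<omega> \<partial>Pr) \<le> \<dots>" .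
  have zout: "zout \<omega> = sl.result (\<lambda>u. \<xi> u \<omega>) n [] (z \<omega>) (zb \<omega>)" if "\<omega> \<in> space Pr" for \<omega>
    using out[of \<omega>] that by (simp add: zout_def z0_def)
  \<comment> \<open>A level with \<open>\<tau> = 0\<close> has \<open>\<sigma> = 0\<close>, so its oracle errors vanish almost surely.\<close>
  have "AE \<omega> in Pr. \<forall>m. m < ?N \<longrightarrow> \<tau> (lev m) = 0 \<longrightarrow> X m \<omega> = 0"
    unfolding AE_all_countable
  proof
    fix m
    show "AE \<omega> in Pr. m < ?N \<longrightarrow> \<tau> (lev m) = 0 \<longrightarrow> X m \<omega> = 0"
    proof (cases "m < ?N \<and> \<tau> (lev m) = 0")
      case True
      then have m: "m < ?N" and "\<sigma> (lev m) = 0"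
        using tau_pos[of "lev m"] sigma_nonneg[of "lev m"] lev(1)[of m] by force+
      then have "(\<integral>\<omega>. ?D m \<omega> \<partial>Pr) = 0" using D(2)[OF m m] by (intro antisym) auto
      then have "AE \<omega> in Pr. ?D m \<omega> = 0"
        using integral_nonneg_eq_0_iff_AE[OF D(1)[OF m m]] by auto
      moreover obtain C where "\<And>v. norm v \<le> C * dual_mnorm P v" using sl.norm_le_dual_mnorm by blast
      then have "X m \<omega> = 0" if "?D m \<omega> = 0" for \<omega>
        using that by (metis mult_zero_right norm_le_zero_iff zero_eq_power2)
      ultimately show ?thesis by (auto elim: eventually_mono)
    qed auto
  qed
  then have gap_le: "AE \<omega> in Pr. gap \<omega> \<le> bound \<omega>"
    using Omega AE_space
  proof eventually_elim
    case (elim \<omega>)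
    have z0: "z0 \<omega> = zin \<omega>" using elim(3) by (simp add: z0_def)
    have bdd: "bdd_above ((\<lambda>v. (mnorm P (zin \<omega> - v))\<^sup>2) ` Z)"
      unfolding sl.mnorm_sq
      by (intro bounded_imp_bdd_above compact_imp_bounded compact_continuous_image sl.compact_Z
          continuous_on_compose2[OF sl.continuous_q[of UNIV]] continuous_intros) auto
    show ?case
      unfolding gap_def
    proof (rule cSUP_least[OF Z(1)])
      fix v assume v: "v \<in> Z"
      have Om: "sl.q (v - z0 \<omega>) \<le> \<Omega>"
        using cSUP_upper[OF v bdd] elim(2) unfolding sl.mnorm_sq z0 sl.q_diff_commute[of v] by linarith
      have err0: "sl.err (\<lambda>u. \<xi> u \<omega>) (z \<omega>) (zb \<omega>) u = 0" if "u \<in> set sl.nodes" "\<tau> (length u) = 0" for u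
        using elim(1) that unfolding in_set_conv_nth X_def lev_def by blast
      show "(\<Sum>i=1..n. p i (zout \<omega>)) - (\<Sum>i=1..n. p i v) + (\<Sum>i=1..n. Q i v) \<bullet> (zout \<omega> - v) \<le> bound \<omega>"
        using sl.pathwise_bound[OF tin tr zz0 v err0 Om]
        unfolding bound_def X_def lev_def zout[OF elim(3)] .
    qed
  qed
  let ?f = "\<lambda>x. \<Sum>i=1..n. p i x" and ?R = "\<lambda>x. \<Sum>i=1..n. Q i x"
  let ?H = "\<lambda>x. SUP v\<in>Z. ?f x - ?f v + ?R v \<bullet> (x - v)"
  have H: "continuous_on Z ?H"
    by (rule sl.gap_continuous) (intro continuous_on_sum sl.p_continuous Q(1); assumption)+
  have outZ: "sl.result (\<lambda>u. \<xi> u \<omega>) n [] (z \<omega>) (zb \<omega>) \<in> Z" for \<omega>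
    using tin n by (auto simp: sl.result_def sl.table_in_def)
  have gap_H: "gap \<omega> = ?H (sl.result (\<lambda>u. \<xi> u \<omega>) n [] (z \<omega>) (zb \<omega>))" if "\<omega> \<in> space Pr" for \<omega>
    unfolding gap_def zout[OF that] ..
  have gap_meas: "gap \<in> borel_measurable Pr"
  proof -
    have "(\<lambda>\<omega>. ?H (sl.result (\<lambda>u. \<xi> u \<omega>) n [] (z \<omega>) (zb \<omega>))) \<in> borel_measurable Pr"
      by (rule measurable_compose[OF run.into_Z[OF measurable_from_subalg[OF sub outF] outZ] borel_measurable_continuous_on_restrict[OF H]])
    then show ?thesis by (rule measurable_cong[THEN iffD1, rotated]) (simp add: gap_H)
  qed
  obtain C where "\<And>x. x \<in> Z \<Longrightarrow> norm (?H x) \<le> C"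
    using compact_imp_bounded[OF compact_continuous_image[OF H sl.compact_Z]] by (auto simp: bounded_iff)
  then have "norm (gap \<omega>) \<le> C" if "\<omega> \<in> space Pr" for \<omega>
    unfolding gap_H[OF that] using outZ by blast
  then have gap_int: "integrable Pr gap"
    by (intro integrable_const_bound[of _ C] gap_meas AE_I2) auto
  have "(\<integral>\<omega>. gap \<omega> \<partial>Pr) \<le> (\<integral>\<omega>. bound \<omega> \<partial>Pr)"
    by (rule integral_mono_AE[OF gap_int bound_int gap_le])
  then show ?thesis using gap_int bound_le by linarith
qed

end
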